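(* Let $\Gamma$ be a $Q$-polynomial distance-regular graph with diameter $D \ge 3$ and valency $k \ge 3$. Then the girth of $\Gamma$ is equal to $6$ if and only if $\Gamma$ is isomorphic either to the Odd graph on a set of cardinality $2D+1$, or to a generalized hexagon of order $(1,k-1)$.
   Context: All graphs are finite, undirected, connected, without loops or multiple edges; $\partial$ is the path-length distance and $D$ the diameter. $\Gamma_i(x)$ is the set of vertices at distance $i$ from $x$. $\Gamma$ is distance-regular if for all $0\le h,i,j\le D$ and all vertices $x,y$ with $\partial(x,y)=h$ the number $p^h_{ij}=|\Gamma_i(x)\cap\Gamma_j(y)|$ depends only on $h,i,j$. For such $\Gamma$ let $A_0,\dots,A_D$ be the distance matrices (with $(A_i)_{xy}=1$ iff $\partial(x,y)=i$), spanning the Bose–Mesner algebra $M$, and let $E_0=|X|^{-1}J,E_1,\dots,E_D$ be the primitive idempotents of $M$. The Krein parameters $q^h_{ij}$ are defined by $E_i\circ E_j=|X|^{-1}\sum_h q^h_{ij}E_h$ ($\circ$ = entrywise product). $\Gamma$ is $Q$-polynomial (with respect to the ordering $E_0,\dots,E_D$) if for all distinct $0\le i,j\le D$, $q^1_{ij}\ne 0$ iff $|i-j|=1$; $\Gamma$ is called $Q$-polynomial if it is $Q$-polynomial with respect to some ordering. The Odd graph on a $(2D+1)$-set has as vertices the $D$-subsets, adjacent when disjoint. A generalized hexagon of order $(1,k-1)$ is (equivalently) a bipartite distance-regular graph of diameter $3$ with intersection array $\{k,k-1,k-1;1,1,k\}$. *)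

theory Defs
  imports "HOL-Analysis.Analysis" "Graph_Theory.Graph_Theory"
begin

text \<open>
  Finite simple undirected graphs are the library's \<open>pair_graph\<close>s: an undirected edge is
  represented by the two arcs \<open>(x, y)\<close> and \<open>(y, x)\<close>.
\<close>

subsection \<open>Distance, diameter, girth\<close>

definition gdist :: "'a pair_pre_digraph \<Rightarrow> 'a \<Rightarrow> 'a \<Rightarrow> nat" where
  "gdist G x y = (LEAST n. \<exists>p. pre_digraph.awalk (with_proj G) x p y \<and> length p = n)"

definition graph_diameter :: "'a pair_pre_digraph \<Rightarrow> nat" where
  "graph_diameter G = Max {gdist G x y | x y. x \<in> pverts G \<and> y \<in> pverts G}"

definition sphere_at :: "'a pair_pre_digraph \<Rightarrow> nat \<Rightarrow> 'a \<Rightarrow> 'a set" where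
  "sphere_at G i x = {y \<in> pverts G. gdist G x y = i}"

definition has_valency :: "'a pair_pre_digraph \<Rightarrow> nat \<Rightarrow> bool" where
  "has_valency G k \<longleftrightarrow> (\<forall>x \<in> pverts G. card {y. (x, y) \<in> parcs G} = k)"

text \<open>
  The library's \<open>cycle\<close> is the directed notion, which also holds of the closed walks
  \<open>x, y, x\<close> along a single edge; the bound on the length excludes them. The girth of a
  forest is \<open>\<infinity>\<close>.
\<close>
definition girth :: "'a pair_pre_digraph \<Rightarrow> enat" where
  "girth G = (INF p \<in> {p. pre_digraph.cycle (with_proj G) p \<and> 3 \<le> length p}. enat (length p))"

definition bipartite :: "'a pair_pre_digraph \<Rightarrow> bool" where
  "bipartite G \<longleftrightarrow> (\<exists>A B. A \<union> B = pverts G \<and> A \<inter> B = {} \<and>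
     (\<forall>(x, y) \<in> parcs G. x \<in> A \<and> y \<in> B \<or> x \<in> B \<and> y \<in> A))"

subsection \<open>Distance-regular graphs\<close>

definition distance_regular :: "'a pair_pre_digraph \<Rightarrow> bool" where
  "distance_regular G \<longleftrightarrow> pair_graph G \<and> Digraph_Component.connected (with_proj G) \<and>
     (\<forall>h \<le> graph_diameter G. \<forall>i \<le> graph_diameter G. \<forall>j \<le> graph_diameter G. \<exists>p.
        \<forall>x \<in> pverts G. \<forall>y \<in> pverts G. gdist G x y = h \<longrightarrow>
          card (sphere_at G i x \<inter> sphere_at G j y) = p)"

text \<open>\<open>intersection_number G h i j\<close> is $p^h_{ij}$.\<close>
definition intersection_number :: "'a pair_pre_digraph \<Rightarrow> nat \<Rightarrow> nat \<Rightarrow> nat \<Rightarrow> nat" where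
  "intersection_number G h i j = (THE p.
     \<forall>x \<in> pverts G. \<forall>y \<in> pverts G. gdist G x y = h \<longrightarrow>
       card (sphere_at G i x \<inter> sphere_at G j y) = p)"

text \<open>
  The intersection array is $\{b_0, \ldots, b_{D-1}; c_1, \ldots, c_D\}$ with
  $b_i = p^i_{1,i+1}$ and $c_i = p^i_{1,i-1}$; the two lists are indexed from 0.
\<close>
definition has_intersection_array :: "'a pair_pre_digraph \<Rightarrow> nat list \<Rightarrow> nat list \<Rightarrow> bool" where
  "has_intersection_array G bs cs \<longleftrightarrow>
     length bs = graph_diameter G \<and> length cs = graph_diameter G \<and>
     (\<forall>i < graph_diameter G. bs ! i = intersection_number G i 1 (Suc i)) \<and>
     (\<forall>i < graph_diameter G. cs ! i = intersection_number G (Suc i) 1 i)"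

subsection \<open>The Bose--Mesner algebra and the $Q$-polynomial property\<close>

text \<open>
  The graphs here have the whole finite type \<open>'v\<close> as vertex set, so that matrices with rows
  and columns indexed by the vertices are the library's \<open>real^'v^'v\<close>.
\<close>

definition distance_matrix :: "('v::finite) pair_pre_digraph \<Rightarrow> nat \<Rightarrow> real^'v^'v" where
  "distance_matrix G i = (\<chi> x y. if gdist G x y = i then 1 else 0)"

definition bose_mesner :: "('v::finite) pair_pre_digraph \<Rightarrow> (real^'v^'v) set" where
  "bose_mesner G = span (distance_matrix G ` {..graph_diameter G})"

definition primitive_idempotent :: "(real^'v^'v) set \<Rightarrow> real^'v^('v::finite) \<Rightarrow> bool" where
  "primitive_idempotent M e \<longleftrightarrow> e \<in> M \<and> e \<noteq> 0 \<and> e ** e = e \<and>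
     \<not> (\<exists>f \<in> M. \<exists>g \<in> M. f \<noteq> 0 \<and> g \<noteq> 0 \<and> f ** f = f \<and> g ** g = g \<and>
          f ** g = 0 \<and> g ** f = 0 \<and> e = f + g)"

text \<open>
  An ordering $E_0, E_1, \ldots, E_D$ of the primitive idempotents of the Bose--Mesner algebra
  is understood to start with $E_0 = |X|^{-1} J$.
\<close>
definition idempotent_ordering ::
    "('v::finite) pair_pre_digraph \<Rightarrow> (nat \<Rightarrow> real^'v^'v) \<Rightarrow> bool" where
  "idempotent_ordering G E \<longleftrightarrow>
     bij_betw E {..graph_diameter G} {e. primitive_idempotent (bose_mesner G) e} \<and>
     E 0 = (\<chi> x y. 1 / real CARD('v))"

definition entrywise_product :: "real^'v^'v \<Rightarrow> real^'v^'v \<Rightarrow> real^'v^('v::finite)" where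
  "entrywise_product A B = (\<chi> x y. A $ x $ y * B $ x $ y)"

text \<open>
  \<open>krein_parameter G E h i j\<close> is $q^h_{ij}$. The condition that the coefficient function
  vanishes beyond the diameter just makes it unique.
\<close>
definition krein_parameter ::
    "('v::finite) pair_pre_digraph \<Rightarrow> (nat \<Rightarrow> real^'v^'v) \<Rightarrow> nat \<Rightarrow> nat \<Rightarrow> nat \<Rightarrow> real" where
  "krein_parameter G E h i j = (THE q.
     (\<forall>l > graph_diameter G. q l = 0) \<and>
     entrywise_product (E i) (E j) =
       (1 / real CARD('v)) *\<^sub>R (\<Sum>l \<le> graph_diameter G. q l *\<^sub>R E l)) h"

definition Q_polynomial_wrt ::
    "('v::finite) pair_pre_digraph \<Rightarrow> (nat \<Rightarrow> real^'v^'v) \<Rightarrow> bool" where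
  "Q_polynomial_wrt G E \<longleftrightarrow>
     (\<forall>i \<le> graph_diameter G. \<forall>j \<le> graph_diameter G. i \<noteq> j \<longrightarrow>
        (krein_parameter G E 1 i j \<noteq> 0 \<longleftrightarrow> \<bar>int i - int j\<bar> = 1))"

definition Q_polynomial :: "('v::finite) pair_pre_digraph \<Rightarrow> bool" where
  "Q_polynomial G \<longleftrightarrow> (\<exists>E. idempotent_ordering G E \<and> Q_polynomial_wrt G E)"

subsection \<open>The two families\<close>

text \<open>The Odd graph on a set of cardinality \<open>2 * d + 1\<close>.\<close>
definition odd_graph :: "nat \<Rightarrow> nat set pair_pre_digraph" where
  "odd_graph d =
     \<lparr> pverts = {S. S \<subseteq> {..<2 * d + 1} \<and> card S = d},
       parcs = {(S, T). S \<subseteq> {..<2 * d + 1} \<and> card S = d \<and>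
                        T \<subseteq> {..<2 * d + 1} \<and> card T = d \<and> S \<inter> T = {}} \<rparr>"

text \<open>
  Generalized hexagons of order \<open>(1, k - 1)\<close>, as bipartite distance-regular graphs with
  intersection array $\{k, k-1, k-1; 1, 1, k\}$.
\<close>
definition generalized_hexagon :: "nat \<Rightarrow> 'a pair_pre_digraph \<Rightarrow> bool" where
  "generalized_hexagon k G \<longleftrightarrow> distance_regular G \<and> bipartite G \<and> graph_diameter G = 3 \<and>
     has_intersection_array G [k, k - 1, k - 1] [1, 1, k]"

end

theory Submission
  imports Defs
begin

text \<open>
  Write $t_i$ for the entries of $E_1$ at distance $i$. The $Q$-polynomial property makes
  $E_i A^* E_j$ vanish for $|i - j| > 1$, where $A^*$ is a dual adjacency matrix, and this gives the
  balanced-set identity: if $C(y, z)$ is the set of neighbours of $y$ nearer to $z$, then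
  $\sum_{w \in C(y,z)} t_{d(x,w)} - \sum_{w \in C(z,y)} t_{d(x,w)}$ is a multiple, depending only on
  $d(y, z)$, of $t_{d(x,y)} - t_{d(x,z)}$.

  Let the girth be 6. Placing $x$ next to $y$ shows $a_h = 0$ for $h < D$ and yields a recurrence for
  the $t_i$. Placing $x$ at distance 2 from $y$ shows that the sets $C(z, x)$ meet in constant numbers,
  hence form symmetric designs; their integrality forces $c_3 = k$, which gives the generalized
  hexagon, or $c_3 = 2$ and the $t_i$ of the Odd graph. In the latter case the vectors
  $E_1 \hat y + E_1 \hat u$, for $y$ adjacent to $u$, take exactly $2D + 1$ values, and the values
  missing at a vertex form the $D$-set that represents it.
\<close>

subsection \<open>Arithmetic of the parameters\<close>

text \<open>The entries \<open>t i\<close> are real numbers, so integrality has to come from the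
  block intersections \<open>e\<close> and \<open>f\<close> of two designs, one seen from distance 2
  and one from distance 4. For \<open>D \<ge> 4\<close> outside the Odd case,
  \<open>g = f - e - 1\<close> and \<open>r 3\<close> determine the ratios of the differences of
  \<open>t 0\<close>, ..., \<open>t 4\<close>, and \<open>r 3\<close> is an integer, being rational
  and a root of a monic integer quadratic. The contradiction then depends on how far the sequence
  continues. For \<open>D \<ge> 6\<close>, block intersections at distances 4 and 5 make two further
  ratios integral, and these conflict. For \<open>D = 4\<close> and \<open>D = 5\<close> the
  recurrence is cut off and the last sphere supplies the contradiction. For \<open>D = 3\<close>
  there is no outer design; the integrality of the size of the third sphere takes its place.

  The vectors attached to edges form a regular simplex: any two distinct ones have the same inner
  product, and positivity of the squared norm of their sum bounds their number by
  \<open>2 * D + 1\<close>. The edges at the two ends of a single edge already account for that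
  many.\<close>

lemma rational_quadratic_root_int:
  fixes x :: real and a b :: int
  assumes "x \<in> \<rat>" "x\<^sup>2 + a * x + b = 0"
  shows "x \<in> \<int>"
proof -
  let ?p = "[:of_int b, of_int a, 1:] :: real poly"
  have "poly ?p x = 0" using assms(2) by (simp add: power2_eq_square algebra_simps)
  moreover have "lead_coeff ?p = 1" by simp
  moreover have "coeff ?p i \<in> \<int>" for i by (auto simp: coeff_pCons split: nat.splits)
  ultimately have "algebraic_int x" by (intro algebraic_int.intros) auto
  then show ?thesis using rational_algebraic_int_is_int assms(1) by blast
qed

text \<open>In units of \<open>t 2 - t 3\<close>, the unknowns are \<open>A = t 1 - t 2\<close>, \<open>T = t 0 - t 1\<close> and
  \<open>X = t 4 - t 3\<close>.\<close>
lemma base_relation: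
  fixes A T X c r :: real
  assumes "r * (T + A + 1) = c * A" "T + (c - 1) = r * A"
  shows "A * (r\<^sup>2 + r - c) = r * (c - 2)"
proof -
  have "T = r * A - (c - 1)" using assms(2) by simp
  then show ?thesis using assms(1) by (simp add: power2_eq_square) (simp add: algebra_simps)
qed

text \<open>The five equations are the balanced-set identity at distance 3 with \<open>x\<close>
  equal to \<open>y\<close>, in \<open>C y z\<close>, and beyond \<open>y\<close>, followed by the
  two block counts. Combining the last two gives \<open>g * (X - 1) = A + 1\<close>. Inserted into
  \<open>base_relation\<close> this produces a product with the factor \<open>c + r\<close>, which
  vanishes only for the excluded values \<open>c = 2\<close>, \<open>r = -2\<close>; the other
  factor is the quadratic for \<open>r\<close>.\<close>

lemma parameter_relations:
  fixes A T X c r e f g :: real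
  assumes 1: "r * (T + A + 1) = c * A" and 2: "T + (c - 1) = r * A" and 3: "c = r * (A + 1 - X)"
    and 4: "A - (c - 1) * X + e * (X - 1) = r" and 5: "f * (X - 1) = c * X + r"
    and nz: "A \<noteq> 0" "A + 1 \<noteq> 0" "X \<noteq> 1" and c: "2 \<le> c"
    and g: "g = f - e - 1"
    and not_odd: "\<not> (c = 2 \<and> r = -2)"
  shows "g \<noteq> 0" "g \<noteq> 1" "r \<noteq> 0" "g * c = r * (r + 2 * g - 1)" "(g - 1) * A = r + 2 * g"
    "g * (X - 1) = A + 1" "e = c - 2 + (g - 1) * (r - 1)"
proof -
  have r0: "r \<noteq> 0" using 3 c by auto
  then show "r \<noteq> 0" .
  have b: "A * (r\<^sup>2 + r - c) = r * (c - 2)" using base_relation[OF 1 2] .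
  show gX: "g * (X - 1) = A + 1" using 4 5 unfolding g by (simp add: algebra_simps)
  then show g0: "g \<noteq> 0" using nz by auto
  have i: "g * (r * A - c) = r * (A + 1)"
  proof -
    have "r * (X - 1) = r * A - c" using 3 by (simp add: algebra_simps)
    moreover have "r * (g * (X - 1)) = r * (A + 1)" using gX by simp
    ultimately show ?thesis by (metis mult.left_commute)
  qed
  have cr: "c \<noteq> - r"
  proof
    assume "c = - r"
    then have "r * (A * (r + 2)) = r * (- (r + 2))" using b by (simp add: power2_eq_square algebra_simps)
    then have "A * (r + 2) = - (r + 2)" using r0 mult_left_cancel by blast
    then have "(A + 1) * (r + 2) = 0" by (simp add: algebra_simps)
    then show False using nz not_odd \<open>c = - r\<close> by auto
  qed
  show g1: "g \<noteq> 1" using i cr by (auto simp: algebra_simps)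
  have Ar: "A * (r * (g - 1)) = r + g * c" using i by (simp add: algebra_simps)
  have "(A * (r * (g - 1))) * (r\<^sup>2 + r - c) = r * (c - 2) * (r * (g - 1))"
    using b by (metis mult.assoc mult.commute)
  then have "(r\<^sup>2 + (2 * g - 1) * r - g * c) * (c + r) = 0"
    unfolding Ar by (simp add: power2_eq_square algebra_simps)
  moreover have "c + r \<noteq> 0" using cr by linarith
  ultimately have "r\<^sup>2 + (2 * g - 1) * r - g * c = 0" by simp
  then show q: "g * c = r * (r + 2 * g - 1)" by (simp add: power2_eq_square algebra_simps)
  have "r * ((g - 1) * A) = r * (r + 2 * g)" using Ar q by (simp add: algebra_simps)
  then show A: "(g - 1) * A = r + 2 * g" using r0 by simp
  have "e * (X - 1) = (c - 1) * X - A + r" using 4 by simp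
  then have "g * (e * (X - 1)) = g * ((c - 1) * X - A + r)" by simp
  then have "e * (g * (X - 1)) = g * ((c - 1) * (X - 1)) + g * (c - 1) - g * A + g * r"
    by (simp add: algebra_simps)
  then have "e * (A + 1) = (c - 1) * (A + 1) + g * (c - 1) - g * A + g * r"
    using gX by (metis mult.left_commute)
  then have "(e - c + 1) * (A + 1) = g * (c - 1) - g * A + g * r" by (simp add: algebra_simps)
  then have "(g - 1) * ((e - c + 1) * (A + 1)) = (g - 1) * (g * (c - 1) - g * A + g * r)" by simp
  then have "(e - c + 1) * ((g - 1) * (A + 1)) = g * (g - 1) * (c - 1) - g * ((g - 1) * A) + g * (g - 1) * r"
    by (simp add: algebra_simps)
  moreover have gA1: "(g - 1) * (A + 1) = r + 3 * g - 1" using A by (simp add: algebra_simps)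
  ultimately have "(e - c + 1) * (r + 3 * g - 1) = (g - 1) * (g * c) - g * (g - 1) - g * (r + 2 * g) + g * (g - 1) * r"
    unfolding gA1 A by (simp add: algebra_simps)
  also have "\<dots> = ((g - 1) * (r - 1) - 1) * (r + 3 * g - 1)"
    unfolding q by (simp add: algebra_simps)
  \<comment> \<open>The cancelled factor \<open>r + 3 * g - 1\<close> equals
    \<open>(g - 1) * (A + 1)\<close>, which is nonzero.\<close>
  finally have "e - c + 1 = (g - 1) * (r - 1) - 1" using gA1 nz g1 by auto
  then show "e = c - 2 + (g - 1) * (r - 1)" by simp
qed

text \<open>The formula for \<open>e\<close> exhibits \<open>r\<close> as rational, and the
  quadratic \<open>g * c = r * (r + 2 * g - 1)\<close> is monic in \<open>r\<close> with integer
  coefficients, so \<open>r\<close> is an integer. The signs in the two design counts then fix the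
  ranges of \<open>g\<close> and \<open>p\<close>.\<close>

lemma parameters_integral:
  fixes A T X r :: real and c e f k c4 :: nat
  assumes 1: "r * (T + A + 1) = c * A" and 2: "T + (real c - 1) = r * A" and 3: "c = r * (A + 1 - X)"
    and 4: "A - (real c - 1) * X + e * (X - 1) = r" and 5: "f * (X - 1) = c * X + r"
    and nz: "A \<noteq> 0" "A + 1 \<noteq> 0" "X \<noteq> 1" and c: "2 \<le> c" "c < k" and k: "3 \<le> k" and c4: "2 \<le> c4"
    and e: "(k - 2) * e = (c - 1) * (c - 2)" and f: "(c4 - 1) * f = c * (c - 1)"
    and not_odd: "\<not> (c = 2 \<and> r = -2)"
  obtains g p :: int where "2 \<le> g" "2 \<le> p" "r = 1 - g\<^sup>2 - g - p" "g * c = r * (r + 2 * g - 1)"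
    "(g - 1) * A = r + 2 * g" "g * (X - 1) = A + 1"
    "(real k - 2) * (p - 1) = (real c - 1) * (p - 1 + g\<^sup>2 - g)"
    "(real c4 - 1) * p = (real c - 1) * (p + g\<^sup>2 - g)"
proof -
  define g :: int where "g = int f - int e - 1"
  have gr: "real_of_int g = real f - real e - 1" by (simp add: g_def)
  have c': "2 \<le> real c" using c by simp
  have not_odd': "\<not> (real c = 2 \<and> r = -2)" using not_odd by simp
  note P = parameter_relations[OF 1 2 3 4 5 nz c' gr not_odd']
  have e': "(real k - 2) * e = (real c - 1) * (real c - 2)"
    using arg_cong[OF e, of real] c k by (simp add: of_nat_diff)
  have f': "(real c4 - 1) * f = real c * (real c - 1)"
    using arg_cong[OF f, of real] c c4 by (simp add: of_nat_diff)
  \<comment> \<open>For \<open>r = 1\<close> the formulas give \<open>c = 2\<close> and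
    \<open>e = 0\<close>, so \<open>f\<close> divides 2 and \<open>g = f - 1\<close> is one of the
    excluded values 0 and 1.\<close>
  have r1: "r \<noteq> 1"
  proof
    assume "r = 1"
    then have "c = 2" "e = 0" using P(1,4,7) by (auto simp: field_simps)
    then have "f \<le> 2" using f by (simp add: dvd_imp_le[OF dvdI])
      (metis dvd_imp_le dvd_triv_right zero_less_numeral)
    then have "g \<in> {-1, 0, 1}" using \<open>e = 0\<close> by (auto simp: g_def)
    moreover have "g \<noteq> -1"
    proof
      assume "g = -1"
      then show False using f \<open>c = 2\<close> \<open>e = 0\<close> by (simp add: g_def)
    qed
    ultimately show False using P(1,2) by auto
  qed
  have c3: "3 \<le> c"
  proof (rule ccontr)
    assume "\<not> 3 \<le> c"
    then have c2: "c = 2" using c by simp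
    then have "e = 0" using e k by simp
    then have "(g - 1) * (r - 1) = 0" using P(7) c2 by simp
    then show False using P(2) r1 by simp
  qed
  have e1: "1 \<le> e" using e c3 by (cases e) auto
  have "r = (real e - real c + 2) / (g - 1) + 1" using P(2,7) by (simp add: field_simps)
  then have "r \<in> \<rat>" by (metis Rats_1 Rats_add Rats_diff Rats_divide Rats_of_int Rats_of_nat Rats_number_of)
  moreover have "r\<^sup>2 + (2 * g - 1) * r + (- g * int c) = 0"
    using P(4) by (simp add: power2_eq_square algebra_simps)
  ultimately have "r \<in> \<int>" using rational_quadratic_root_int[of r "2 * g - 1" "- g * int c"] by simp
  then obtain s :: int where s: "r = of_int s" by (auto simp: Ints_def)
  \<comment> \<open>\<open>N\<close> is the factor common to both block intersections:
    \<open>g * e = (s - 1) * N\<close> and \<open>g * f = s * (N - 1)\<close>. After this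
    substitution the factors \<open>s - 1\<close> and \<open>s\<close> cancel from the design
    counts.\<close>
  define N where "N = g\<^sup>2 + g + s"
  have eg: "g * int e = (s - 1) * N"
  proof -
    have "g * real e = g * c - 2 * g + g * (g - 1) * (r - 1)" by (subst P(7)) (simp add: algebra_simps)
    also have "\<dots> = (r - 1) * (g\<^sup>2 + g + r)" using P(4) by (simp add: power2_eq_square algebra_simps)
    finally have "real_of_int (g * int e) = real_of_int ((s - 1) * N)" by (simp add: s N_def)
    then show ?thesis by linarith
  qed
  have cg: "g * int c = s * (s + 2 * g - 1)"
  proof -
    have "real_of_int (g * int c) = real_of_int (s * (s + 2 * g - 1))" using P(4) by (simp add: s)
    then show ?thesis by linarith
  qed
  have s1: "s \<noteq> 1" "s \<noteq> 0" "g \<noteq> 0" "g \<noteq> 1" using r1 P s by auto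
  have fg: "g * int f = s * (N - 1)"
    using eg by (simp add: g_def N_def power2_eq_square algebra_simps)
  have c2g: "g * (int c - 2) = (s - 1) * (s + 2 * g)" using cg by (simp add: algebra_simps)
  have K: "(int k - 2) * N = (int c - 1) * (s + 2 * g)"
  proof -
    have "int ((k - 2) * e) = int ((c - 1) * (c - 2))" using e by simp
    then have "(int k - 2) * int e = (int c - 1) * (int c - 2)" using k c by (simp add: of_nat_diff)
    then have "(int k - 2) * (g * int e) = (int c - 1) * (g * (int c - 2))" by (metis mult.left_commute)
    then have "(s - 1) * ((int k - 2) * N) = (s - 1) * ((int c - 1) * (s + 2 * g))"
      unfolding eg c2g by (simp add: algebra_simps)
    then show ?thesis using s1 by simp
  qed
  have C4: "(int c4 - 1) * (N - 1) = (int c - 1) * (s + 2 * g - 1)"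
  proof -
    have "int ((c4 - 1) * f) = int (c * (c - 1))" using f by simp
    then have "(int c4 - 1) * int f = int c * (int c - 1)" using c4 c by (simp add: of_nat_diff)
    then have "(int c4 - 1) * (g * int f) = (g * int c) * (int c - 1)" by (metis mult.left_commute mult.assoc)
    then have "s * ((int c4 - 1) * (N - 1)) = s * ((int c - 1) * (s + 2 * g - 1))"
      unfolding fg cg by (simp add: algebra_simps)
    then show ?thesis using s1 by simp
  qed
  have g2: "2 \<le> g"
  proof (rule ccontr)
    assume "\<not> 2 \<le> g"
    then have gn: "g \<le> -1" using s1 by linarith
    have "s * (s + 2 * g - 1) < 0" using cg gn c3 mult_neg_pos[of g "int c"] by simp
    then have "0 < s" using gn mult_nonpos_nonpos[of s "s + 2 * g - 1"] by linarith
    then have "2 \<le> s" using s1 by linarith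
    moreover have "0 \<le> g * g + g" using gn mult_nonpos_nonpos[of g "g + 1"] by (simp add: algebra_simps)
    ultimately have "0 < (s - 1) * N" by (simp add: N_def power2_eq_square)
    moreover have "g * int e < 0" using gn e1 by (simp add: mult_neg_pos)
    ultimately show False using eg by simp
  qed
  \<comment> \<open>If \<open>N\<close> were positive it would exceed \<open>s + 2 * g\<close>;
    together with \<open>c - 1 \<le> k - 2\<close> this makes the left side of \<open>K\<close>
    larger than the right.\<close>
  have sN: "N < 0"
  proof (rule ccontr)
    assume N: "\<not> N < 0"
    have "0 < (s - 1) * N" using eg g2 e1 by (metis mult_pos_pos of_nat_0_less_iff less_le_trans zero_less_numeral zero_less_one)
    then have s2: "2 \<le> s" "0 < N" using N by (auto simp: zero_less_mult_iff)
    have "s + 2 * g < N" using g2 mult_right_mono[of 2 g g] by (simp add: N_def power2_eq_square)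
    then have "(int c - 1) * (s + 2 * g) < (int c - 1) * N" using c3 by simp
    also have "\<dots> \<le> (int k - 2) * N" using c s2 by (intro mult_right_mono) auto
    finally show False using K by simp
  qed
  define p where "p = 1 - N"
  have sp: "s = 1 - g\<^sup>2 - g - p" by (simp add: p_def N_def)
  show thesis
  proof (rule that[of g p])
    show "2 \<le> p" using sN by (simp add: p_def)
    show "r = 1 - g\<^sup>2 - g - p" using sp s by simp
    have "(int k - 2) * (p - 1) = (int c - 1) * (p - 1 + g\<^sup>2 - g)"
      using K by (simp add: p_def N_def algebra_simps)
    from arg_cong[OF this, of real_of_int]
    show "(real k - 2) * (p - 1) = (real c - 1) * (p - 1 + g\<^sup>2 - g)" by simp
    have "(int c4 - 1) * p = (int c - 1) * (p + g\<^sup>2 - g)"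
      using C4 by (simp add: p_def N_def algebra_simps)
    from arg_cong[OF this, of real_of_int] show "(real c4 - 1) * p = (real c - 1) * (p + g\<^sup>2 - g)" by simp
  qed (use g2 P in auto)
qed

text \<open>\<open>i\<close> and \<open>j\<close> will be the quotients of \<open>t 1 - t 3\<close>
  by \<open>t 5 - t 3\<close> and by \<open>t 6 - t 4\<close>. If \<open>p > g\<close>, the factor
  of \<open>j\<close> exceeds \<open>g ^ 3\<close>. If \<open>p = g - 1\<close>, then
  \<open>p\<close> divides \<open>g\<^sup>2 = p * (g + 1) + 1\<close> and hence 1.\<close>

lemma no_integral_ratios:
  fixes g p i j :: int
  assumes "2 \<le> g" "2 \<le> p" "p \<noteq> g" and i: "i * p = - g\<^sup>2" and j: "j * (p\<^sup>2 + g\<^sup>2 * (p - 1)) = g ^ 3"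
  shows False
proof -
  define n where "n = - i"
  have np: "n * p = g\<^sup>2" using i by (simp add: n_def)
  have n0: "0 < n" using np assms by (metis zero_less_mult_pos2 zero_less_power zero_less_numeral less_le_trans)
  have Q: "0 < p\<^sup>2 + g\<^sup>2 * (p - 1)" using assms by (simp add: add_pos_nonneg)
  have j0: "0 < j" using j Q assms by (metis zero_less_mult_pos2 zero_less_power zero_less_numeral less_le_trans)
  consider "p > g" | "p = g - 1" | "p \<le> g - 2" using \<open>p \<noteq> g\<close> by linarith
  then show False
  proof cases
    case 1
    have "g ^ 3 \<le> g\<^sup>2 * (p - 1)" using 1 assms by (simp add: power3_eq_cube power2_eq_square)
    then have "g ^ 3 < p\<^sup>2 + g\<^sup>2 * (p - 1)" using assms by (simp add: add_pos_nonneg add_strict_increasing)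
    also have "\<dots> \<le> j * (p\<^sup>2 + g\<^sup>2 * (p - 1))" using Q j0 by (simp add: mult_le_cancel_right1)
    finally show False using j by simp
  next
    case 2
    have "p * (n - g - 1) = n * p - p * (g + 1)" by (simp add: algebra_simps)
    also have "\<dots> = 1" unfolding np by (simp add: 2 power2_eq_square algebra_simps)
    finally have "p * (n - g - 1) = 1" .
    then show False using \<open>2 \<le> p\<close> by (metis dvd_triv_left zdvd_imp_le zero_less_one not_le one_less_numeral_iff semiring_norm(76) less_le_trans)
  next
    case 3
    \<comment> \<open>Dividing the equation for \<open>j\<close> by \<open>p\<close>, with
      \<open>g\<^sup>2 = n * p\<close>, gives \<open>j * p = n * m\<close>. So \<open>m\<close> is a
      positive integer, and eliminating \<open>j\<close> leaves
      \<open>m * (p\<^sup>2 + g\<^sup>2 * (p - 1)) = g * p\<^sup>2\<close>, which is too small on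
      the right.\<close>
    define m where "m = g - j * (p - 1)"
    have "(j * (p + n * (p - 1))) * p = (g * n) * p"
      using j by (simp add: power3_eq_cube power2_eq_square np[unfolded power2_eq_square, symmetric] algebra_simps)
    then have "j * (p + n * (p - 1)) = g * n" using assms by simp
    then have jp: "j * p = n * m" by (simp add: m_def algebra_simps)
    then have m1: "1 \<le> m" using j0 n0 assms by (metis mult_pos_pos zero_less_mult_pos int_one_le_iff_zero_less zero_less_numeral less_le_trans)
    have "j * p\<^sup>2 = g\<^sup>2 * m" using jp np by (simp add: power2_eq_square) (metis mult.assoc mult.commute)
    then have "m * (p\<^sup>2 + g\<^sup>2 * (p - 1)) = p\<^sup>2 * m + j * p\<^sup>2 * (p - 1)" by (simp add: algebra_simps)
    also have "\<dots> = g * p\<^sup>2" by (simp add: m_def algebra_simps)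
    finally have "p\<^sup>2 + g\<^sup>2 * (p - 1) \<le> g * p\<^sup>2" using mult_right_mono[of 1 m "p\<^sup>2 + g\<^sup>2 * (p - 1)"] m1 Q by simp
    moreover have "0 \<le> (p - 2) * (g - 2 - p)" using assms 3 by simp
    then have "0 \<le> p * (g - p) - g" using 3 assms by (simp add: algebra_simps)
    then have "0 \<le> g * (p * (g - p) - g)" using assms by simp
    moreover have "g\<^sup>2 * (p - 1) + p\<^sup>2 = g * (p * (g - p) - g) + p\<^sup>2 + g * p\<^sup>2"
      by (simp add: power2_eq_square algebra_simps)
    moreover have "0 < p\<^sup>2" using assms by simp
    ultimately show False by linarith
  qed
qed

section \<open>The sequence \<open>t\<close> outside the Odd case, for diameter at least 4\<close>

locale large_parameters =
  fixes t0 t1 t2 t3 t4 v G P :: real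
  assumes G: "2 \<le> G" and P: "2 \<le> P" and v: "v \<noteq> 0"
    and t23: "t2 - t3 = G * (G - 1) * v"
    and t13: "t1 - t3 = - G * (P + G\<^sup>2 - 2 * G) * v"
    and t42: "t4 - t2 = - (P + G\<^sup>2 - 2 * G) * v"
    and t04: "t0 - t4 = (P + G\<^sup>2) * (P + G\<^sup>2 - 2 * G) * v"
begin

text \<open>\<open>w\<close> is the factor shared by \<open>t1 - t3\<close>, \<open>t4 - t2\<close>
  and \<open>t0 - t4\<close>. \<open>Z\<close> is what remains of \<open>t0 - t5\<close> after the
  recurrence has produced \<open>t5\<close>; see \<open>t05\<close>.\<close>

definition w where "w = P + G\<^sup>2 - 2 * G"
definition Z where "Z = P\<^sup>2 + P * (2 * G\<^sup>2 - G) + G ^ 4 - G ^ 3 - G\<^sup>2"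

lemma w_pos: "0 < w"
proof -
  have "2 * G \<le> G * G" by (rule mult_right_mono) (use G in auto)
  then show ?thesis using P by (simp add: w_def power2_eq_square)
qed

lemma w': "0 < P + G\<^sup>2 - G"
  using w_pos G by (simp add: w_def)

lemma t14: "t1 - t4 = - (G - 1) * (P + G\<^sup>2 - G) * v"
  using t23 t13 t42 by (simp add: algebra_simps power2_eq_square)

text \<open>The hypothesis is the recurrence at distance 4. Both sides contain the nonzero factor
  \<open>w * v\<close>, and cancelling it determines \<open>t5\<close>.\<close>

lemma t15:
  assumes "(t2 - t4) * (t0 - t4) = (t1 - t3) * (t1 - t5)"
  shows "G * (t1 - t5) = - (P + G\<^sup>2) * w * v"
proof -
  have "t2 - t4 = w * v" using t42 by (simp add: w_def algebra_simps)
  then have "(w * v) * ((P + G\<^sup>2) * w * v) = (w * v) * (- G * (t1 - t5))"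
    using assms t04 t13 by (simp add: w_def[symmetric])
  moreover have "w * v \<noteq> 0" using w_pos v by simp
  ultimately have "(P + G\<^sup>2) * w * v = - G * (t1 - t5)" using mult_left_cancel by blast
  then show ?thesis by (simp add: algebra_simps)
qed

text \<open>At diameter 4 the recurrence is cut off, with \<open>t4\<close> in place of
  \<open>t5\<close>. It becomes \<open>P\<^sup>2 + P * (G\<^sup>2 - G) = G\<^sup>2\<close>, whose
  left side is too large for \<open>P\<close> and \<open>G\<close> at least 2.\<close>

lemma not_4:
  assumes "(t2 - t4) * (t0 - t4) = (t1 - t3) * (t1 - t4)"
  shows False
proof -
  have "v * (G * (- (G - 1) * (P + G\<^sup>2 - G))) = v * (- (P + G\<^sup>2) * w)"
    using t15[OF assms] unfolding t14 by (simp add: algebra_simps)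
  then have "G * (- (G - 1) * (P + G\<^sup>2 - G)) = - (P + G\<^sup>2) * w" using v mult_left_cancel by blast
  then have "P\<^sup>2 + P * (G\<^sup>2 - G) = G\<^sup>2"
    by (simp add: w_def power2_eq_square algebra_simps)
  moreover have "2 * (G\<^sup>2 - G) \<le> P * (G\<^sup>2 - G)" using P G by (intro mult_right_mono) (auto simp: power2_eq_square)
  moreover have "2 * G \<le> G\<^sup>2" using G by (simp add: power2_eq_square)
  moreover have "4 \<le> P\<^sup>2" using power_mono[OF P, of 2] by simp
  moreover define X where "X = P * (G\<^sup>2 - G)"
  ultimately have "P\<^sup>2 + X = G\<^sup>2" "2 * (G\<^sup>2 - G) \<le> X" "2 * G \<le> G\<^sup>2" "4 \<le> P\<^sup>2" by (simp_all only:)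
  then show False by (simp add: algebra_simps)
qed

lemma t53:
  assumes "(t2 - t4) * (t0 - t4) = (t1 - t3) * (t1 - t5)"
  shows "G * (t5 - t3) = P * w * v"
proof -
  have "G * (t5 - t3) = G * (t1 - t3) - G * (t1 - t5)" by (simp add: algebra_simps)
  then show ?thesis unfolding t15[OF assms] t13 by (simp add: w_def power2_eq_square algebra_simps)
qed

lemma t25:
  assumes "(t2 - t4) * (t0 - t4) = (t1 - t3) * (t1 - t5)"
  shows "G * (t2 - t5) = (G - P) * (P + G\<^sup>2 - G) * v"
proof -
  have "G * (t2 - t5) = G * (t2 - t3) - G * (t5 - t3)" by (simp add: algebra_simps)
  then show ?thesis unfolding t53[OF assms] t23 by (simp add: w_def power2_eq_square algebra_simps)
qed

lemma t01: "t0 - t1 = ((P + G\<^sup>2) * w + (G - 1) * (P + G\<^sup>2 - G)) * v"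
  using t14 t04 by (simp add: w_def algebra_simps)

lemma t05:
  assumes "(t2 - t4) * (t0 - t4) = (t1 - t3) * (t1 - t5)"
  shows "G * (t0 - t5) = (G - 1) * Z * v"
proof -
  have "G * (t0 - t5) = G * (t0 - t1) + G * (t1 - t5)" by (simp add: algebra_simps)
  then show ?thesis unfolding t15[OF assms] t01
    by (simp add: w_def Z_def power2_eq_square power3_eq_cube power4_eq_xxxx algebra_simps)
qed

lemma t16:
  assumes 4: "(t2 - t4) * (t0 - t4) = (t1 - t3) * (t1 - t5)"
    and 5: "(t2 - t5) * (t0 - t5) = (t1 - t4) * (t1 - t6)"
  shows "G\<^sup>2 * (t1 - t6) = - (G - P) * Z * v"
proof -
  have "(G * (t2 - t5)) * (G * (t0 - t5)) = G\<^sup>2 * ((t1 - t4) * (t1 - t6))"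
    using 5 by (simp add: power2_eq_square)
  then have "((P + G\<^sup>2 - G) * ((G - 1) * v)) * ((G - P) * Z * v) = ((P + G\<^sup>2 - G) * ((G - 1) * v)) * (- (G\<^sup>2 * (t1 - t6)))"
    unfolding t25[OF 4] t05[OF 4] t14 by (simp add: algebra_simps)
  moreover have "(P + G\<^sup>2 - G) * ((G - 1) * v) \<noteq> 0" using w' G v by simp
  ultimately show ?thesis by (metis mult_left_cancel mult_minus_left minus_minus)
qed

text \<open>Diameter 5 with \<open>c 5 < k\<close>: here \<open>t5\<close> stands in for
  \<open>t6\<close>. The resulting equation for \<open>P * Z\<close> fails because \<open>Z\<close>
  exceeds \<open>G\<^sup>2 + (G ^ 4 - G ^ 3)\<close>.\<close>

lemma not_5:
  assumes 4: "(t2 - t4) * (t0 - t4) = (t1 - t3) * (t1 - t5)"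
    and 5: "(t2 - t5) * (t0 - t5) = (t1 - t4) * (t1 - t5)"
  shows False
proof -
  have "G * (G * (t1 - t5)) = - (G - P) * Z * v" using t16[OF 4 5] by (simp add: power2_eq_square)
  then have "v * (G * ((P + G\<^sup>2) * w)) = v * ((G - P) * Z)" unfolding t15[OF 4] by (simp add: algebra_simps)
  then have "G * ((P + G\<^sup>2) * w) = (G - P) * Z" using v by simp
  then have eq: "P * Z = G\<^sup>2 * P + G ^ 4 - G ^ 3"
    by (simp add: w_def Z_def power2_eq_square power3_eq_cube power4_eq_xxxx algebra_simps)
  have G3: "0 \<le> G ^ 4 - G ^ 3" using G by (simp add: power_increasing)
  have "2 * (2 * G\<^sup>2 - G) \<le> P * (2 * G\<^sup>2 - G)" using G P by (intro mult_right_mono) (auto simp: power2_eq_square)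
  moreover have "2 * G \<le> G\<^sup>2" using G by (simp add: power2_eq_square)
  moreover have "4 \<le> P\<^sup>2" using power_mono[OF P, of 2] by simp
  moreover have "4 \<le> G\<^sup>2" using power_mono[OF G, of 2] by simp
  moreover define X where "X = P * (2 * G\<^sup>2 - G)"
  ultimately have "2 * (2 * G\<^sup>2 - G) \<le> X" "2 * G \<le> G\<^sup>2" "4 \<le> P\<^sup>2" "4 \<le> G\<^sup>2" by (simp_all only:)
  then have "0 < P\<^sup>2 + X - 2 * G\<^sup>2" by (simp add: algebra_simps)
  then have "0 < P\<^sup>2 + P * (2 * G\<^sup>2 - G) - 2 * G\<^sup>2" by (simp only: X_def)
  then have "G\<^sup>2 + (G ^ 4 - G ^ 3) < Z" unfolding Z_def by simp
  then have "P * (G\<^sup>2 + (G ^ 4 - G ^ 3)) < P * Z" using P by simp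
  moreover have "1 * (G ^ 4 - G ^ 3) \<le> P * (G ^ 4 - G ^ 3)" using G3 P by (intro mult_right_mono) auto
  ultimately show False using eq by (simp add: algebra_simps)
qed

lemma t64:
  assumes 4: "(t2 - t4) * (t0 - t4) = (t1 - t3) * (t1 - t5)"
    and 5: "(t2 - t5) * (t0 - t5) = (t1 - t4) * (t1 - t6)"
  shows "G\<^sup>2 * (t6 - t4) = - w * (P\<^sup>2 + G\<^sup>2 * (P - 1)) * v"
proof -
  have "G\<^sup>2 * (t6 - t4) = G\<^sup>2 * (t1 - t4) - G\<^sup>2 * (t1 - t6)" by (simp add: algebra_simps)
  then show ?thesis unfolding t14 t16[OF assms]
    by (simp add: w_def Z_def power2_eq_square power3_eq_cube power4_eq_xxxx algebra_simps)
qed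

text \<open>The last two hypotheses are eigenvector equations for a bipartite graph of diameter 5.\<close>
lemma not_bipartite_5:
  fixes k c \<theta> :: real
  assumes 4: "(t2 - t4) * (t0 - t4) = (t1 - t3) * (t1 - t5)"
    and k: "(k - 2) * (P - 1) = (c - 1) * (P - 1 + G\<^sup>2 - G)"
    and c: "G * c = (P - 1 + G\<^sup>2 + G) * (P + G\<^sup>2 - G)"
    and P_int: "P \<le> G \<or> G + 1 \<le> P"
    and "t0 \<noteq> t1" and th: "(\<theta> + 1) * (t0 - t1) = (k - 1) * (t1 - t2)"
    and e5: "k * (t1 - t4) = \<theta> * (t0 - t5)"
  shows False
proof -
  define T where "T = (P + G\<^sup>2) * w + (G - 1) * (P + G\<^sup>2 - G)"
  have T0: "T \<noteq> 0" using t01 \<open>t0 \<noteq> t1\<close> by (auto simp: T_def)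
  have t12: "t1 - t2 = - G * (P - 1 + G\<^sup>2 - G) * v"
    using t13 t23 by (simp add: power2_eq_square algebra_simps)
  have "v * ((\<theta> + 1) * T) = v * (- (k - 1) * G * (P - 1 + G\<^sup>2 - G))"
    using th unfolding t01 t12 T_def by (simp add: algebra_simps)
  then have "(\<theta> + 1) * T = - (k - 1) * G * (P - 1 + G\<^sup>2 - G)" using v mult_left_cancel by blast
  then have th': "\<theta> * T = - (k - 1) * G * (P - 1 + G\<^sup>2 - G) - T" by (simp add: algebra_simps)
  have "G * (k * (t1 - t4)) = \<theta> * (G * (t0 - t5))" using e5 by simp
  then have "((G - 1) * v) * (G * k * (P + G\<^sup>2 - G)) = ((G - 1) * v) * (- \<theta> * Z)"
    unfolding t14 t05[OF 4] by (simp add: algebra_simps)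
  moreover have "(G - 1) * v \<noteq> 0" using G v by simp
  ultimately have "G * k * (P + G\<^sup>2 - G) = - \<theta> * Z" using mult_left_cancel by blast
  then have "G * k * (P + G\<^sup>2 - G) * T = - \<theta> * Z * T" by simp
  also have "\<dots> = - (\<theta> * T) * Z" by simp
  finally have E: "G * k * (P + G\<^sup>2 - G) * T = ((k - 1) * G * (P - 1 + G\<^sup>2 - G) + T) * Z"
    unfolding th' by (simp add: algebra_simps)
  define a q where "a = P - 1" and "q = G\<^sup>2 - G"
  \<comment> \<open>\<open>Y\<close> is read off from the elimination of \<theta>, \<open>k\<close>
    and \<open>c\<close>: the resulting polynomial has the factor \<open>G * T\<close>, and its
    cofactor is \<open>(P - G) * Y - G ^ 3 * (G - 1)\<close>.\<close>
  define Y where "Y = P\<^sup>2 + (2 * G\<^sup>2 - 2 * G - 1) * P + G ^ 4 - 2 * G ^ 3 - 2 * G\<^sup>2 + 2 * G"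
  have "k * a = 2 * a + (c - 1) * (a + q)" using k by (simp add: a_def q_def algebra_simps)
  then have "G * (k * a) = G * (2 * a + (c - 1) * (a + q))" by simp
  also have "\<dots> = 2 * G * a + (G * c - G) * (a + q)" by (simp add: algebra_simps)
  finally have ka: "G * (k * a) = 2 * G * a + ((a + G\<^sup>2 + G) * (P + q) - G) * (a + q)"
    unfolding c by (simp add: a_def q_def algebra_simps)
  have "G * (G * (k * a)) * (P + q) * T = ((G * (k * a) - G * a) * G * (a + q) + G * a * T) * Z"
    using arg_cong[OF E, of "\<lambda>x. G * a * x"] by (simp add: a_def q_def algebra_simps)
  note E2 = this[unfolded ka]
  have "G * T * ((P - G) * Y - G ^ 3 * (G - 1)) = 0"
    using E2 unfolding T_def Z_def w_def Y_def a_def q_def by algebra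
  then have Y: "(P - G) * Y = G ^ 3 * (G - 1)" using T0 G by simp
  have G22: "2 * G \<le> G\<^sup>2" using G by (simp add: power2_eq_square)
  then have pos: "0 \<le> 2 * G\<^sup>2 - 2 * G - 1" using G by linarith
  \<comment> \<open>For \<open>P \<le> G\<close> the product \<open>(P - G) * Y\<close> is not
    positive. For \<open>P \<ge> G + 1\<close> it is at least \<open>Y\<close>, which alone exceeds
    \<open>G ^ 3 * (G - 1)\<close>. Integrality closes the gap between the two cases.\<close>
  from P_int show False
  proof
    assume "P \<le> G"
    have "4 \<le> P\<^sup>2" using power_mono[OF P, of 2] by simp
    moreover have "2 * (2 * G\<^sup>2 - 2 * G - 1) \<le> (2 * G\<^sup>2 - 2 * G - 1) * P"
      using mult_left_mono[OF P pos] by (simp only: mult.commute)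
    moreover have "2 * G ^ 3 \<le> G ^ 4" using G by (simp add: power3_eq_cube power4_eq_xxxx)
    ultimately have "0 \<le> Y" using G22 G unfolding Y_def by (simp add: algebra_simps)
    then have "(P - G) * Y \<le> 0" using \<open>P \<le> G\<close> by (simp add: mult_nonpos_nonneg)
    moreover have "0 < G ^ 3 * (G - 1)" using G by simp
    ultimately show False using Y by simp
  next
    assume P: "G + 1 \<le> P"
    have "(G + 1)\<^sup>2 \<le> P\<^sup>2" using G P by (intro power_mono) auto
    moreover have "(2 * G\<^sup>2 - 2 * G - 1) * (G + 1) \<le> (2 * G\<^sup>2 - 2 * G - 1) * P"
      using pos P by (intro mult_left_mono) auto
    ultimately have "G ^ 4 - G\<^sup>2 + G \<le> Y" unfolding Y_def
      by (simp add: power2_eq_square power3_eq_cube power4_eq_xxxx algebra_simps)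
    moreover have "G\<^sup>2 \<le> G ^ 3" using G by (simp add: power_increasing)
    moreover have "0 < G" using G by simp
    ultimately have "G ^ 3 * (G - 1) < Y" by (simp add: power3_eq_cube power4_eq_xxxx algebra_simps)
    moreover have "0 < G ^ 3 * (G - 1)" using G by simp
    ultimately have "1 * Y \<le> (P - G) * Y" using P by (intro mult_right_mono) auto
    then show False using Y \<open>G ^ 3 * (G - 1) < Y\<close> by simp
  qed
qed

end

subsection \<open>Distance-regular graphs and the balanced-set identity\<close>

text \<open>Everything is phrased for a distance function, so that the combinatorial arguments and
  the matrix algebra share one interface. \<open>d_step\<close> expresses that distances are
  realised by paths.\<close>

locale drg_metric =
  fixes d :: "'v::finite \<Rightarrow> 'v \<Rightarrow> nat" and D :: nat and p :: "nat \<Rightarrow> nat \<Rightarrow> nat \<Rightarrow> nat"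
  assumes d_eq_0: "d x y = 0 \<longleftrightarrow> x = y"
    and d_sym: "d x y = d y x"
    and d_tri: "d x z \<le> d x y + d y z"
    and d_step: "d x y = Suc n \<Longrightarrow> \<exists>w. d x w = 1 \<and> d w y = n"
    and d_le: "d x y \<le> D"
    and ex_diam: "\<exists>x y. d x y = D"
    and regular: "i \<le> D \<Longrightarrow> j \<le> D \<Longrightarrow> card {w. d x w = i \<and> d w y = j} = p (d x y) i j"
begin

lemma d_self [simp]: "d x x = 0"
  by (simp add: d_eq_0)

definition C :: "'v \<Rightarrow> 'v \<Rightarrow> 'v set" where
  "C y z = {w. d y w = 1 \<and> Suc (d w z) = d y z}"

definition c :: "nat \<Rightarrow> nat" where
  "c h = p h 1 (h - 1)"

definition k :: nat where
  "k = p 0 1 1"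

lemma in_C: "w \<in> C y z \<longleftrightarrow> d y w = 1 \<and> Suc (d w z) = d y z"
  by (simp add: C_def)

lemma adj_dist: "d x y = 1 \<Longrightarrow> d x z \<le> Suc (d y z)"
  using d_tri[of x z y] by simp

lemma adj_dist': "d x y = 1 \<Longrightarrow> d y z \<le> Suc (d x z)"
  using d_tri[of y z x] d_sym[of x y] by simp

text \<open>\<open>p 0 D D\<close> counts the vertices at distance \<open>D\<close> from any vertex
  whatsoever, so one diametral pair gives every vertex a partner at distance \<open>D\<close>; a
  geodesic supplies the smaller distances.\<close>

lemma ex_dist:
  assumes "h \<le> D"
  shows "\<exists>y. d y z = h"
proof -
  obtain x0 y0 where xy0: "d x0 y0 = D" using ex_diam by blast
  have "card {w. d x0 w = D \<and> d w x0 = D} = p 0 D D"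
    using regular[of D D x0 x0] by simp
  moreover have "y0 \<in> {w. d x0 w = D \<and> d w x0 = D}" using xy0 d_sym by auto
  ultimately have "p 0 D D \<noteq> 0" by (metis card_eq_0_iff empty_iff finite)
  then have "card {w. d z w = D \<and> d w z = D} \<noteq> 0"
    using regular[of D D z z] by simp
  then have "{w. d z w = D \<and> d w z = D} \<noteq> {}" by (metis card.empty)
  then obtain y1 where "d y1 z = D" by blast
  from \<open>h \<le> D\<close> this have "\<exists>y. d y z = h"
  proof (induction "D - h" arbitrary: h)
    case 0 then show ?case by auto
  next
    case (Suc n)
    then have "\<exists>y. d y z = Suc h" by auto
    then show ?case using d_step by blast
  qed
  then show ?thesis .
qed

lemma ex_farther:
  assumes "d y z < D"
  shows "\<exists>x. d y x = 1 \<and> d x z = Suc (d y z)"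
proof -
  obtain x0 where x0: "d x0 z = Suc (d y z)" using ex_dist[of "Suc (d y z)" z] assms by auto
  then obtain w where w: "d x0 w = 1" "d w z = d y z" using d_step by blast
  have D1: "1 \<le> D" "Suc (d y z) \<le> D" using assms by auto
  have "x0 \<in> {v. d w v = 1 \<and> d v z = Suc (d y z)}" using x0 w d_sym by auto
  then have "card {v. d w v = 1 \<and> d v z = Suc (d y z)} \<noteq> 0" by (metis card_eq_0_iff empty_iff finite)
  then have "card {v. d y v = 1 \<and> d v z = Suc (d y z)} \<noteq> 0"
    using regular[OF D1, of w z] regular[OF D1, of y z] w(2) by argo
  then have "{v. d y v = 1 \<and> d v z = Suc (d y z)} \<noteq> {}" by (metis card.empty)
  then show ?thesis by blast
qed

lemma card_C:
  assumes "y \<noteq> z"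
  shows "card (C y z) = c (d y z)"
proof -
  have pos: "0 < d y z" using assms d_eq_0 by auto
  then have "1 \<le> D" using d_le[of y z] by linarith
  moreover have "d y z - 1 \<le> D" using d_le[of y z] by linarith
  ultimately have "card {w. d y w = 1 \<and> d w z = d y z - 1} = c (d y z)"
    unfolding c_def by (rule regular)
  moreover have "C y z = {w. d y w = 1 \<and> d w z = d y z - 1}"
    using pos by (auto simp: C_def)
  ultimately show ?thesis by simp
qed

lemma C_nonempty: "y \<noteq> z \<Longrightarrow> C y z \<noteq> {}"
  using d_step[of y z "d y z - 1"] d_eq_0[of y z] by (auto simp: C_def)

lemma card_nbrs: "1 \<le> D \<Longrightarrow> card {w. d x w = 1} = k"
  using regular[of 1 1 x x] by (simp add: k_def d_sym[of _ x])

text \<open>A geodesic from \<open>y\<close> to \<open>v\<close> extends by the edge from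
  \<open>v\<close> to \<open>z\<close>. Both the monotonicity of \<open>c\<close> and the incidence
  count of the outer design rest on this.\<close>

lemma C_subset:
  assumes "v \<in> C z y"
  shows "C y v \<subseteq> C y z"
proof
  fix w assume w: "w \<in> C y v"
  have "d w z \<le> d w v + d v z" by (rule d_tri)
  moreover have "d y z \<le> Suc (d w z)" using w adj_dist[of y w z] by (simp add: in_C)
  moreover have "d v z = 1" "Suc (d v y) = d z y" using assms by (auto simp: in_C d_sym)
  ultimately show "w \<in> C y z" using w d_sym[of y v] d_sym[of y z] by (simp add: in_C)
qed

lemma c_mono:
  assumes "1 \<le> h" "h < D"
  shows "c h \<le> c (Suc h)"
proof -
  obtain y z where yz: "d y z = Suc h" using ex_dist[of "Suc h"] assms by fastforce
  then have ne: "y \<noteq> z" by (metis d_self nat.simps(3))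
  then obtain v where v: "v \<in> C z y" using C_nonempty[of z y] by auto
  have vy: "d y v = h" using v yz d_sym by (simp add: in_C)
  then have "y \<noteq> v" using assms by (metis d_self not_one_le_zero)
  have "card (C y v) \<le> card (C y z)" by (rule card_mono[OF _ C_subset[OF v]]) simp
  then show ?thesis using card_C[OF ne] card_C[OF \<open>y \<noteq> v\<close>] vy yz by simp
qed

lemma C_D_lt:
  assumes "d y z < D" "y \<noteq> z"
  shows "c (d y z) < k"
proof -
  obtain x where x: "d y x = 1" "d x z = Suc (d y z)" using ex_farther[OF assms(1)] by blast
  have "C y z \<subset> {w. d y w = 1}"
  proof (rule psubsetI)
    show "C y z \<subseteq> {w. d y w = 1}" by (auto simp: in_C)
    have "x \<notin> C y z" using x by (simp add: in_C)
    then show "C y z \<noteq> {w. d y w = 1}" using x(1) by blast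
  qed
  then have "card (C y z) < card {w. d y w = 1}" by (rule psubset_card_mono[rotated]) simp
  then show ?thesis using card_C[OF assms(2)] card_nbrs assms(1) by simp
qed

end

locale q_poly_metric = drg_metric +
  fixes t :: "nat \<Rightarrow> real" and \<theta> :: real
  assumes t_inj: "inj_on t {..D}"
    and t_idem: "(\<Sum>x\<in>UNIV. t (d x y) * t (d x z)) = t (d y z)"
    and t_eigen: "(\<Sum>w | d y w = 1. t (d x w)) = \<theta> * t (d x y)"
    and t_balanced: "\<exists>r. \<forall>x. (\<Sum>w\<in>C y z. t (d x w)) - (\<Sum>w\<in>C z y. t (d x w)) = r * (t (d x y) - t (d x z))"
begin

lemma t_neq: "i \<le> D \<Longrightarrow> j \<le> D \<Longrightarrow> i \<noteq> j \<Longrightarrow> t i \<noteq> t j"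
  using t_inj by (auto simp: inj_on_def)

text \<open>The multiplier obtained from the balanced-set identity at \<open>x = y\<close>; the
  value shows that it depends on the distance alone. Note that \<open>r 2 = 0\<close>, so distance 2
  needs separate treatment.\<close>

definition r :: "nat \<Rightarrow> real" where
  "r h = c h * (t 1 - t (h - 1)) / (t 0 - t h)"

lemma balanced:
  assumes "y \<noteq> z"
  shows "(\<Sum>w\<in>C y z. t (d x w)) - (\<Sum>w\<in>C z y. t (d x w)) = r (d y z) * (t (d x y) - t (d x z))"
proof -
  obtain s where s: "\<And>x. (\<Sum>w\<in>C y z. t (d x w)) - (\<Sum>w\<in>C z y. t (d x w)) = s * (t (d x y) - t (d x z))"
    using t_balanced[of y z] by blast
  have "d y z \<noteq> 0" using assms d_eq_0 by simp
  then have nz: "t 0 - t (d y z) \<noteq> 0" using t_neq[of 0 "d y z"] d_le[of y z] by simp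
  have "(\<Sum>w\<in>C y z. t (d y w)) = card (C y z) * t 1"
    by (simp add: in_C)
  moreover have "(\<Sum>w\<in>C z y. t (d y w)) = card (C z y) * t (d y z - 1)"
  proof -
    have "t (d y w) = t (d y z - 1)" if "w \<in> C z y" for w
    proof -
      have "d y w = d y z - 1" using that d_sym[of y w] d_sym[of y z] by (auto simp: in_C)
      then show ?thesis by simp
    qed
    then show ?thesis by simp
  qed
  ultimately have "c (d y z) * (t 1 - t (d y z - 1)) = s * (t 0 - t (d y z))"
    using s[of y] card_C[OF assms] card_C[of z y] assms d_sym[of y z] by (simp add: algebra_simps)
  then have "s = r (d y z)" using nz by (simp add: r_def field_simps)
  then show ?thesis using s by simp
qed

end

section \<open>Local structure at girth 6 and the first relations among the
  \<open>t i\<close>\<close>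

locale q_poly_girth_6 = q_poly_metric +
  assumes D_ge_3: "3 \<le> D"
    and k_ge_3: "3 \<le> k"
    and no_triangle: "d x y = 1 \<Longrightarrow> d x z = 1 \<Longrightarrow> d y z \<noteq> 1"
    and no_square: "d x y = 2 \<Longrightarrow> d x w = 1 \<Longrightarrow> d w y = 1 \<Longrightarrow> d x w' = 1 \<Longrightarrow> d w' y = 1 \<Longrightarrow> w = w'"
    and no_pentagon: "d x y = 2 \<Longrightarrow> d x z = 2 \<Longrightarrow> d y z \<noteq> 1"
    and c_3_ge_2: "2 \<le> c 3"
begin

text \<open>A neighbour of \<open>y\<close> that is not nearer to \<open>z\<close> lies one step
  farther away, unless \<open>d y z = D\<close>, when it stays at distance \<open>D\<close>. Capping
  the index treats both cases alike; in particular \<open>\<tau> (Suc D) = t D\<close>.\<close>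

definition \<tau> :: "nat \<Rightarrow> real" where
  "\<tau> h = t (min h D)"

lemma \<tau>_le [simp]: "h \<le> D \<Longrightarrow> \<tau> h = t h"
  by (simp add: \<tau>_def)

lemma adj_dist_cases:
  assumes "d x y = 1"
  shows "d x z = Suc (d y z) \<or> d x z = d y z \<or> Suc (d x z) = d y z"
  using adj_dist[OF assms, of z] adj_dist'[OF assms, of z] by linarith

lemma dist_2: "d x y = 1 \<Longrightarrow> d x z = 1 \<Longrightarrow> y \<noteq> z \<Longrightarrow> d y z = 2"
  using adj_dist'[of x y z] no_triangle[of x y z] d_eq_0[of y z] by fastforce

lemma sum_C_far:
  assumes "d x y = 1" "d y z \<le> d x z"
  shows "(\<Sum>w\<in>C y z. t (d x w)) = card (C y z) * t 2"
proof -
  have "t (d x w) = t 2" if "w \<in> C y z" for w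
  proof -
    have "w \<noteq> x" using that assms(2) by (auto simp: in_C)
    then have "d x w = 2" using dist_2[of y x w] that assms(1) d_sym by (auto simp: in_C)
    then show ?thesis by simp
  qed
  then show ?thesis by simp
qed

lemma c_1: "c 1 = 1"
proof -
  obtain y z where yz: "d y z = 1" using ex_dist[of 1] D_ge_3 by fastforce
  then have "C y z = {z}" using d_eq_0 by (auto simp: in_C)
  moreover have "y \<noteq> z" using yz by auto
  ultimately show ?thesis using card_C[of y z] yz by simp
qed

lemma c_2: "c 2 = 1"
proof -
  obtain y z where yz: "d y z = 2" using ex_dist[of 2] D_ge_3 by fastforce
  then have ne: "y \<noteq> z" by auto
  then obtain w where w: "w \<in> C y z" using C_nonempty by blast
  have "C y z = {w}"
    using w no_square[OF yz] yz by (auto simp: in_C)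
  then show ?thesis using card_C[OF ne] yz by simp
qed

text \<open>Every neighbour of \<open>y\<close> not nearer to \<open>z\<close> gives the same value of the balanced-set identity,
  so by injectivity of \<open>t\<close> all of them are equally far from \<open>z\<close>.\<close>
lemma far_eq_aux:
  assumes yz: "y \<noteq> z" and a: "\<forall>x y z'. d y z' = h - 1 \<longrightarrow> d x y = 1 \<longrightarrow> d x z' \<noteq> h - 1"
    and h: "d y z = h" and x: "d x y = 1" "h \<le> d x z"
  shows "c h * (t 2 - t h) = r h * (t 1 - t (d x z))"
proof -
  have h0: "0 < h" using yz h d_eq_0 by auto
  have "t (d x w) = t h" if w: "w \<in> C z y" for w
  proof -
    have wy: "d y w = h - 1" "d z w = 1" using w h d_sym[of w y] d_sym[of z y] by (auto simp: in_C)
    then have "d x w \<noteq> h - 1" using a wy(1) x(1) by blast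
    moreover have "d x w \<le> h" using adj_dist[OF x(1), of w] wy h0 by simp
    moreover have "h \<le> Suc (d x w)" using adj_dist[OF wy(2), of x] x(2) d_sym[of z x] d_sym[of w x] by simp
    ultimately have "d x w = h" by linarith
    then show ?thesis by simp
  qed
  then have "(\<Sum>w\<in>C z y. t (d x w)) = card (C z y) * t h" by simp
  then show ?thesis
    using balanced[OF yz, of x] sum_C_far[OF x(1), of z] x h card_C[OF yz] card_C[of z y] yz d_sym[of z y]
    by (simp add: algebra_simps)
qed

lemma r_nz:
  assumes "1 \<le> h" "h \<le> D" "h \<noteq> 2"
  shows "r h \<noteq> 0"
proof -
  obtain y z where yz: "d y z = h" using ex_dist[of h] assms by fastforce
  then have ne: "y \<noteq> z" using assms by auto
  have "c h \<noteq> 0" using C_nonempty[OF ne] card_C[OF ne] yz by (metis card_eq_0_iff finite)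
  moreover have "t 1 \<noteq> t (h - 1)" using t_neq[of 1 "h - 1"] assms D_ge_3 by linarith
  moreover have "t 0 \<noteq> t h" using t_neq[of 0 h] assms by linarith
  ultimately show ?thesis by (simp add: r_def)
qed

lemma no_equal:
  assumes "h < D" "d y z = h" "d x y = 1"
  shows "d x z \<noteq> h"
  using assms
proof (induction h arbitrary: x y z)
  case 0
  then show ?case using d_eq_0 by auto
next
  case (Suc h)
  have ne: "y \<noteq> z" using Suc.prems by auto
  \<comment> \<open>At distance 2 the multiplier \<open>r 2\<close> vanishes and the comparison of
    two neighbours says nothing; there the absence of pentagons takes over.\<close>
  show ?case
  proof (cases "h = 1")
    case True
    then show ?thesis using no_pentagon[of z y x] Suc.prems d_sym by (auto simp: numeral_2_eq_2)
  next
    case False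
    have a: "\<forall>x w y. d w y = Suc h - 1 \<longrightarrow> d x w = 1 \<longrightarrow> d x y \<noteq> Suc h - 1"
      using Suc.IH Suc.prems by simp
    obtain x' where x': "d y x' = 1" "d x' z = Suc (Suc h)"
      using ex_farther[of y z] Suc.prems by auto
    have "c (Suc h) * (t 2 - t (Suc h)) = r (Suc h) * (t 1 - t (Suc (Suc h)))"
      using far_eq_aux[OF ne a Suc.prems(2), where x=x'] x' d_sym by simp
    moreover have "c (Suc h) * (t 2 - t (Suc h)) = r (Suc h) * (t 1 - t (Suc h))" if "d x z = Suc h"
      using far_eq_aux[OF ne a Suc.prems(2), where x=x] Suc.prems that by simp
    moreover have "r (Suc h) \<noteq> 0" using r_nz[of "Suc h"] False Suc.prems by simp
    moreover have "t (Suc h) \<noteq> t (Suc (Suc h))" using t_neq Suc.prems by simp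
    ultimately show ?thesis by auto
  qed
qed

lemma t_far:
  assumes "d x y = 1" "d y z \<le> d x z"
  shows "t (d x z) = \<tau> (Suc (d y z))"
proof (cases "d y z < D")
  case True
  then show ?thesis using adj_dist[OF assms(1), of z] no_equal[of "d y z" y z x] assms by (simp add: le_Suc_eq)
next
  case False
  then have "d x z = D" "d y z = D" using d_le[of x z] d_le[of y z] assms by linarith+
  then show ?thesis unfolding \<tau>_def by simp
qed

lemma ex_far:
  assumes "c (d y z) < k" "y \<noteq> z"
  shows "\<exists>x. d x y = 1 \<and> d y z \<le> d x z"
proof -
  have "card (C y z) < card {w. d y w = 1}" using card_C[OF assms(2)] assms card_nbrs D_ge_3 by simp
  then have "\<not> {w. d y w = 1} \<subseteq> C y z" using card_mono[OF finite[of "C y z"]] by (meson leD)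
  then obtain x where "d y x = 1" "x \<notin> C y z" by blast
  then show ?thesis using adj_dist_cases[of y x z] d_sym[of x y] by (auto simp: in_C)
qed

lemma far_relation:
  assumes "1 \<le> h" "h \<le> D" "c h < k"
  shows "c h * (t 2 - t h) = r h * (t 1 - \<tau> (Suc h))"
proof -
  obtain y z where yz: "d y z = h" using ex_dist[of h] assms by fastforce
  then have ne: "y \<noteq> z" using assms by auto
  obtain x where x: "d x y = 1" "d y z \<le> d x z" using ex_far[of y z] ne yz assms by blast
  have "h - 1 < D" using assms by linarith
  then have a: "\<forall>v w u. d w u = h - 1 \<longrightarrow> d v w = 1 \<longrightarrow> d v u \<noteq> h - 1"
    using no_equal by blast
  have "h \<le> d x z" using x yz by simp
  from far_eq_aux[OF ne a yz x(1) this] show ?thesis using t_far[OF x] yz by simp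
qed

lemma c_lt: "h < D \<Longrightarrow> 1 \<le> h \<Longrightarrow> c h < k"
proof -
  assume h: "h < D" "1 \<le> h"
  then obtain y z where yz: "d y z = h" using ex_dist[of h] by fastforce
  then have "y \<noteq> z" using h by auto
  then show "c h < k" using C_D_lt[of y z] h yz by simp
qed

lemma r_eq: "h \<le> D \<Longrightarrow> 1 \<le> h \<Longrightarrow> r h * (t 0 - t h) = c h * (t 1 - t (h - 1))"
  using t_neq[of 0 h] by (simp add: r_def)

text \<open>This is the balanced-set identity at distance 3 with \<open>x = u\<close> taken from
  \<open>C y z\<close>. Exactly one vertex of \<open>C z y\<close> is adjacent to \<open>u\<close>,
  since a second would close a square, and the absence of pentagons puts the others at distance
  3.\<close>

lemma hexagon_eq: "t 0 + (real (c 3) - 1) * t 2 - (t 1 + (real (c 3) - 1) * t 3) = r 3 * (t 1 - t 2)"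
proof -
  obtain y z where yz: "d y z = 3" using ex_dist[of 3] D_ge_3 by fastforce
  then have ne: "y \<noteq> z" by auto
  then obtain u where u: "u \<in> C y z" using C_nonempty by blast
  then have uy: "d u y = 1" "d u z = 2" using yz d_sym by (auto simp: in_C)
  have cu: "real (card (C y z - {u})) = real (c 3) - 1" "card (C z y) = c 3"
    using u card_C[OF ne] card_C[of z y] ne yz c_3_ge_2 d_sym by (auto simp: card_Diff_singleton)
  have "t (d u w) = t 2" if "w \<in> C y z - {u}" for w
    using dist_2[of y u w] uy that d_sym by (auto simp: in_C)
  then have "(\<Sum>w\<in>C y z - {u}. t (d u w)) = (real (c 3) - 1) * t 2" using cu by simp
  then have 1: "(\<Sum>w\<in>C y z. t (d u w)) = t 0 + (real (c 3) - 1) * t 2"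
    using u by (simp add: sum.remove)
  obtain v where v: "d u v = 1" "d v z = 1" using d_step[of u z 1] uy by auto
  have vC: "v \<in> C z y"
  proof -
    have "d v y \<le> 2" using adj_dist[of v u y] v uy d_sym by (simp add: numeral_2_eq_2)
    moreover have "3 \<le> Suc (d v y)" using adj_dist'[of v z y] v yz d_sym by simp
    ultimately have "d v y = 2" by linarith
    then show ?thesis using v yz d_sym by (auto simp: in_C)
  qed
  have "t (d u w) = t 3" if w: "w \<in> C z y - {v}" for w
  proof -
    have "d z w = 1" "d w y = 2" using w yz d_sym[of z y] by (auto simp: in_C)
    then have "d u w \<noteq> 2" using no_pentagon[of u z w] uy by auto
    moreover have "d u w \<noteq> 1" using no_square[of u z v w] uy v w \<open>d z w = 1\<close> d_sym by auto
    moreover have "d u w \<noteq> 0" using uy \<open>d w y = 2\<close> d_eq_0 by auto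
    moreover have "d u w \<le> 3" using adj_dist[OF uy(1), of w] \<open>d w y = 2\<close> d_sym by simp
    ultimately have "d u w = 3" by linarith
    then show ?thesis by simp
  qed
  moreover have "real (card (C z y - {v})) = real (c 3) - 1" using vC cu c_3_ge_2 by (auto simp: card_Diff_singleton of_nat_diff)
  ultimately have "(\<Sum>w\<in>C z y - {v}. t (d u w)) = (real (c 3) - 1) * t 3" by simp
  then have "(\<Sum>w\<in>C z y. t (d u w)) = t 1 + (real (c 3) - 1) * t 3" using vC v by (simp add: sum.remove)
  then show ?thesis using 1 balanced[OF ne, of u] uy yz by simp
qed

text \<open>Two vertices at distance \<open>h\<close> from \<open>z\<close> with a common neighbour \<open>w\<close>: the number of
  neighbours of \<open>z\<close> nearer to both is determined by the position of \<open>w\<close>.\<close>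
lemma block_meet:
  assumes "x \<noteq> y" "d x w = 1" "d w y = 1" "d x z = h" "d y z = h" "1 \<le> h"
  defines "n \<equiv> card (C z x \<inter> C z y)"
  shows "c h * t 3 + (if Suc (d w z) = h then t 1 - t 3 else 0) - (n * t (h - 1) + (real (c h) - n) * \<tau> (Suc h))
    = r h * (t 2 - t h)"
proof -
  have ne: "y \<noteq> z" "x \<noteq> z" using assms by auto
  have xy: "d x y = 2" using dist_2[of w x y] assms d_sym by auto
  have *: "d x u = 3" if u: "u \<in> C y z" "u \<noteq> w" for u
  proof -
    have yu: "d y u = 1" using u by (simp add: in_C)
    have "d x u \<noteq> 1" using no_square[OF xy, of w u] assms u yu d_sym by auto
    moreover have "d x u \<noteq> 2" using no_pentagon[OF xy, of u] yu by auto
    moreover have "d x u \<noteq> 0" using d_eq_0 u assms by (auto simp: in_C)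
    moreover have "d x u \<le> 3" using adj_dist'[OF yu, of x] xy d_sym by simp
    ultimately show ?thesis by linarith
  qed
  have 1: "(\<Sum>u\<in>C y z. t (d x u)) = c h * t 3 + (if Suc (d w z) = h then t 1 - t 3 else 0)"
  proof (cases "w \<in> C y z")
    case True
    have "(\<Sum>u\<in>C y z. t (d x u)) = t 1 + (\<Sum>u\<in>C y z - {w}. t (d x u))"
      using True assms by (simp add: sum.remove)
    also have "(\<Sum>u\<in>C y z - {w}. t (d x u)) = card (C y z - {w}) * t 3" using * by simp
    also have "real (card (C y z - {w})) = real (c h) - 1"
      proof -
      have "0 < card (C y z)" using True by (auto simp: card_gt_0_iff)
      then have "real (card (C y z) - 1) = real (card (C y z)) - 1" by (simp add: of_nat_diff)
      then show ?thesis using True card_C[OF ne(1)] assms(5) by (simp add: card_Diff_singleton)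
    qed
    finally show ?thesis using True assms by (simp add: in_C algebra_simps)
  next
    case False
    then have "Suc (d w z) \<noteq> h" using assms d_sym by (auto simp: in_C)
    moreover have "(\<Sum>u\<in>C y z. t (d x u)) = (\<Sum>u\<in>C y z. t 3)"
    proof (rule sum.cong)
      fix u assume "u \<in> C y z"
      then show "t (d x u) = t 3" using *[of u] False by (cases "u = w") auto
    qed simp
    ultimately show ?thesis using card_C[OF ne(1)] assms(5) by simp
  qed
  have "t (d x v) = t (h - 1)" if "v \<in> C z x \<inter> C z y" for v
  proof -
    have "d x v = h - 1" using that assms d_sym[of x v] d_sym[of x z] by (auto simp: in_C)
    then show ?thesis by simp
  qed
  then have 2: "(\<Sum>v\<in>C z y \<inter> C z x. t (d x v)) = n * t (h - 1)" by (simp add: n_def Int_commute)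
  have "t (d x v) = \<tau> (Suc h)" if v: "v \<in> C z y - C z x" for v
  proof -
    have vz: "d v z = 1" "Suc (d v x) \<noteq> d z x" using v d_sym by (auto simp: in_C)
    then have "d z x \<le> d v x" using adj_dist_cases[OF vz(1), of x] by auto
    then show ?thesis using t_far[OF vz(1), of x] assms d_sym[of z x] d_sym[of v x] by simp
  qed
  moreover have "real (card (C z y - C z x)) = real (c h) - n"
  proof -
    have "card (C z y - C z x) = card (C z y) - n"
      unfolding n_def using card_Diff_subset_Int[of "C z y" "C z x"] by (simp add: Int_commute)
    moreover have "n \<le> card (C z y)" unfolding n_def by (simp add: card_mono)
    ultimately show ?thesis using card_C[of z y] ne assms d_sym[of z y] by simp
  qed
  ultimately have "(\<Sum>v\<in>C z y - C z x. t (d x v)) = (real (c h) - n) * \<tau> (Suc h)" by simp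
  then have "(\<Sum>v\<in>C z y. t (d x v)) = n * t (h - 1) + (real (c h) - n) * \<tau> (Suc h)"
    using 2 sum.Int_Diff[of "C z y" "\<lambda>v. t (d x v)" "C z x"] by simp
  then show ?thesis using 1 balanced[OF ne(1), of x] xy assms by simp
qed

end

lemma card_ge_2_imp_ex_neq:
  assumes "2 \<le> card A"
  shows "\<exists>a\<in>A. \<exists>b\<in>A. a \<noteq> b"
proof -
  have "finite A" using assms card.infinite by fastforce
  then show ?thesis using card_le_Suc0_iff_eq[of A] assms by force
qed

section \<open>Block designs on the neighbours of a vertex\<close>

context q_poly_girth_6
begin

lemma far_iff:
  assumes "d x y = 1" "d y z < D"
  shows "d x z = Suc (d y z) \<longleftrightarrow> x \<notin> C y z"
  using adj_dist_cases[OF assms(1), of z] no_equal[OF assms(2) refl assms(1)] assms d_sym[of x y] by (auto simp: in_C)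

lemma card_far:
  assumes "d y z < D" "y \<noteq> z"
  shows "card {x. d y x = 1 \<and> d x z = Suc (d y z)} = k - c (d y z)"
proof -
  have "{x. d y x = 1 \<and> d x z = Suc (d y z)} = {x. d y x = 1} - C y z"
    using far_iff[of _ y z] assms d_sym by auto
  moreover have "C y z \<subseteq> {x. d y x = 1}" by (auto simp: in_C)
  ultimately show ?thesis using card_C[OF assms(2)] card_nbrs D_ge_3 by (simp add: card_Diff_subset)
qed

lemma \<tau>_neq: "h \<le> D \<Longrightarrow> 1 \<le> h \<Longrightarrow> t (h - 1) \<noteq> \<tau> (Suc h)"
  unfolding \<tau>_def by (rule t_neq) (auto simp: min_def)

text \<open>In \<open>block_meet\<close> the intersection size has the coefficient
  \<open>t (h - 1) - \<tau> (Suc h)\<close>, nonzero by injectivity, so the equation determines it.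
  Of the common neighbour only its being nearer or not enters.\<close>

lemma block_meet_unique:
  assumes "x \<noteq> y" "d x w = 1" "d w y = 1" "d x z = h" "d y z = h"
    and "x' \<noteq> y'" "d x' w' = 1" "d w' y' = 1" "d x' z' = h" "d y' z' = h"
    and "Suc (d w z) = h \<longleftrightarrow> Suc (d w' z') = h" "1 \<le> h"
  shows "card (C z x \<inter> C z y) = card (C z' x' \<inter> C z' y')"
proof -
  let ?n = "real (card (C z x \<inter> C z y))" and ?m = "real (card (C z' x' \<inter> C z' y'))"
  have "?n * t (h - 1) + (real (c h) - ?n) * \<tau> (Suc h) = ?m * t (h - 1) + (real (c h) - ?m) * \<tau> (Suc h)"
    using block_meet[OF assms(1-5,12)] block_meet[OF assms(6-10,12)] assms(11) by (simp split: if_splits)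
  then have "(?n - ?m) * (t (h - 1) - \<tau> (Suc h)) = 0" by (simp add: algebra_simps)
  moreover have "h \<le> D" using assms(4) d_le by auto
  then have "t (h - 1) \<noteq> \<tau> (Suc h)" using \<tau>_neq assms(12) by blast
  ultimately show ?thesis by simp
qed

lemma c_ge_2:
  assumes "3 \<le> h" "h \<le> D"
  shows "2 \<le> c h"
  using assms
proof (induction h rule: dec_induct)
  case base show ?case by (rule c_3_ge_2)
next
  case (step n)
  then show ?case using c_mono[of n] by simp
qed

lemma dist_2_3:
  assumes "d u z = 2" "d z v = 1" "v \<notin> C u z"
  shows "d u v = 3"
  using far_iff[of v z u] assms d_sym D_ge_3 by (auto simp: in_C)

text \<open>The sets \<open>C z x\<close> with \<open>x\<close> running over the neighbours of a vertex at distance 2 from \<open>z\<close>,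
  with a common point removed, form a symmetric block design.\<close>
lemma inner_design:
  obtains e :: nat where
    "real (c 3) * t 3 + (t 1 - t 3) - ((real e + 1) * t 2 + (real (c 3) - (real e + 1)) * \<tau> 4) = r 3 * (t 2 - t 3)"
    "(k - 2) * e = (c 3 - 1) * (c 3 - 2)"
proof -
  obtain y z where yz: "d y z = 3" using ex_dist[of 3] D_ge_3 by fastforce
  then have ne: "y \<noteq> z" by auto
  then obtain u where u: "u \<in> C y z" using C_nonempty by blast
  then have uy: "d u y = 1" "d u z = 2" using yz d_sym by (auto simp: in_C)
  then have uz: "u \<noteq> z" by auto
  obtain v1 where v1: "C u z = {v1}"
    using card_C[OF uz] uy c_2 card_1_singletonE by metis
  then have v1': "d u v1 = 1" "d v1 z = 1" using uy by (auto simp: C_def)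
  define S where "S = {x. d u x = 1} - {v1}"
  have S: "d x z = 3" if "x \<in> S" for x
    using far_iff[of x u z] that uy uz v1 d_sym D_ge_3 by (auto simp: S_def)
  have yS: "y \<in> S" using uy yz v1' by (auto simp: S_def)
  have cardS: "card (S - {y}) = k - 2"
    using card_nbrs[of u] yS v1' D_ge_3 by (simp add: S_def card_Diff_singleton)
  then have "S - {y} \<noteq> {}" using k_ge_3 by force
  then obtain x0 where x0: "x0 \<in> S" "x0 \<noteq> y" by blast
  have v1C: "v1 \<in> C z x" if "x \<in> S" for x
  proof -
    have "d u x = 1" "x \<noteq> v1" using that by (auto simp: S_def)
    then have "d v1 x = 2" using dist_2[of u v1 x] v1' by auto
    then show ?thesis using v1' S[OF that] d_sym[of z v1] d_sym[of z x] by (simp add: in_C)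
  qed
  \<comment> \<open>The subtraction discards \<open>v1\<close>, which lies in every block.\<close>
  define e where "e = card (C z x0 \<inter> C z y) - 1"
  have n: "card (C z x \<inter> C z y) = e + 1" if "x \<in> S" "x \<noteq> y" for x
  proof -
    have "card (C z x \<inter> C z y) = card (C z x0 \<inter> C z y)"
      by (rule block_meet_unique[where w=u and w'=u and h=3])
        (use that x0 S yS uy d_sym in \<open>auto simp: S_def\<close>)
    moreover have "v1 \<in> C z x0 \<inter> C z y" using v1C x0 yS by auto
    then have "0 < card (C z x0 \<inter> C z y)" by (auto simp: card_gt_0_iff)
    ultimately show ?thesis by (simp add: e_def)
  qed
  have "real (c 3) * t 3 + (if Suc (d u z) = 3 then t 1 - t 3 else 0) -
      (card (C z x0 \<inter> C z y) * t (3 - 1) + (real (c 3) - card (C z x0 \<inter> C z y)) * \<tau> (Suc 3)) = r 3 * (t 2 - t 3)"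
    by (rule block_meet) (use x0 S yS uy d_sym in \<open>auto simp: S_def\<close>)
  then have eq: "real (c 3) * t 3 + (t 1 - t 3) - ((real e + 1) * t 2 + (real (c 3) - (real e + 1)) * \<tau> 4) = r 3 * (t 2 - t 3)"
    using n[OF x0] uy by (simp add: add.commute)
  have cz: "card (C z y - {v1}) = c 3 - 1"
    using v1C[OF yS] card_C[of z y] ne yz d_sym[of z y] by (simp add: card_Diff_singleton)
  \<comment> \<open>Pairs of another block and a point it shares with the block of \<open>y\<close>
    are counted in two ways. The blocks through a point \<open>v\<close> come from
    \<open>C u v\<close>, from which \<open>v1\<close> and \<open>y\<close> itself drop out; hence
    \<open>c 3 - 2\<close>.\<close>
  have "(\<Sum>x\<in>S - {y}. card {v \<in> C z y - {v1}. v \<in> C z x}) = (c 3 - 2) * card (C z y - {v1})"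
  proof (rule sum_multicount; (simp; fail)?; intro ballI)
    fix v assume v: "v \<in> C z y - {v1}"
    then have vz: "d z v = 1" "d v y = 2" using yz d_sym[of z y] by (auto simp: in_C)
    have uv: "d u v = 3" by (rule dist_2_3) (use uy vz v v1 in auto)
    then have "u \<noteq> v" by auto
    have "{x \<in> S - {y}. v \<in> C z x} = C u v - {v1} - {y}"
      using S vz d_sym uv by (auto simp: S_def in_C)
    moreover have "v1 \<in> C u v" "y \<in> C u v - {v1}"
      using v1' uv uy vz v dist_2[of z v1 v] d_sym yz by (auto simp: in_C)
    ultimately show "card {x \<in> S - {y}. v \<in> C z x} = c 3 - 2"
      using card_C[OF \<open>u \<noteq> v\<close>] uv by (simp add: card_Diff_singleton)
  qed
  moreover have "card {v \<in> C z y - {v1}. v \<in> C z x} = e" if "x \<in> S - {y}" for x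
  proof -
    have "{v \<in> C z y - {v1}. v \<in> C z x} = C z x \<inter> C z y - {v1}" by auto
    moreover have "v1 \<in> C z x \<inter> C z y" using v1C that yS by auto
    ultimately show ?thesis using n[of x] that by (simp add: card_Diff_singleton)
  qed
  ultimately have "(k - 2) * e = (c 3 - 1) * (c 3 - 2)" using cardS cz by simp
  then show ?thesis using eq that by blast
qed

text \<open>The counterpart of \<open>inner_design\<close> with the common neighbour
  \<open>y'\<close> one step farther out. The blocks \<open>C z x\<close> for \<open>x\<close> in
  \<open>C y' z\<close> lie in \<open>C z y'\<close>, so there are \<open>c 4\<close> points and
  \<open>c 4\<close> blocks of size \<open>c 3\<close>, and no point is common to all by
  construction.\<close>

lemma outer_design:
  assumes "4 \<le> D"
  obtains f :: nat where
    "real (c 3) * t 3 - (real f * t 2 + (real (c 3) - real f) * t 4) = r 3 * (t 2 - t 3)"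
    "(c 4 - 1) * f = c 3 * (c 3 - 1)"
proof -
  obtain y' z where yz': "d y' z = 4" using ex_dist[of 4] assms by fastforce
  then have ne': "y' \<noteq> z" by auto
  then obtain y where y: "y \<in> C y' z" using C_nonempty by blast
  then have yy': "d y' y = 1" "d y z = 3" using yz' by (auto simp: in_C)
  have card4: "card (C y' z - {y}) = c 4 - 1"
    using y card_C[OF ne'] yz' by (simp add: card_Diff_singleton)
  then have "C y' z - {y} \<noteq> {}" using c_ge_2[of 4] assms by force
  then obtain x0 where x0: "x0 \<in> C y' z" "x0 \<noteq> y" by blast
  define f where "f = card (C z x0 \<inter> C z y)"
  have n: "card (C z x \<inter> C z y) = f" if "x \<in> C y' z" "x \<noteq> y" for x
    unfolding f_def
    by (rule block_meet_unique[where w=y' and w'=y' and h=3])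
      (use that x0 yy' yz' d_sym in \<open>auto simp: in_C\<close>)
  have "real (c 3) * t 3 + (if Suc (d y' z) = 3 then t 1 - t 3 else 0) -
      (card (C z x0 \<inter> C z y) * t (3 - 1) + (real (c 3) - card (C z x0 \<inter> C z y)) * \<tau> (Suc 3)) = r 3 * (t 2 - t 3)"
    by (rule block_meet) (use x0 yy' yz' d_sym in \<open>auto simp: in_C\<close>)
  then have eq: "real (c 3) * t 3 - (real f * t 2 + (real (c 3) - real f) * t 4) = r 3 * (t 2 - t 3)"
    using yz' assms by (simp add: f_def)
  have cz: "card (C z y) = c 3"
    using card_C[of z y] yy' d_sym[of z y] by fastforce
  have "(\<Sum>x\<in>C y' z - {y}. card {v \<in> C z y. v \<in> C z x}) = (c 3 - 1) * card (C z y)"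
  proof (rule sum_multicount; (simp; fail)?; intro ballI)
    fix v assume v: "v \<in> C z y"
    then have vz: "d z v = 1" "d v y = 2" using yy' d_sym[of z y] by (auto simp: in_C)
    have "d v y' = 3" using adj_dist'[OF yy'(1), of v] adj_dist'[OF vz(1), of y']
      adj_dist[OF vz(1), of y'] adj_dist[OF yy'(1), of v] vz yz' d_sym by simp
    then have y'v: "d y' v = 3" using d_sym by simp
    then have "y' \<noteq> v" by auto
    have vC: "v \<in> C z y'" using vz y'v yz' d_sym by (auto simp: in_C)
    have "{x \<in> C y' z - {y}. v \<in> C z x} = C y' v - {y}"
      using C_subset[OF vC] vz d_sym y'v yz' by (auto simp: in_C)
    moreover have "y \<in> C y' v"
      using yy' y'v vz d_sym by (auto simp: in_C)
    ultimately show "card {x \<in> C y' z - {y}. v \<in> C z x} = c 3 - 1"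
      using card_C[OF \<open>y' \<noteq> v\<close>] y'v by (simp add: card_Diff_singleton)
  qed
  moreover have "card {v \<in> C z y. v \<in> C z x} = f" if "x \<in> C y' z - {y}" for x
    using n[of x] that by (simp add: Int_def conj_commute)
  ultimately have "(c 4 - 1) * f = c 3 * (c 3 - 1)" using card4 cz by simp
  then show ?thesis using eq that by blast
qed

text \<open>\<open>block_meet\<close> is applied at distance \<open>h\<close> twice, with the common
  neighbour at distance \<open>h - 1\<close> and at distance \<open>h + 1\<close>. The two equations
  differ only in the term \<open>t 1 - t 3\<close> and in the intersection sizes, so
  \<open>i\<close> is a difference of cardinalities. The bound on \<open>c (h - 1)\<close> provides
  two distinct vertices in the first configuration.\<close>

lemma difference_ratio:
  assumes "3 \<le> h" "h < D" "c (h - 1) + 2 \<le> k"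
  obtains i :: int where "of_int i * (t (Suc h) - t (h - 1)) = t 1 - t 3"
proof -
  have "h - 1 < D" "h - 1 \<le> D" using assms by auto
  then obtain u z where uz: "d u z = h - 1" using ex_dist[of "h - 1"] by blast
  then have une: "u \<noteq> z" using assms by auto
  have "2 \<le> card {x. d u x = 1 \<and> d x z = Suc (d u z)}"
    using card_far[of u z] une uz assms \<open>h - 1 < D\<close> by simp
  then obtain x y where xy: "x \<noteq> y" "d u x = 1" "d x z = h" "d u y = 1" "d y z = h"
    using uz assms card_ge_2_imp_ex_neq[of "{x. d u x = 1 \<and> d x z = Suc (d u z)}"] by auto
  obtain w z' where wz: "d w z' = Suc h" using ex_dist[of "Suc h"] assms by fastforce
  then have "w \<noteq> z'" by auto
  then have "2 \<le> card (C w z')" using card_C wz c_ge_2[of "Suc h"] assms by simp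
  then obtain x' y' where xy': "x' \<noteq> y'" "x' \<in> C w z'" "y' \<in> C w z'"
    using card_ge_2_imp_ex_neq by blast
  let ?E = "card (C z x \<inter> C z y)" and ?F = "card (C z' x' \<inter> C z' y')"
  have "real (c h) * t 3 + (if Suc (d u z) = h then t 1 - t 3 else 0) -
      (?E * t (h - 1) + (real (c h) - ?E) * \<tau> (Suc h)) = r h * (t 2 - t h)"
    by (rule block_meet) (use xy d_sym assms in auto)
  moreover have "real (c h) * t 3 + (if Suc (d w z') = h then t 1 - t 3 else 0) -
      (?F * t (h - 1) + (real (c h) - ?F) * \<tau> (Suc h)) = r h * (t 2 - t h)"
    by (rule block_meet) (use xy' wz d_sym assms in \<open>auto simp: in_C\<close>)
  ultimately have "(real ?F - real ?E) * (t (Suc h) - t (h - 1)) = t 1 - t 3"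
    using uz wz assms by (simp add: algebra_simps)
  then show ?thesis using that[of "int ?F - int ?E"] by simp
qed

lemma eigen_0: "k * t 1 = \<theta> * t 0"
proof -
  have "(\<Sum>w | d x w = 1. t (d x w)) = k * t 1" for x
    using card_nbrs[of x] D_ge_3 by simp
  then show ?thesis using t_eigen[of _ x for x] by (metis d_self)
qed

lemma eigen_step:
  assumes "1 \<le> h" "h \<le> D"
  shows "c h * t (h - 1) + (real k - c h) * \<tau> (Suc h) = \<theta> * t h"
proof -
  obtain y z where yz: "d y z = h" using ex_dist[of h] assms by fastforce
  then have ne: "y \<noteq> z" using assms by auto
  have sub: "C y z \<subseteq> {w. d y w = 1}" by (auto simp: in_C)
  have "t (d w z) = t (h - 1)" if "w \<in> C y z" for w
  proof -
    have "d w z = h - 1" using that yz by (auto simp: in_C)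
    then show ?thesis by simp
  qed
  then have 1: "(\<Sum>w\<in>C y z. t (d w z)) = c h * t (h - 1)"
    using card_C[OF ne] yz by simp
  have "t (d w z) = \<tau> (Suc h)" if "w \<in> {w. d y w = 1} - C y z" for w
    using t_far[of w y z] adj_dist_cases[of y w z] that d_sym[of y w] yz by (auto simp: in_C)
  moreover have "real (card ({w. d y w = 1} - C y z)) = real k - c h"
    using card_C[OF ne] card_nbrs[of y] card_mono[OF _ sub] sub yz D_ge_3
    by (simp add: card_Diff_subset of_nat_diff)
  ultimately have 2: "(\<Sum>w\<in>{w. d y w = 1} - C y z. t (d w z)) = (real k - c h) * \<tau> (Suc h)" by simp
  have "(\<Sum>w | d y w = 1. t (d w z)) = (\<Sum>w\<in>{w. d y w = 1} - C y z. t (d w z)) + (\<Sum>w\<in>C y z. t (d w z))"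
    by (rule sum.subset_diff[OF sub]) simp
  then have "(\<Sum>w | d y w = 1. t (d z w)) = c h * t (h - 1) + (real k - c h) * \<tau> (Suc h)"
    using 1 2 by (simp add: d_sym[of z])
  then show ?thesis using t_eigen[of z y] yz d_sym[of z y] by simp
qed

lemma t_0_pos: "0 < t 0"
proof -
  have "t 0 = (\<Sum>x\<in>UNIV. t (d x y) * t (d x y))" for y using t_idem[of y y] by simp
  moreover have "0 \<le> (\<Sum>x\<in>UNIV. t (d x y) * t (d x y))" for y by (rule sum_nonneg) simp
  moreover have "t 0 \<noteq> 0"
  proof
    assume t0: "t 0 = 0"
    obtain x y where xy: "d x y = 1" using ex_dist[of 1] D_ge_3 by fastforce
    have "(\<Sum>x\<in>UNIV. t (d x y) * t (d x y)) = 0" using t_idem[of y y] t0 by simp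
    then have "t (d x y) * t (d x y) = 0" by (subst (asm) sum_nonneg_eq_0_iff) auto
    then have "t 1 = t 0" using t0 xy by simp
    then show False using t_neq[of 0 1] D_ge_3 by simp
  qed
  ultimately show ?thesis by (metis order_le_less)
qed

end

section \<open>Diameter at least 4: only the Odd parameters survive\<close>

context q_poly_girth_6
begin

text \<open>Eliminates \<open>r h\<close> between the balanced-set identity at \<open>x = y\<close>
  and the one with \<open>x\<close> beyond \<open>y\<close>. The case \<open>h = D\<close> is
  included when \<open>c D < k\<close>, and then says that the sequence stops consistently.\<close>

lemma recurrence:
  assumes "1 \<le> h" "h \<le> D" "c h < k"
  shows "(t 2 - t h) * (t 0 - t h) = (t 1 - t (h - 1)) * (t 1 - \<tau> (Suc h))"
proof -
  obtain y z where yz: "d y z = h" using ex_dist[of h] assms by fastforce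
  then have ne: "y \<noteq> z" using assms by auto
  have c0: "c h \<noteq> 0" using C_nonempty[OF ne] card_C[OF ne] yz by (metis card_eq_0_iff finite)
  have "c h * ((t 2 - t h) * (t 0 - t h)) = (r h * (t 0 - t h)) * (t 1 - \<tau> (Suc h))"
    using far_relation[OF assms] by simp
  then have "c h * ((t 2 - t h) * (t 0 - t h)) = c h * ((t 1 - t (h - 1)) * (t 1 - \<tau> (Suc h)))"
    unfolding r_eq[OF assms(2,1)] by simp
  then show ?thesis using c0 by simp
qed

text \<open>With these two values \<open>hexagon_eq\<close> turns into
  \<open>t 0 + t 1 = t 2 + t 3\<close>, the beginning of the two arithmetic progressions in
  \<open>t_formula\<close>.\<close>

definition odd_like :: bool where
  "odd_like \<longleftrightarrow> c 3 = 2 \<and> r 3 = -2"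

lemma large_diameter_cases:
  assumes D4: "4 \<le> D" and no: "\<not> odd_like"
  obtains g q :: int and v :: real where "2 \<le> g" "2 \<le> q" "q \<noteq> g"
    "large_parameters (t 0) (t 1) (t 2) (t 3) (t 4) v g q"
    "(real k - 2) * (q - 1) = (real (c 3) - 1) * (q - 1 + g\<^sup>2 - g)"
    "(real (c 4) - 1) * q = (real (c 3) - 1) * (q + g\<^sup>2 - g)"
    "g * c 3 = (q - 1 + g\<^sup>2 + g) * (q + g\<^sup>2 - g)"
proof -
  define u where "u = t 2 - t 3"
  have u: "u \<noteq> 0" using t_neq[of 2 3] D4 by (simp add: u_def)
  define A T X where "A = (t 1 - t 2) / u" and "T = (t 0 - t 1) / u" and "X = (t 4 - t 3) / u"
  have u2: "t 2 = t 3 + u" by (simp add: u_def)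
  have "A * u = t 1 - t 2" "T * u = t 0 - t 1" "X * u = t 4 - t 3" using u by (simp_all add: A_def T_def X_def)
  then have A: "t 1 = t 3 + (A + 1) * u" and T: "t 0 = t 3 + (T + A + 1) * u" and X: "t 4 = t 3 + X * u"
    using u2 by (simp_all add: algebra_simps)
  obtain e where e: "real (c 3) * t 3 + (t 1 - t 3) - ((real e + 1) * t 2 + (real (c 3) - (real e + 1)) * \<tau> 4) = r 3 * (t 2 - t 3)"
    "(k - 2) * e = (c 3 - 1) * (c 3 - 2)" using inner_design .
  obtain f where f: "real (c 3) * t 3 - (real f * t 2 + (real (c 3) - real f) * t 4) = r 3 * (t 2 - t 3)"
    "(c 4 - 1) * f = c 3 * (c 3 - 1)" using outer_design[OF D4] .
  have c3k: "c 3 < k" using c_lt D4 by simp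
  have canc: "x = y" if "x * u = y * u" for x y using that u by simp
  have "(r 3 * (T + A + 1)) * u = (c 3 * A) * u"
    using r_eq[of 3] D4 by (simp del: One_nat_def add: A T u2 algebra_simps)
  then have 1: "r 3 * (T + A + 1) = c 3 * A" by (rule canc)
  have "(T + (real (c 3) - 1)) * u = (r 3 * A) * u"
    using hexagon_eq by (simp del: One_nat_def add: A T u2 algebra_simps)
  then have 2: "T + (real (c 3) - 1) = r 3 * A" by (rule canc)
  have "(real (c 3)) * u = (r 3 * (A + 1 - X)) * u"
    using far_relation[of 3] D4 c3k by (simp del: One_nat_def add: A X u2 algebra_simps)
  then have 3: "c 3 = r 3 * (A + 1 - X)" by (rule canc)
  have "(A - (real (c 3) - 1) * X + e * (X - 1)) * u = (r 3) * u"
    using e(1) D4 by (simp del: One_nat_def add: A X u2 algebra_simps)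
  then have 4: "A - (real (c 3) - 1) * X + e * (X - 1) = r 3" by (rule canc)
  have "(f * (X - 1)) * u = (c 3 * X + r 3) * u"
    using f(1) by (simp add: X u2 algebra_simps)
  then have 5: "f * (X - 1) = c 3 * X + r 3" by (rule canc)
  have A0: "A \<noteq> 0" using t_neq[of 1 2] D4 by (auto simp del: One_nat_def simp: A u2)
  have A1: "A + 1 \<noteq> 0" using t_neq[of 1 3] D4 by (auto simp del: One_nat_def simp: A)
  have X1: "X \<noteq> 1" using t_neq[of 4 2] D4 by (auto simp: X u2)
  have X0: "X \<noteq> 0" using t_neq[of 4 3] D4 by (auto simp: X)
  have c4: "2 \<le> c 4" using c_ge_2[of 4] D4 by simp
  have odd: "\<not> (c 3 = 2 \<and> r 3 = -2)" using no by (simp add: odd_like_def)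
  obtain g q :: int where gq: "2 \<le> g" "2 \<le> q" and r: "r 3 = 1 - g\<^sup>2 - g - q"
    and gc: "g * c 3 = r 3 * (r 3 + 2 * g - 1)"
    and gA: "(g - 1) * A = r 3 + 2 * g" and gX: "g * (X - 1) = A + 1"
    and K: "(real k - 2) * (q - 1) = (real (c 3) - 1) * (q - 1 + g\<^sup>2 - g)"
    and C4: "(real (c 4) - 1) * q = (real (c 3) - 1) * (q + g\<^sup>2 - g)"
    using parameters_integral[OF 1 2 3 4 5 A0 A1 X1 c_3_ge_2 c3k k_ge_3 c4 e(2) f(2) odd] .
  define G where "G = real_of_int g"
  define P where "P = real_of_int q"
  have G: "2 \<le> G" "2 \<le> P" using gq by (simp_all add: G_def P_def)
  \<comment> \<open>\<open>A\<close> and \<open>X\<close> have the denominators \<open>G - 1\<close>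
    and \<open>G * (G - 1)\<close>; in units of \<open>v\<close> all differences become polynomials
    in \<open>G\<close> and \<open>P\<close>.\<close>
  define v where "v = u / (G * (G - 1))"
  have uv: "u = G * (G - 1) * v" and v: "v \<noteq> 0" using G u by (simp_all add: v_def)
  have r': "r 3 = 1 - G\<^sup>2 - G - P" using r by (simp add: G_def P_def)
  have gA1: "(G - 1) * (A + 1) = - (P + G\<^sup>2 - 2 * G)" using gA unfolding r by (simp add: G_def P_def algebra_simps)
  have gX1: "G * (X - 1) = A + 1" using gX by (simp add: G_def)
  have gc': "G * c 3 = (P - 1 + G\<^sup>2 + G) * (P + G\<^sup>2 - G)"
    using gc unfolding r by (simp add: G_def P_def algebra_simps)
  have cA: "G * (A + 1 - X) = - (P + G\<^sup>2 - G)"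
  proof -
    have "r 3 * (G * (A + 1 - X)) = G * c 3" using 3 by simp
    also have "\<dots> = r 3 * (- (P + G\<^sup>2 - G))" unfolding gc' r' by (simp add: algebra_simps)
    finally have "r 3 * (G * (A + 1 - X)) = r 3 * (- (P + G\<^sup>2 - G))" .
    moreover have "r 3 \<noteq> 0" using 3 c_3_ge_2 by auto
    ultimately show ?thesis by simp
  qed
  have X0': "G * (G - 1) * X = G - P"
  proof -
    have "G * (G - 1) * X = G * (G - 1) * (A + 1) - (G - 1) * (G * (A + 1 - X))" by (simp add: algebra_simps)
    also have "\<dots> = G * ((G - 1) * (A + 1)) - (G - 1) * (G * (A + 1 - X))" by simp
    finally show ?thesis unfolding gA1 cA by (simp add: power2_eq_square algebra_simps)
  qed
  \<comment> \<open>Equality would give \<open>X = 0\<close>, that is,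
    \<open>t 4 = t 3\<close>.\<close>
  have qg: "q \<noteq> g"
    using X0' X0 G by (auto simp: G_def P_def)
  show thesis
  proof (rule that[OF gq qg])
    show "large_parameters (t 0) (t 1) (t 2) (t 3) (t 4) v g q"
      unfolding G_def[symmetric] P_def[symmetric]
    proof
      show "2 \<le> G" "2 \<le> P" "v \<noteq> 0" by fact+
      show "t 2 - t 3 = G * (G - 1) * v" using u2 uv by simp
      have "t 1 - t 3 = G * ((G - 1) * (A + 1)) * v" using A uv by simp
      also have "\<dots> = - G * (P + G\<^sup>2 - 2 * G) * v" unfolding gA1 by (simp only: mult_minus_right mult_minus_left)
      finally show "t 1 - t 3 = - G * (P + G\<^sup>2 - 2 * G) * v" .
      have "t 4 - t 2 = (G - 1) * (G * (X - 1)) * v" using X u2 uv by (simp add: algebra_simps)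
      then show "t 4 - t 2 = - (P + G\<^sup>2 - 2 * G) * v" unfolding gX1 gA1 by simp
      have "t 0 - t 4 = (T + (A + 1 - X)) * u" using T X by (simp add: algebra_simps)
      also have "T = r 3 * A - (real (c 3) - 1)" using 2 by simp
      also have "(r 3 * A - (real (c 3) - 1) + (A + 1 - X)) * u =
         (r 3 * G * ((G - 1) * (A + 1)) - G * (G - 1) * r 3 - (G - 1) * (G * c 3) + G * (G - 1)
           + (G - 1) * (G * (A + 1 - X))) * v"
        unfolding uv by (simp add: algebra_simps)
      also have "\<dots> = (P + G\<^sup>2) * (P + G\<^sup>2 - 2 * G) * v"
        unfolding gA1 gc' cA r' by (simp add: power2_eq_square algebra_simps)
      finally show "t 0 - t 4 = (P + G\<^sup>2) * (P + G\<^sup>2 - 2 * G) * v" .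
    qed
    show "g * c 3 = (q - 1 + g\<^sup>2 + g) * (q + g\<^sup>2 - g)"
    proof -
      have "real_of_int (g * c 3) = real_of_int ((q - 1 + g\<^sup>2 + g) * (q + g\<^sup>2 - g))"
        using gc' by (simp add: G_def P_def)
      then show ?thesis by (simp only: of_int_eq_iff)
    qed
  qed (use K C4 in auto)
qed

lemma odd_like_of_large_diameter:
  assumes D4: "4 \<le> D"
  shows odd_like
proof (rule ccontr)
  assume "\<not> odd_like"
  then obtain g q :: int and v :: real where gq: "2 \<le> g" "2 \<le> q" "q \<noteq> g"
    and L: "large_parameters (t 0) (t 1) (t 2) (t 3) (t 4) v g q"
    and K: "(real k - 2) * (q - 1) = (real (c 3) - 1) * (q - 1 + g\<^sup>2 - g)"
    and C4: "(real (c 4) - 1) * q = (real (c 3) - 1) * (q + g\<^sup>2 - g)"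
    and gc: "g * c 3 = (q - 1 + g\<^sup>2 + g) * (q + g\<^sup>2 - g)"
    using large_diameter_cases[OF D4] by metis
  interpret L: large_parameters "t 0" "t 1" "t 2" "t 3" "t 4" v g q by (rule L)
  have v: "v \<noteq> 0" by (rule L.v)
  have c3: "2 \<le> real (c 3)" using c_3_ge_2 by simp
  have gg: "0 < real_of_int (g\<^sup>2 - g)" using gq by (simp add: power2_eq_square)
  \<comment> \<open>Both design counts carry the same positive excess \<open>a\<close>. The first
    gives \<open>c 3 + 1 < k\<close>, and comparing it with the second gives
    \<open>c 4 + 1 < k\<close>. These are the bounds that \<open>recurrence\<close> at 4 and
    \<open>difference_ratio\<close> at 4 and 5 require.\<close>
  define a where "a = (real (c 3) - 1) * real_of_int (g\<^sup>2 - g)"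
  have a: "0 < a" using c3 gg by (simp add: a_def)
  define P where "P = real_of_int q"
  have P: "2 \<le> P" using gq by (simp add: P_def)
  have K': "(real k - 2) * (P - 1) = (real (c 3) - 1) * (P - 1) + a"
    using K by (simp add: a_def P_def algebra_simps)
  have C4': "(real (c 4) - 1) * P = (real (c 3) - 1) * P + a"
    using C4 by (simp add: a_def P_def algebra_simps)
  have kc3: "real k - 2 > real (c 3) - 1"
  proof (rule ccontr)
    assume "\<not> ?thesis"
    then have "(real k - 2) * (P - 1) \<le> (real (c 3) - 1) * (P - 1)" using P by (intro mult_right_mono) auto
    then show False using K' a by simp
  qed
  have kc4: "real k - 2 > real (c 4) - 1"
  proof (rule ccontr)
    assume "\<not> ?thesis"
    then have "(real k - 2) * P \<le> (real (c 4) - 1) * P" using P by (intro mult_right_mono) auto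
    then have "(real k - 2) * P \<le> (real (c 3) - 1) * P + a" using C4' by simp
    then have "(real k - 2) - (real (c 3) - 1) \<le> 0" using K' by (simp add: algebra_simps)
    then show False using kc3 by simp
  qed
  then have c4k: "c 4 < k" by linarith
  have 4: "(t 2 - t 4) * (t 0 - t 4) = (t 1 - t 3) * (t 1 - \<tau> 5)"
    using recurrence[of 4] D4 c4k by simp
  \<comment> \<open>Only from diameter 6 on are both \<open>t 5\<close> and \<open>t 6\<close>
    available together with intersection counts at distances 4 and 5. The smaller diameters are
    settled by the cut-off recurrence and, if \<open>D = 5\<close> and \<open>c 5 = k\<close>, by
    the eigenvector equations.\<close>
  consider "D = 4" | "D = 5" | "6 \<le> D" using D4 by linarith
  then show False
  proof cases
    case 1
    have "\<tau> 5 = t 4" by (simp only: \<tau>_def) (simp add: 1)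
    then show False using L.not_4 4 by metis
  next
    case 2
    have t5: "\<tau> 5 = t 5" "\<tau> 6 = t 5" by (simp_all only: \<tau>_def) (simp_all add: 2)
    show False
    proof (cases "c 5 < k")
      case True
      then have "(t 2 - t 5) * (t 0 - t 5) = (t 1 - t 4) * (t 1 - t 5)"
        using recurrence[of 5] 2 t5 by simp
      then show False using L.not_5 4 unfolding t5 by blast
    next
      case False
      obtain y z where yz: "d y z = 5" using ex_dist[of 5] 2 by fastforce
      have "card (C y z) \<le> card {w. d y w = 1}" by (rule card_mono) (auto simp: in_C)
      then have c5: "c 5 = k" using card_C[of y z] yz card_nbrs[of y] 2 False by (cases "y = z") auto
      have e1: "t 0 + (real k - 1) * t 2 = \<theta> * t 1"
        using eigen_step[of 1] c_1 D4 by simp (simp add: numeral_2_eq_2)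
      have "k * t 4 = \<theta> * t 5" using eigen_step[of 5] c5 2 by simp
      then have e5: "k * (t 1 - t 4) = \<theta> * (t 0 - t 5)" using eigen_0 by (simp add: algebra_simps)
      have th: "(\<theta> + 1) * (t 0 - t 1) = (real k - 1) * (t 1 - t 2)"
        using eigen_0 e1 by (simp add: algebra_simps)
      have t01: "t 0 \<noteq> t 1" using t_neq[of 0 1] D4 by simp
      have qg: "real_of_int q \<le> g \<or> real_of_int g + 1 \<le> q" using gq by linarith
      have gc': "real_of_int g * real (c 3) =
          (real_of_int q - 1 + (real_of_int g)\<^sup>2 + real_of_int g) * (real_of_int q + (real_of_int g)\<^sup>2 - real_of_int g)"
        using arg_cong[OF gc, of real_of_int] by simp
      have K2: "(real k - 2) * (real_of_int q - 1) = (real (c 3) - 1) * (real_of_int q - 1 + (real_of_int g)\<^sup>2 - real_of_int g)"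
        using K by simp
      show False by (rule L.not_bipartite_5[OF 4[unfolded t5] K2 gc' qg t01 th e5])
    qed
  next
    case 3
    have "c 5 < k" using c_lt 3 by simp
    then have 5: "(t 2 - t 5) * (t 0 - t 5) = (t 1 - t 4) * (t 1 - t 6)"
      using recurrence[of 5] 3 by simp
    have rec4: "(t 2 - t 4) * (t 0 - t 4) = (t 1 - t 3) * (t 1 - t 5)" using 4 3 by simp
    have "3 \<le> (4::nat)" "4 < D" "c (4 - 1) + 2 \<le> k" using kc3 3 by simp_all
    then obtain i :: int where i: "of_int i * (t (Suc 4) - t (4 - 1)) = t 1 - t 3"
      by (rule difference_ratio)
    have "3 \<le> (5::nat)" "5 < D" "c (5 - 1) + 2 \<le> k" using kc4 3 by simp_all
    then obtain j :: int where j: "of_int j * (t (Suc 5) - t (5 - 1)) = t 1 - t 3"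
      by (rule difference_ratio)
    have i': "of_int i * (t 5 - t 3) = t 1 - t 3" and j': "of_int j * (t 6 - t 4) = t 1 - t 3"
      using i j by simp_all
    have nz: "L.w * v \<noteq> 0" using L.w_pos v by simp
    have t13: "t 1 - t 3 = - g * (L.w * v)" using L.t13 by (simp add: L.w_def)
    have "g * (of_int i * (t 5 - t 3)) = of_int i * (q * L.w * v)"
      using L.t53[OF rec4] by (metis mult.left_commute)
    then have "(L.w * v) * real_of_int (- g * g) = (L.w * v) * real_of_int (i * q)"
      unfolding i' t13 by (simp add: algebra_simps)
    then have "real_of_int (- g * g) = real_of_int (i * q)" using nz mult_left_cancel by blast
    then have ip: "i * q = - g\<^sup>2" unfolding of_int_eq_iff by (simp add: power2_eq_square)
    have "real_of_int g ^ 2 * (of_int j * (t 6 - t 4)) = of_int j * (- L.w * (real_of_int q ^ 2 + real_of_int g ^ 2 * (q - 1)) * v)"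
      by (subst mult.left_commute) (simp only: L.t64[OF rec4 5] of_int_diff of_int_1)
    then have "(L.w * v) * real_of_int (g ^ 3) = (L.w * v) * real_of_int (j * (q\<^sup>2 + g\<^sup>2 * (q - 1)))"
      unfolding j' t13 by (simp add: algebra_simps power2_eq_square power3_eq_cube)
    then have "real_of_int (g ^ 3) = real_of_int (j * (q\<^sup>2 + g\<^sup>2 * (q - 1)))" using nz mult_left_cancel by blast
    then have "j * (q\<^sup>2 + g\<^sup>2 * (q - 1)) = g ^ 3" unfolding of_int_eq_iff by simp
    then show False using no_integral_ratios[OF gq ip] by blast
  qed
qed

end

section \<open>Diameter 3: divisibility in place of the outer design\<close>

lemma diameter_3_parameters:
  fixes e c k :: nat and r A T :: real
  assumes 1: "r * (T + A + 1) = c * A" and 2: "T + (real c - 1) = r * A" and 3: "c = r * (A + 1)"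
    and 4: "A - e = r" and T: "T \<noteq> 0" and c: "2 \<le> c" and k: "3 \<le> k"
    and e: "(k - 2) * e = (c - 1) * (c - 2)" and dvd: "c dvd k * (k - 1)\<^sup>2"
  shows "c = 2 \<and> r = -2"
proof -
  have r0: "r \<noteq> 0" using 3 c by auto
  have A: "A = e + r" using 4 by simp
  have rc: "r * (e + r + 1) = c" using 3 A by (simp add: algebra_simps)
  have "A * (r\<^sup>2 + r - c) = r * (real c - 2)" using base_relation[OF 1 2] .
  then have "r * (- (real e * (e + r))) = r * (real c - 2)" unfolding A rc[symmetric]
    by (simp add: power2_eq_square algebra_simps)
  then have "- (real e * (e + r)) = real c - 2" using r0 mult_left_cancel by blast
  then have er: "real e * (e + r) = 2 - real c" by simp
  show ?thesis
  proof (cases "e = 0")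
    case True
    then have "c = 2" using er by simp
    then have "(r - 1) * (r + 2) = 0" using rc True by (simp add: algebra_simps)
    moreover have "r \<noteq> 1"
    proof
      assume "r = 1"
      then have "A = 1" using A True by simp
      then show False using 2 T \<open>r = 1\<close> \<open>c = 2\<close> by simp
    qed
    ultimately show ?thesis using \<open>c = 2\<close> by simp
  next
    case False
    have "r = (2 - real c) / e - e" using er False by (simp add: field_simps)
    then have "r \<in> \<rat>" by (metis Rats_diff Rats_divide Rats_of_nat Rats_number_of)
    moreover have "r\<^sup>2 + (int e + 1) * r + (- int c) = 0"
      using rc by (simp add: power2_eq_square algebra_simps)
    ultimately have "r \<in> \<int>" using rational_quadratic_root_int[of r "int e + 1" "- int c"] by simp
    then obtain s :: int where s: "r = of_int s" by (auto simp: Ints_def)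
    \<comment> \<open>The single integer \<open>w\<close> determines all parameters:
      \<open>e = w * w - w - 2\<close>, \<open>c = (w - 1) * (w * w - 2)\<close> and
      \<open>k = 2 + (c - 1) * w\<close>.\<close>
    define w where "w = - (int e + s)"
    have ew: "int e * w = int c - 2"
    proof -
      have "real_of_int (int e * w) = real_of_int (int c - 2)" using er by (simp add: w_def s algebra_simps)
      then show ?thesis by (simp only: of_int_eq_iff)
    qed
    have cw: "int c = (int e + w) * (w - 1)"
    proof -
      have "real_of_int (int c) = real_of_int ((int e + w) * (w - 1))" using rc by (simp add: w_def s algebra_simps)
      then show ?thesis by (simp only: of_int_eq_iff)
    qed
    have e1: "1 \<le> int e" using False by simp
    have ewe: "int e = w * w - w - 2" using ew cw by (simp add: algebra_simps)
    have "0 \<le> w" using ew e1 c zero_le_mult_iff[of "int e" w] by auto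
    moreover have "w \<noteq> 0" "w \<noteq> 1" "w \<noteq> 2" using ewe e1 by auto
    ultimately have w3: "3 \<le> w" by linarith
    have "int ((k - 2) * e) = int ((c - 1) * (c - 2))" using e by simp
    then have "(int k - 2) * int e = (int c - 1) * (int c - 2)" using k c by (simp add: of_nat_diff)
    then have "int e * (int k - 2) = int e * ((int c - 1) * w)" using ew by (metis mult.commute mult.left_commute)
    then have K: "int k = 2 + (int c - 1) * w" using e1 by simp
    have c2: "int c = (w - 1) * (w * w - 2)" using ew ewe by (simp add: algebra_simps)
    have "int c dvd int k * (int k - 1)\<^sup>2"
    proof -
      have "int c dvd int (k * (k - 1)\<^sup>2)" using dvd by (simp only: of_nat_dvd_iff)
      then show ?thesis using k by (simp add: of_nat_diff)
    qed
    \<comment> \<open>Modulo \<open>c\<close>, the formula for \<open>k\<close> reads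
      \<open>2 - w\<close>, so that \<open>k - 1\<close> reads \<open>1 - w\<close>; the cofactor of
      \<open>c\<close> is spelled out.\<close>
    moreover have "int k * (int k - 1)\<^sup>2 = (2 - w) * (1 - w)\<^sup>2 +
       int c * (w * (int k - 1)\<^sup>2 + (2 - w) * w * (2 * (1 - w) + int c * w))"
      unfolding K by (simp add: power2_eq_square algebra_simps)
    ultimately have "int c dvd (2 - w) * (1 - w)\<^sup>2" by (metis dvd_add_left_iff dvd_triv_left)
    then have "(w - 1) * (w * w - 2) dvd (w - 1) * ((2 - w) * (w - 1))"
      unfolding c2 by (simp add: power2_eq_square algebra_simps)
    then have "w * w - 2 dvd (2 - w) * (w - 1)" using w3 by simp
    \<comment> \<open>Adding the divisor lowers the degree: the sum is \<open>3 * w - 4\<close>,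
      positive and smaller than \<open>w * w - 2\<close> for \<open>w \<ge> 3\<close>.\<close>
    then have "w * w - 2 dvd (2 - w) * (w - 1) + (w * w - 2)" by simp
    then have "w * w - 2 dvd 3 * w - 4" by (simp add: algebra_simps)
    then have "w * w - 2 \<le> 3 * w - 4" using w3 by (intro zdvd_imp_le) auto
    moreover have "0 < (w - 1) * (w - 2)" using w3 by simp
    ultimately show ?thesis by (simp add: algebra_simps)
  qed
qed

context q_poly_girth_6
begin

lemma sphere_step:
  assumes "1 \<le> h" "h < D"
  shows "card {x. d x z = Suc h} * c (Suc h) = card {x. d x z = h} * (k - c h)"
proof -
  have "(\<Sum>x\<in>{x. d x z = Suc h}. card {y \<in> {y. d y z = h}. d x y = 1}) = (k - c h) * card {y. d y z = h}"
  proof (rule sum_multicount; (simp; fail)?; intro ballI)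
    fix y assume "y \<in> {y. d y z = h}"
    then have y: "d y z = h" "y \<noteq> z" using assms by auto
    have "{x \<in> {x. d x z = Suc h}. d x y = 1} = {x. d y x = 1 \<and> d x z = Suc (d y z)}"
      using y d_sym by auto
    then show "card {x \<in> {x. d x z = Suc h}. d x y = 1} = k - c h"
      using card_far[of y z] y assms by simp
  qed
  moreover have "card {y \<in> {y. d y z = h}. d x y = 1} = c (Suc h)" if "x \<in> {x. d x z = Suc h}" for x
  proof -
    have x: "d x z = Suc h" "x \<noteq> z" using that by auto
    have "{y \<in> {y. d y z = h}. d x y = 1} = C x z" using x by (auto simp: in_C)
    then show ?thesis using card_C[OF x(2)] x by simp
  qed
  ultimately show ?thesis by (simp add: mult.commute)
qed

text \<open>The sphere of radius 3 has \<open>k * (k - 1)\<^sup>2\<close> divided by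
  \<open>c 3\<close> elements, which is an integer.\<close>

lemma c_3_dvd: "c 3 dvd k * (k - 1)\<^sup>2"
proof -
  fix z
  have "card {x. d x z = 1} = k" using card_nbrs[of z] D_ge_3 by (simp add: d_sym[of _ z])
  then have "card {x. d x z = 2} = k * (k - 1)"
    using sphere_step[of 1 z] D_ge_3 c_1 c_2 by (simp add: numeral_2_eq_2)
  then have "card {x. d x z = 3} * c 3 = k * (k - 1) * (k - 1)"
    using sphere_step[of 2 z] D_ge_3 c_2 by simp
  then show ?thesis by (metis dvd_triv_right power2_eq_square mult.assoc)
qed

lemma odd_like_of_diameter_3:
  assumes D3: "D = 3" and c3k: "c 3 < k"
  shows odd_like
proof -
  define u where "u = t 2 - t 3"
  have u: "u \<noteq> 0" using t_neq[of 2 3] D3 by (simp add: u_def)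
  define A T where "A = (t 1 - t 2) / u" and "T = (t 0 - t 1) / u"
  have u2: "t 2 = t 3 + u" by (simp add: u_def)
  have "A * u = t 1 - t 2" "T * u = t 0 - t 1" using u by (simp_all add: A_def T_def)
  then have A: "t 1 = t 3 + (A + 1) * u" and T: "t 0 = t 3 + (T + A + 1) * u"
    using u2 by (simp_all add: algebra_simps)
  \<comment> \<open>Neighbours beyond distance 3 do not exist, so \<open>t 3\<close> plays the part
    of \<open>t 4\<close>, and \<open>X\<close> becomes 0.\<close>
  have \<tau>4: "\<tau> 4 = t 3" by (simp only: \<tau>_def) (simp add: D3)
  obtain e where e: "real (c 3) * t 3 + (t 1 - t 3) - ((real e + 1) * t 2 + (real (c 3) - (real e + 1)) * \<tau> 4) = r 3 * (t 2 - t 3)"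
    "(k - 2) * e = (c 3 - 1) * (c 3 - 2)" using inner_design .
  have canc: "x = y" if "x * u = y * u" for x y using that u by simp
  have "(r 3 * (T + A + 1)) * u = (c 3 * A) * u"
    using r_eq[of 3] D3 by (simp del: One_nat_def add: A T u2 algebra_simps)
  then have 1: "r 3 * (T + A + 1) = c 3 * A" by (rule canc)
  have "(T + (real (c 3) - 1)) * u = (r 3 * A) * u"
    using hexagon_eq by (simp del: One_nat_def add: A T u2 algebra_simps)
  then have 2: "T + (real (c 3) - 1) = r 3 * A" by (rule canc)
  have "(real (c 3)) * u = (r 3 * (A + 1)) * u"
    using far_relation[of 3] D3 c3k \<tau>4 by (simp del: One_nat_def add: A u2 algebra_simps)
  then have 3: "c 3 = r 3 * (A + 1)" by (rule canc)
  have "(A - e) * u = r 3 * u"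
    using e(1) \<tau>4 by (simp del: One_nat_def add: A u2 algebra_simps)
  then have 4: "A - e = r 3" by (rule canc)
  have "T \<noteq> 0" using t_neq[of 0 1] D3 by (auto simp del: One_nat_def simp: A T)
  then show ?thesis
    using diameter_3_parameters[OF 1 2 3 4 _ c_3_ge_2 k_ge_3 e(2) c_3_dvd] by (simp add: odd_like_def)
qed

lemma c_le_k: "1 \<le> h \<Longrightarrow> h \<le> D \<Longrightarrow> c h \<le> k"
proof -
  assume h: "1 \<le> h" "h \<le> D"
  obtain y z where yz: "d y z = h" using ex_dist[of h] h by fastforce
  then have "y \<noteq> z" using h by auto
  moreover have "card (C y z) \<le> card {w. d y w = 1}" by (rule card_mono) (auto simp: in_C)
  ultimately show "c h \<le> k" using card_C yz card_nbrs D_ge_3 by simp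
qed

end

section \<open>The Odd parameters: the sequence \<open>t\<close>, the eigenvalue and the
  valency\<close>

locale q_poly_odd_like = q_poly_girth_6 +
  assumes odd_like: odd_like
begin

definition b where "b = t 0 - t 2"

lemma t_3: "t 3 = t 1 + b"
  using hexagon_eq odd_like by (simp add: odd_like_def b_def algebra_simps)

lemma t_2: "t 2 = t 0 - b"
  by (simp add: b_def)

text \<open>The relation \<open>t 0 + t 1 = t 2 + t 3\<close> closes the first three eigenvector
  equations into the cubic \<open>(\<theta> + k - 1) * (\<theta>\<^sup>2 - k\<^sup>2) = 0\<close>.
  The root \<open>k\<close> would make \<open>t 0 = t 1\<close>, the root \<open>- k\<close> would
  make \<open>t 0 = t 2\<close>.\<close>

lemma theta: "\<theta> = 1 - real k"
proof -
  have e0: "k * t 1 = \<theta> * t 0" by (rule eigen_0)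
  have e1: "t 0 + (real k - 1) * t 2 = \<theta> * t 1"
    using eigen_step[of 1] c_1 D_ge_3 by simp (simp add: numeral_2_eq_2)
  have e2: "t 1 + (real k - 1) * t 3 = \<theta> * t 2"
    using eigen_step[of 2] c_2 D_ge_3 by simp
  have s: "t 0 + t 1 = t 2 + t 3" using t_2 t_3 by simp
  have k0: "real k \<noteq> 0" using k_ge_3 by simp
  have "\<theta> * (t 1 + t 2) = (t 0 + t 1) + (real k - 1) * (t 2 + t 3)" using e1 e2 by (simp add: algebra_simps)
  also have "\<dots> = k * (t 0 + t 1)" using s by (simp add: algebra_simps)
  finally have f: "\<theta> * (t 1 + t 2) = k * (t 0 + t 1)" .
  have "(\<theta> + k - 1) * (\<theta>\<^sup>2 - (real k)\<^sup>2) * t 0 = 0"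
    using e0 e1 f by algebra
  moreover have "\<theta> \<noteq> real k"
  proof
    assume "\<theta> = real k"
    then have "t 1 = t 0" using e0 k0 by simp
    then show False using t_neq[of 0 1] D_ge_3 by simp
  qed
  moreover have "\<theta> \<noteq> - real k"
  proof
    assume th: "\<theta> = - real k"
    then have "real k * t 1 = real k * (- t 0)" using e0 by simp
    then have "t 1 = - t 0" using k0 mult_left_cancel by blast
    then have "(real k - 1) * t 2 = (real k - 1) * t 0" using e1 th by (simp add: algebra_simps)
    then have "t 2 = t 0" using k_ge_3 by simp
    then show False using t_neq[of 0 2] D_ge_3 by simp
  qed
  ultimately show ?thesis using t_0_pos by (auto simp: power2_eq_iff)
qed

lemma k_t_1: "k * t 1 = (1 - real k) * t 0"
  using eigen_0 theta by simp

lemma t_0_1: "t 0 - t 1 = (real k - 1) * b" "k * (t 0 - t 1) = (2 * real k - 1) * t 0"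
proof -
  have e1: "t 0 + (real k - 1) * t 2 = (1 - real k) * t 1"
    using eigen_step[of 1] c_1 D_ge_3 theta by simp (simp add: numeral_2_eq_2)
  show "k * (t 0 - t 1) = (2 * real k - 1) * t 0" using k_t_1 by (simp add: algebra_simps)
  have "k * ((real k - 1) * b - (t 0 - t 1)) = 0"
    using k_t_1 e1 unfolding b_def by algebra
  then show "t 0 - t 1 = (real k - 1) * b" using k_ge_3 by simp
qed

lemma b_pos: "0 < b"
proof -
  have "k * ((real k - 1) * b) = (2 * real k - 1) * t 0" using t_0_1 by simp
  moreover have "0 < (2 * real k - 1) * t 0" using k_ge_3 t_0_pos by simp
  ultimately have "0 < k * ((real k - 1) * b)" by simp
  then show ?thesis using k_ge_3 by (simp add: zero_less_mult_iff)
qed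

text \<open>The recurrence continues two interleaved arithmetic progressions, with steps
  \<open>- b\<close> and \<open>b\<close>. If \<open>c D < k\<close>, it also yields the capped
  value at \<open>Suc D\<close>, from which \<open>k_eq\<close> obtains the valency.\<close>

lemma t_formula:
  assumes "h \<le> D \<or> h = Suc D \<and> c D < k"
  shows "\<tau> h = (if even h then t 0 - real (h div 2) * b else t 1 + real (h div 2) * b)"
  using assms
proof (induction h rule: less_induct)
  case (less h)
  consider "h = 0" | "h = 1" | "h = 2" | "h = 3" | "4 \<le> h" by linarith
  then show ?case
  proof cases
    case 5
    then obtain n where n: "h = Suc n" "3 \<le> n" by (cases h) auto
    then have nD: "n \<le> D" "c n < k" using less.prems c_lt[of n] by (cases "n = D"; auto)+
    have rec: "(t 2 - t n) * (t 0 - t n) = (t 1 - t (n - 1)) * (t 1 - \<tau> h)"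
      using recurrence[of n] n nD by simp
    have nz: "t 1 - t (n - 1) \<noteq> 0" using t_neq[of 1 "n - 1"] n nD by simp
    have IH1: "t n = (if even n then t 0 - real (n div 2) * b else t 1 + real (n div 2) * b)"
      using less.IH[of n] n nD by simp
    have IH2: "t (n - 1) = (if even (n - 1) then t 0 - real ((n - 1) div 2) * b else t 1 + real ((n - 1) div 2) * b)"
      using less.IH[of "n - 1"] n nD by simp
    show ?thesis
    proof (cases "even n")
      case True
      then obtain j where j: "n = 2 * j" by blast
      then have j1: "1 \<le> j" "(n - 1) div 2 = j - 1" "odd (n - 1)" using n by auto
      have tn: "t n = t 0 - j * b" using IH1 j by simp
      have tn1: "t (n - 1) = t 1 + (real j - 1) * b" using IH2 j1 by (simp add: of_nat_diff)
      have "(real j - 1) * b * (- (t 1 - \<tau> h)) = (real j - 1) * b * (j * b)"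
        using rec unfolding tn tn1 t_2 by (simp add: algebra_simps)
      moreover have "(real j - 1) * b \<noteq> 0" using nz tn1 by simp
      ultimately have "- (t 1 - \<tau> h) = j * b" using mult_left_cancel by blast
      then show ?thesis using n j by simp
    next
      case False
      then obtain j where j: "n = 2 * j + 1" using oddE by blast
      then have j1: "1 \<le> j" "(n - 1) div 2 = j" "even (n - 1)" using n by auto
      have tn: "t n = t 1 + j * b" using IH1 j by simp
      have tn1: "t (n - 1) = t 0 - j * b" using IH2 j1 by simp
      have "(t 1 - t (n - 1)) * (t 2 - t n) = (t 1 - t (n - 1)) * (- (t 1 - \<tau> h))"
        using rec unfolding tn tn1 by (simp add: algebra_simps)
      then have "t 2 - t n = - (t 1 - \<tau> h)" using nz mult_left_cancel by blast
      then show ?thesis using n j tn t_2 by (simp add: algebra_simps)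
    qed
  qed (use D_ge_3 t_2 t_3 in auto)
qed

lemma t_even: "2 * j \<le> D \<Longrightarrow> t (2 * j) = t 0 - j * b"
  using t_formula[of "2 * j"] by simp

lemma t_odd: "2 * j + 1 \<le> D \<Longrightarrow> t (2 * j + 1) = t 1 + j * b"
  using t_formula[of "2 * j + 1"] by simp

text \<open>Since \<open>t 0 - t 1 = (k - 1) * b\<close>, the two progressions cross between
  \<open>k - 1\<close> and \<open>k\<close>: both indices would receive the same value, against
  injectivity.\<close>

lemma D_less_k: "D < k"
proof (rule ccontr)
  assume "\<not> D < k"
  then have kD: "k \<le> D" by simp
  have "t (k - 1) = t k"
  proof (cases "even k")
    case True
    then obtain j where j: "k = 2 * j" by blast
    then obtain i where i: "j = Suc i" using k_ge_3 by (cases j) auto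
    have "t (2 * i + 1) = t 1 + i * b" "t (2 * j) = t 0 - j * b"
      using t_odd[of i] t_even[of j] kD j i by simp_all
    moreover have "t 0 - t 1 = (2 * real j - 1) * b" using t_0_1 j by simp
    ultimately show ?thesis using j i by (simp add: algebra_simps)
  next
    case False
    then obtain j where j: "k = 2 * j + 1" using oddE by blast
    have "t (2 * j + 1) = t 1 + j * b" "t (2 * j) = t 0 - j * b"
      using t_odd[of j] t_even[of j] kD j by simp_all
    moreover have "t 0 - t 1 = (2 * real j) * b" using t_0_1 j by simp
    ultimately show ?thesis using j by (simp add: algebra_simps)
  qed
  moreover have "k - 1 \<noteq> k" "k - 1 \<le> D" using kD k_ge_3 by linarith+
  ultimately show False using t_neq[of "k - 1" k] kD by simp
qed

text \<open>If \<open>c D = k\<close>, all neighbours of a vertex at distance \<open>D\<close> are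
  nearer, and the eigenvector equation at \<open>D\<close> forces \<open>D div 2\<close> to be
  \<open>k\<close> or \<open>k - 1\<close>. Both are too large by \<open>D_less_k\<close>.\<close>

lemma c_D_less: "c D < k"
proof (rule ccontr)
  assume "\<not> c D < k"
  then have "c D = k" using c_le_k[of D] D_ge_3 by simp
  then have e: "k * t (D - 1) = (1 - real k) * t D" using eigen_step[of D] theta D_ge_3 by simp
  show False
  proof (cases "even D")
    case True
    then obtain j where j: "D = 2 * j" by blast
    then obtain i where i: "j = Suc i" using D_ge_3 by (cases j) auto
    have "t (2 * i + 1) = t 1 + i * b" "t (2 * j) = t 0 - j * b"
      using t_odd[of i] t_even[of j] j i by simp_all
    then have "k * (t 1 + i * b) = (1 - real k) * (t 0 - j * b)" using e j i by simp
    then have "(real k * i) * b = ((real k - 1) * j) * b" using k_t_1 by (simp add: algebra_simps)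
    then have "real k * i = (real k - 1) * j" using b_pos by simp
    then have "real j = real k" using i by (simp add: algebra_simps)
    then show False using D_less_k j by simp
  next
    case False
    then obtain j where j: "D = 2 * j + 1" using oddE by blast
    have "t (2 * j + 1) = t 1 + j * b" "t (2 * j) = t 0 - j * b"
      using t_odd[of j] t_even[of j] j by simp_all
    then have "k * (t 0 - j * b) = (1 - real k) * (t 1 + j * b)" using e j by simp
    then have "k * t 0 + (real k - 1) * t 1 = j * b" by (simp add: algebra_simps)
    moreover have "k * t 0 + (real k - 1) * t 1 = (real k - 1) * b"
      using k_t_1 t_0_1(1) by (simp add: algebra_simps)
    ultimately have "real j * b = (real k - 1) * b" by simp
    then have "real j = real k - 1" using b_pos by simp
    then show False using D_less_k j k_ge_3 by linarith
  qed
qed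

text \<open>By the cap, the progressions must agree at \<open>D\<close> and \<open>Suc D\<close>;
  the crossing point found in \<open>D_less_k\<close> therefore lies exactly there.\<close>

lemma k_eq: "k = Suc D"
proof -
  have eq: "\<tau> (Suc D) = t D" by (simp add: \<tau>_def)
  have f: "t D = (if even (Suc D) then t 0 - real (Suc D div 2) * b else t 1 + real (Suc D div 2) * b)"
    using t_formula[of "Suc D"] c_D_less eq by simp
  show ?thesis
  proof (cases "even D")
    case True
    then obtain j where j: "D = 2 * j" by blast
    have "t 0 - j * b = t 1 + j * b" using f t_even[of j] j by simp
    then have "(real k - 1) * b = (2 * real j) * b" using t_0_1(1) by (simp add: algebra_simps)
    then have "real k - 1 = 2 * real j" using b_pos by simp
    then show ?thesis using j by linarith
  next
    case False
    then obtain j where j: "D = 2 * j + 1" using oddE by blast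
    have "t 0 - (real j + 1) * b = t 1 + j * b" using f t_odd[of j] j by (simp add: add.commute)
    then have "(real k - 1) * b = (2 * real j + 1) * b" using t_0_1(1) by (simp add: algebra_simps)
    then have "real k - 1 = 2 * real j + 1" using b_pos by simp
    then show ?thesis using j by linarith
  qed
qed

text \<open>Consecutive terms come from the two different progressions, so their steps cancel up to
  one \<open>b\<close>. This is what leaves so few inner products between labels.\<close>

lemma edge_sum:
  assumes "d z w = 1"
  shows "t (d y z) + t (d y w) \<in> {t 0 + t 1, t 0 + t 1 - b}"
proof -
  have step: "t h + \<tau> (Suc h) \<in> {t 0 + t 1, t 0 + t 1 - b}" if "h \<le> D" for h
  proof -
    have 1: "t h = (if even h then t 0 - real (h div 2) * b else t 1 + real (h div 2) * b)"
      using t_formula[of h] that by simp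
    have "Suc h \<le> D \<or> Suc h = Suc D \<and> c D < k" using that c_D_less by auto
    note 2 = t_formula[OF this]
    show ?thesis
    proof (cases "even h")
      case True
      then show ?thesis using 1 2 by simp
    next
      case False
      then obtain j where "h = 2 * j + 1" using oddE by blast
      then show ?thesis using 1 2 by (simp add: algebra_simps)
    qed
  qed
  have *: "t (d y z) + t (d y w) \<in> {t 0 + t 1, t 0 + t 1 - b}" if "d z w = 1" "d y z \<le> d y w" for z w
  proof -
    have "t (d w y) = \<tau> (Suc (d z y))" using t_far[of w z y] that d_sym by metis
    then show ?thesis using step[OF d_le[of y z]] d_sym by metis
  qed
  show ?thesis
  proof (cases "d y z \<le> d y w")
    case True then show ?thesis using *[OF assms] by simp
  next
    case False
    then show ?thesis using *[of w z] assms d_sym[of w z] by (simp add: add.commute)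
  qed
qed

end

subsection \<open>Recovering the Odd graph\<close>

context q_poly_odd_like
begin

text \<open>In the Odd graph the label of an edge would be the point missed by both of its ends.\<close>
definition lab :: "'a \<Rightarrow> 'a \<Rightarrow> 'a \<Rightarrow> real" where
  "lab y u = (\<lambda>x. t (d x y) + t (d x u))"

definition ip :: "('a \<Rightarrow> real) \<Rightarrow> ('a \<Rightarrow> real) \<Rightarrow> real" where
  "ip f g = (\<Sum>x\<in>UNIV. f x * g x)"

definition \<Lambda> :: "('a \<Rightarrow> real) set" where
  "\<Lambda> = {lab y u | y u. d y u = 1}"

definition labs :: "'a \<Rightarrow> ('a \<Rightarrow> real) set" where
  "labs x = lab x ` {u. d x u = 1}"

text \<open>The squared norm of a label. By \<open>N_eq\<close> it is the value for which
  \<open>2 * D + 1\<close> vectors with mutual inner products \<open>N - b\<close> add up to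
  zero.\<close>

definition N :: real where
  "N = 2 * (t 0 + t 1)"

lemma N_eq: "(2 * real D + 1) * N = 2 * real D * b"
proof -
  have "t 0 - t 1 = D * b" "(real D + 1) * (t 0 - t 1) = (2 * real D + 1) * t 0"
    using t_0_1 k_eq by (simp_all add: algebra_simps)
  then show ?thesis unfolding N_def by algebra
qed

lemma N_less: "N < b"
proof -
  have "(2 * real D + 1) * N < (2 * real D + 1) * b" using N_eq b_pos by (simp add: algebra_simps)
  then show ?thesis by (simp add: mult_less_cancel_left)
qed

lemma lab_sym: "lab y u = lab u y"
  by (auto simp: lab_def)

lemma ip_lab: "ip (lab y u) (lab z w) = (t (d y z) + t (d y w)) + (t (d u z) + t (d u w))"
  by (simp add: ip_def lab_def distrib_left distrib_right sum.distrib t_idem)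

lemma ip_self: "d y u = 1 \<Longrightarrow> ip (lab y u) (lab y u) = N"
  using d_sym[of y u] by (simp add: ip_lab N_def)

lemma ip_eq_N:
  assumes "d y u = 1" "d z w = 1" "ip (lab y u) (lab z w) = N"
  shows "lab y u = lab z w"
proof -
  let ?f = "lab y u" and ?g = "lab z w"
  have "(\<Sum>x\<in>UNIV. (?f x - ?g x)\<^sup>2) = ip ?f ?f + ip ?g ?g - 2 * ip ?f ?g"
    by (simp add: ip_def power2_eq_square algebra_simps sum.distrib sum_subtractf sum_distrib_left)
  also have "\<dots> = 0" using assms ip_self by simp
  finally have "\<forall>x. (?f x - ?g x)\<^sup>2 = 0" by (subst (asm) sum_nonneg_eq_0_iff) auto
  then show ?thesis by auto
qed

text \<open>Two edge sums leave three candidates for the inner product. The lowest,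
  \<open>N - 2 * b\<close>, would give \<open>L + M\<close> the negative squared norm
  \<open>4 * (N - b)\<close>; the highest forces equality of the labels.\<close>

lemma ip_cases:
  assumes "L \<in> \<Lambda>" "M \<in> \<Lambda>"
  shows "ip L M = (if L = M then N else N - b)"
proof -
  obtain y u z w where L: "L = lab y u" "d y u = 1" and M: "M = lab z w" "d z w = 1"
    using assms by (auto simp: \<Lambda>_def)
  have "ip L M \<in> {N, N - b, N - 2 * b}"
    using edge_sum[OF M(2), of y] edge_sum[OF M(2), of u] by (auto simp: L M ip_lab N_def)
  moreover have "ip L M \<noteq> N - 2 * b"
  proof
    assume i: "ip L M = N - 2 * b"
    have "0 \<le> (\<Sum>x\<in>UNIV. (L x + M x)\<^sup>2)" by (rule sum_nonneg) simp
    also have "\<dots> = ip L L + ip M M + 2 * ip L M"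
      by (simp add: ip_def power2_eq_square algebra_simps sum.distrib sum_distrib_left)
    also have "\<dots> = 4 * (N - b)" using i ip_self L M by simp
    finally show False using N_less by simp
  qed
  moreover have "ip L M = N \<longleftrightarrow> L = M" using ip_eq_N[OF L(2) M(2)] ip_self L M by auto
  ultimately show ?thesis by auto
qed

lemma finite_\<Lambda>: "finite \<Lambda>"
proof -
  have "\<Lambda> \<subseteq> (\<lambda>(y, u). lab y u) ` UNIV" by (auto simp: \<Lambda>_def)
  then show ?thesis by (rule finite_subset) simp
qed

text \<open>The sum of \<open>m\<close> labels has squared norm
  \<open>m * (m * (N - b) + b)\<close>. As \<open>N < b\<close>, the bracket decreases in
  \<open>m\<close>, and by \<open>N_eq\<close> it is zero at \<open>m = 2 * D + 1\<close>.\<close>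

lemma card_\<Lambda>_le: "card \<Lambda> \<le> 2 * D + 1"
proof (rule ccontr)
  assume "\<not> ?thesis"
  then have gt: "2 * real D + 1 < card \<Lambda>" by linarith
  have "0 \<le> (\<Sum>x\<in>UNIV. (\<Sum>L\<in>\<Lambda>. L x)\<^sup>2)" by (rule sum_nonneg) simp
  also have "\<dots> = (\<Sum>x\<in>UNIV. \<Sum>L\<in>\<Lambda>. \<Sum>M\<in>\<Lambda>. L x * M x)"
    by (simp add: power2_eq_square sum_product)
  also have "\<dots> = (\<Sum>L\<in>\<Lambda>. \<Sum>x\<in>UNIV. \<Sum>M\<in>\<Lambda>. L x * M x)" by (rule sum.swap)
  also have "\<dots> = (\<Sum>L\<in>\<Lambda>. \<Sum>M\<in>\<Lambda>. ip L M)"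
    by (rule sum.cong[OF refl], unfold ip_def, rule sum.swap)
  also have "\<dots> = (\<Sum>L\<in>\<Lambda>. \<Sum>M\<in>\<Lambda>. (N - b) + (if L = M then b else 0))"
    by (intro sum.cong refl) (simp add: ip_cases)
  also have "\<dots> = card \<Lambda> * (card \<Lambda> * (N - b) + b)"
    by (simp add: sum.distrib finite_\<Lambda>)
  finally have "0 \<le> card \<Lambda> * (card \<Lambda> * (N - b) + b)" .
  then have "0 \<le> card \<Lambda> * (N - b) + b" using gt by (simp add: zero_le_mult_iff)
  also have "\<dots> < (2 * real D + 1) * (N - b) + b"
    using gt N_less by (simp add: mult_less_cancel_right)
  also have "\<dots> = 0" using N_eq by (simp add: algebra_simps)
  finally show False by simp
qed

lemma labs_subset: "labs x \<subseteq> \<Lambda>"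
  by (auto simp: labs_def \<Lambda>_def)

lemma lab_inj: "inj_on (lab x) {u. d x u = 1}"
proof (rule inj_onI)
  fix u v assume u: "u \<in> {u. d x u = 1}" and v: "v \<in> {u. d x u = 1}" and eq: "lab x u = lab x v"
  show "u = v"
  proof (rule ccontr)
    assume "u \<noteq> v"
    then have "d u v = 2" using dist_2[of x u v] u v by simp
    then have "ip (lab x u) (lab x v) = t 0 + t 1 + (t 1 + t 2)" using u v d_sym[of u x] by (simp add: ip_lab)
    moreover have "ip (lab x u) (lab x v) = N" using eq ip_self[of x v] v by simp
    ultimately show False using t_2 b_pos by (simp add: N_def)
  qed
qed

lemma card_labs: "card (labs x) = D + 1"
  unfolding labs_def using card_image[OF lab_inj] card_nbrs[of x] D_ge_3 k_eq by simp

lemma labs_adj: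
  assumes xy: "d x y = 1"
  shows "labs x \<inter> labs y = {lab x y}"
proof
  have "lab x y \<in> labs x" "lab y x \<in> labs y" using xy d_sym[of y x] by (auto simp: labs_def)
  then show "{lab x y} \<subseteq> labs x \<inter> labs y" using lab_sym[of x y] by simp
  show "labs x \<inter> labs y \<subseteq> {lab x y}"
  proof
    fix L assume "L \<in> labs x \<inter> labs y"
    then obtain u v where u: "d x u = 1" "L = lab x u" and v: "d y v = 1" "L = lab y v" by (auto simp: labs_def)
    show "L \<in> {lab x y}"
    proof (rule ccontr)
      assume "L \<notin> {lab x y}"
      then have "v \<noteq> x" using v lab_sym by auto
      then have "d x v = 2" using dist_2[of y x v] xy v d_sym by auto
      then have "ip (lab x u) (lab y v) = (t 1 + t 2) + (t (d u y) + t (d u v))" using xy by (simp add: ip_lab)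
      moreover have "t (d u y) + t (d u v) \<le> t 0 + t 1" using edge_sum[OF v(1), of u] b_pos by auto
      moreover have "ip (lab x u) (lab y v) = N" using ip_self[of x u] u v by simp
      ultimately show False using t_2 b_pos by (simp add: N_def)
    qed
  qed
qed

text \<open>Two sets of \<open>D + 1\<close> labels with one in common already fill the upper bound
  for the number of all labels.\<close>

lemma labs_union:
  assumes xy: "d x y = 1"
  shows "labs x \<union> labs y = \<Lambda>"
proof (rule card_seteq[OF finite_\<Lambda>])
  have fin: "finite (labs x)" "finite (labs y)" using finite_subset[OF labs_subset finite_\<Lambda>] by auto
  show "labs x \<union> labs y \<subseteq> \<Lambda>" using labs_subset by blast
  have "card (labs x) + card (labs y) = card (labs x \<union> labs y) + card (labs x \<inter> labs y)"
    using fin by (rule card_Un_Int)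
  then show "card \<Lambda> \<le> card (labs x \<union> labs y)" using card_\<Lambda>_le card_labs labs_adj[OF xy] by simp
qed

lemma card_\<Lambda>: "card \<Lambda> = 2 * D + 1"
proof -
  obtain x y where xy: "d x y = 1" using ex_dist[of 1] D_ge_3 by fastforce
  have fin: "finite (labs x)" "finite (labs y)" using finite_subset[OF labs_subset finite_\<Lambda>] by auto
  have "card (labs x) + card (labs y) = card (labs x \<union> labs y) + card (labs x \<inter> labs y)"
    using fin by (rule card_Un_Int)
  then show ?thesis using card_labs labs_adj[OF xy] labs_union[OF xy] by simp
qed

definition pts :: "'a \<Rightarrow> ('a \<Rightarrow> real) set" where
  "pts x = \<Lambda> - labs x"

lemma card_pts: "card (pts x) = D"
  unfolding pts_def using card_Diff_subset[OF _ labs_subset] labs_subset[of x] finite_\<Lambda> card_\<Lambda> card_labs[of x]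
  by (simp add: finite_subset)

text \<open>The labels at \<open>z\<close> add up to \<open>k + \<theta> = 1\<close> times the
  column of the idempotent at \<open>z\<close>. So they determine that column, and injectivity of
  \<open>t\<close> recovers the vertex.\<close>

lemma pts_inj: "inj pts"
proof (rule injI)
  fix x y assume "pts x = pts y"
  then have eq: "labs x = labs y" using labs_subset[of x] labs_subset[of y] unfolding pts_def by blast
  have sum: "(\<Sum>L\<in>labs z. L v) = t (d v z)" for z v
  proof -
    have "(\<Sum>L\<in>labs z. L v) = (\<Sum>u | d z u = 1. lab z u v)"
      unfolding labs_def by (subst sum.reindex[OF lab_inj]) simp
    also have "\<dots> = k * t (d v z) + \<theta> * t (d v z)"
      using t_eigen[of v z] card_nbrs[of z] D_ge_3 by (simp add: lab_def sum.distrib)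
    also have "\<dots> = t (d v z)" unfolding theta by (simp add: algebra_simps)
    finally show ?thesis .
  qed
  have "t 0 = t (d x y)" using sum[of x x] sum[of x y] eq by simp
  then have "d x y = 0" using t_neq[of 0 "d x y"] d_le[of x y] by auto
  then show "x = y" using d_eq_0 by simp
qed

lemma adj_pts_disjoint: "d x y = 1 \<Longrightarrow> pts x \<inter> pts y = {}"
  using labs_union[of x y] by (auto simp: pts_def)

text \<open>A vertex has \<open>D + 1\<close> neighbours and \<open>D + 1\<close> labels, and the
  latter have \<open>D + 1\<close> subsets of size \<open>D\<close>. The injection
  \<open>pts\<close> from the former to those subsets is therefore onto.\<close>

lemma ex_adj_pts:
  assumes "T \<subseteq> \<Lambda>" "card T = D" "T \<inter> pts x = {}"
  shows "\<exists>y. d x y = 1 \<and> pts y = T"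
proof -
  have finl: "finite (labs x)" using finite_subset[OF labs_subset finite_\<Lambda>] .
  have "pts ` {u. d x u = 1} = {T. T \<subseteq> labs x \<and> card T = D}"
  proof (rule card_subset_eq)
    show "finite {T. T \<subseteq> labs x \<and> card T = D}" using finl by simp
    show "pts ` {u. d x u = 1} \<subseteq> {T. T \<subseteq> labs x \<and> card T = D}"
      using adj_pts_disjoint card_pts by (fastforce simp: pts_def)
    have "card (pts ` {u. d x u = 1}) = k"
      using card_image[OF inj_on_subset[OF pts_inj]] card_nbrs[of x] D_ge_3 by simp
    moreover have "card {T. T \<subseteq> labs x \<and> card T = D} = (D + 1) choose D"
      using n_subsets[OF finl] card_labs by simp
    ultimately show "card (pts ` {u. d x u = 1}) = card {T. T \<subseteq> labs x \<and> card T = D}"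
      using k_eq by simp
  qed
  moreover have "T \<subseteq> labs x" using assms by (auto simp: pts_def)
  ultimately have "T \<in> pts ` {u. d x u = 1}" using assms(2) by simp
  then show ?thesis by auto
qed

lemma adj_iff_pts_disjoint: "d x y = 1 \<longleftrightarrow> pts x \<inter> pts y = {}"
proof
  assume "pts x \<inter> pts y = {}"
  then have "pts y \<inter> pts x = {}" by blast
  moreover have "pts y \<subseteq> \<Lambda>" by (auto simp: pts_def)
  ultimately obtain u where "d x u = 1" "pts u = pts y" using ex_adj_pts card_pts by metis
  then show "d x y = 1" using pts_inj by (simp add: inj_eq)
qed (rule adj_pts_disjoint)

lemma range_pts: "range pts = {T. T \<subseteq> \<Lambda> \<and> card T = D}"
proof
  show "range pts \<subseteq> {T. T \<subseteq> \<Lambda> \<and> card T = D}" using card_pts by (auto simp: pts_def)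
  show "{T. T \<subseteq> \<Lambda> \<and> card T = D} \<subseteq> range pts"
  proof
    fix T assume "T \<in> {T. T \<subseteq> \<Lambda> \<and> card T = D}"
    then have T: "T \<subseteq> \<Lambda>" "card T = D" by auto
    have finT: "finite T" using finite_subset[OF T(1) finite_\<Lambda>] .
    have "T \<in> range pts" if "card (T - pts x) = n" for n x
      using that
    proof (induction n arbitrary: x)
      case 0
      then have "T \<subseteq> pts x" using finT by auto
      then have "T = pts x"
        using card_subset_eq[of "pts x" T] card_pts[of x] T finite_\<Lambda> by (simp add: pts_def)
      then show ?case by simp
    next
      case (Suc n)
      have finx: "finite (pts x)" using finite_\<Lambda> by (simp add: pts_def)
      obtain l where l: "l \<in> T" "l \<notin> pts x" using Suc.prems by (metis DiffE card.empty equals0I nat.distinct(1))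
      have "\<not> pts x \<subseteq> T"
      proof
        assume "pts x \<subseteq> T"
        then have "pts x = T" using card_subset_eq[OF finT] card_pts[of x] T by simp
        then show False using l by simp
      qed
      then obtain m where m: "m \<in> pts x" "m \<notin> T" by blast
      \<comment> \<open>The point \<open>m\<close> is exchanged for \<open>l\<close> by two steps in
        the graph, through the vertex whose points are the complement of
        \<open>insert l (pts x)\<close>. Each exchange brings the vertex closer to representing
        \<open>T\<close>.\<close>
      define S where "S = insert l (pts x - {m})"
      define U where "U = \<Lambda> - insert l (pts x)"
      have l\<Lambda>: "insert l (pts x) \<subseteq> \<Lambda>" using l T by (auto simp: pts_def)
      have disj: "U \<subseteq> \<Lambda>" "U \<inter> pts x = {}" by (auto simp: U_def)
      have "card U = D"
        unfolding U_def using card_Diff_subset[OF _ l\<Lambda>] finx l card_\<Lambda> card_pts[of x] by simp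
      then obtain y where y: "pts y = U" using ex_adj_pts[OF disj(1) _ disj(2)] by blast
      have "card S = D" using finx l m card_pts[of x] D_ge_3 by (simp add: S_def card_Diff_singleton)
      moreover have "S \<subseteq> \<Lambda>" "S \<inter> pts y = {}" using l\<Lambda> y by (auto simp: S_def U_def)
      ultimately obtain y' where y': "pts y' = S" using ex_adj_pts by blast
      have "T - pts y' = (T - pts x) - {l}" using l m y' by (auto simp: S_def)
      then have "card (T - pts y') = n" using Suc.prems l by (simp add: card_Diff_singleton)
      then show ?case by (rule Suc.IH)
    qed
    then show "T \<in> range pts" by blast
  qed
qed

theorem ex_odd_graph_isomorphism:
  "\<exists>f :: 'a \<Rightarrow> nat set. bij_betw f UNIV {S. S \<subseteq> {..<2 * D + 1} \<and> card S = D} \<and>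
     (\<forall>x y. d x y = 1 \<longleftrightarrow> f x \<inter> f y = {})"
proof -
  obtain \<phi> where \<phi>: "bij_betw \<phi> \<Lambda> {0..<card \<Lambda>}"
    using ex_bij_betw_finite_nat[OF finite_\<Lambda>] by blast
  then have im: "\<phi> ` \<Lambda> = {..<2 * D + 1}" and inj: "inj_on \<phi> \<Lambda>"
    using card_\<Lambda> by (auto simp: bij_betw_def lessThan_atLeast0)
  have sub: "pts x \<subseteq> \<Lambda>" for x by (auto simp: pts_def)
  have "bij_betw ((`) \<phi>) {T. T \<subseteq> \<Lambda> \<and> card T = D} {S. S \<subseteq> {..<2 * D + 1} \<and> card S = D}"
  proof (rule bij_betw_imageI)
    show "inj_on ((`) \<phi>) {T. T \<subseteq> \<Lambda> \<and> card T = D}"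
      using inj_on_image_eq_iff[OF inj] by (auto intro!: inj_onI)
    show "(`) \<phi> ` {T. T \<subseteq> \<Lambda> \<and> card T = D} = {S. S \<subseteq> {..<2 * D + 1} \<and> card S = D}"
    proof
      show "(`) \<phi> ` {T. T \<subseteq> \<Lambda> \<and> card T = D} \<subseteq> {S. S \<subseteq> {..<2 * D + 1} \<and> card S = D}"
        using im card_image[OF inj_on_subset[OF inj]] by auto
      show "{S. S \<subseteq> {..<2 * D + 1} \<and> card S = D} \<subseteq> (`) \<phi> ` {T. T \<subseteq> \<Lambda> \<and> card T = D}"
      proof
        fix S assume "S \<in> {S. S \<subseteq> {..<2 * D + 1} \<and> card S = D}"
        then have S: "S \<subseteq> \<phi> ` \<Lambda>" "card S = D" using im by auto
        then obtain T where T: "T \<subseteq> \<Lambda>" "S = \<phi> ` T" by (meson subset_imageE)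
        then have "card T = D" using S card_image[OF inj_on_subset[OF inj T(1)]] by simp
        then show "S \<in> (`) \<phi> ` {T. T \<subseteq> \<Lambda> \<and> card T = D}" using T by blast
      qed
    qed
  qed
  moreover have "bij_betw pts UNIV {T. T \<subseteq> \<Lambda> \<and> card T = D}"
    using pts_inj range_pts by (simp add: bij_betw_def)
  ultimately have "bij_betw ((`) \<phi> \<circ> pts) UNIV {S. S \<subseteq> {..<2 * D + 1} \<and> card S = D}"
    by (rule bij_betw_trans[rotated])
  moreover have "d x y = 1 \<longleftrightarrow> ((`) \<phi> \<circ> pts) x \<inter> ((`) \<phi> \<circ> pts) y = {}" for x y
    using inj_on_image_Int[OF inj sub[of x] sub[of y]] adj_iff_pts_disjoint[of x y] by auto
  ultimately show ?thesis by blast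
qed

end

subsection \<open>The Bose--Mesner algebra\<close>

lemma matrix_mult_entry: "(A ** B) $ x $ y = (\<Sum>w\<in>UNIV. A $ x $ w * B $ w $ y)"
  by (simp add: matrix_matrix_mult_def)

lemma matrix_mult_sum_left: "(\<Sum>i\<in>I. f i) ** (B :: real^'n^'n) = (\<Sum>i\<in>I. f i ** B)"
  by (simp add: vec_eq_iff matrix_mult_entry sum_component sum_distrib_right) (auto intro: sum.swap)

lemma matrix_mult_diff_left: "(A - A') ** (B :: real^'n^'n) = A ** B - A' ** B"
  by (simp add: vec_eq_iff matrix_mult_entry left_diff_distrib sum_subtractf)

lemma matrix_mult_diff_right: "(B :: real^'n^'n) ** (A - A') = B ** A - B ** A'"
  by (simp add: vec_eq_iff matrix_mult_entry right_diff_distrib sum_subtractf)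

lemma matrix_mult_scaleR_left: "(r *\<^sub>R A) ** (B :: real^'n^'n) = r *\<^sub>R (A ** B)"
  by (simp add: vec_eq_iff matrix_mult_entry sum_distrib_left mult.assoc)

section \<open>Idempotents of the Bose-Mesner algebra and Krein parameters\<close>

locale bm_algebra = drg_metric d D p for d :: "'v::finite \<Rightarrow> 'v \<Rightarrow> nat" and D p +
  fixes A :: "nat \<Rightarrow> real^'v^'v" and M :: "(real^'v^'v) set" and E :: "nat \<Rightarrow> real^'v^'v"
  assumes A_entry: "A i $ x $ y = (if d x y = i then 1 else 0)"
    and M_span: "M = span (A ` {..D})"
    and E_bij: "bij_betw E {..D} {e. primitive_idempotent M e}"
begin

lemma M_subspace: "subspace M"
  by (simp add: M_span)

lemma A_in: "i \<le> D \<Longrightarrow> A i \<in> M"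
  unfolding M_span by (intro span_base) simp

lemma M_coeff:
  assumes "B \<in> M"
  obtains \<beta> where "\<And>x y. B $ x $ y = \<beta> (d x y)"
proof -
  have "\<exists>\<beta>. \<forall>x y. B $ x $ y = \<beta> (d x y)"
    using assms unfolding M_span
  proof (induction rule: span_induct_alt)
    case base
    show ?case by (rule exI[of _ "\<lambda>_. 0"]) simp
  next
    case (step a B0 C0)
    then obtain i where i: "B0 = A i" by auto
    obtain \<beta> where b: "\<forall>x y. C0 $ x $ y = \<beta> (d x y)" using step.IH by blast
    show ?case
      by (rule exI[of _ "\<lambda>j. a * (if j = i then 1 else 0) + \<beta> j"]) (simp add: i A_entry b)
  qed
  then show ?thesis using that by blast
qed

lemma M_of_coeff:
  assumes "\<And>x y. B $ x $ y = \<beta> (d x y)"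
  shows "B \<in> M"
proof -
  have "B = (\<Sum>i\<le>D. \<beta> i *\<^sub>R A i)"
    using d_le by (simp add: vec_eq_iff sum_component A_entry assms if_distrib cong: if_cong)
  then show ?thesis using A_in M_subspace by (auto intro: subspace_sum subspace_scale)
qed

lemma M_mult:
  assumes "B \<in> M" "C' \<in> M"
  shows "B ** C' \<in> M"
proof -
  obtain \<beta> where b: "\<And>x y. B $ x $ y = \<beta> (d x y)" using M_coeff[OF assms(1)] by blast
  obtain \<gamma> where g: "\<And>x y. C' $ x $ y = \<gamma> (d x y)" using M_coeff[OF assms(2)] by blast
  have "(B ** C') $ x $ y = (\<Sum>i\<le>D. \<Sum>j\<le>D. real (p (d x y) i j) * (\<beta> i * \<gamma> j))" for x y
  proof -
    have "(B ** C') $ x $ y = (\<Sum>w\<in>UNIV. \<beta> (d x w) * \<gamma> (d w y))" by (simp add: matrix_mult_entry b g)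
    also have "\<dots> = (\<Sum>w\<in>UNIV. \<Sum>i\<le>D. \<Sum>j\<le>D. if d x w = i \<and> d w y = j then \<beta> i * \<gamma> j else 0)"
    proof (rule sum.cong[OF refl])
      fix w
      have "(\<Sum>i\<le>D. \<Sum>j\<le>D. if d x w = i \<and> d w y = j then \<beta> i * \<gamma> j else 0) =
        (\<Sum>i\<le>D. if d x w = i then (\<Sum>j\<le>D. if d w y = j then \<beta> i * \<gamma> j else 0) else 0)"
        by (intro sum.cong refl) auto
      then show "\<beta> (d x w) * \<gamma> (d w y) = (\<Sum>i\<le>D. \<Sum>j\<le>D. if d x w = i \<and> d w y = j then \<beta> i * \<gamma> j else 0)"
        using d_le by simp
    qed
    also have "\<dots> = (\<Sum>i\<le>D. \<Sum>w\<in>UNIV. \<Sum>j\<le>D. if d x w = i \<and> d w y = j then \<beta> i * \<gamma> j else 0)"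
      by (rule sum.swap)
    also have "\<dots> = (\<Sum>i\<le>D. \<Sum>j\<le>D. \<Sum>w\<in>UNIV. if d x w = i \<and> d w y = j then \<beta> i * \<gamma> j else 0)"
      by (rule sum.cong[OF refl], rule sum.swap)
    also have "\<dots> = (\<Sum>i\<le>D. \<Sum>j\<le>D. real (p (d x y) i j) * (\<beta> i * \<gamma> j))"
    proof (intro sum.cong refl)
      fix i j assume ij: "i \<in> {..D}" "j \<in> {..D}"
      have "(\<Sum>w\<in>UNIV. if d x w = i \<and> d w y = j then \<beta> i * \<gamma> j else 0) =
        (\<Sum>w | d x w = i \<and> d w y = j. \<beta> i * \<gamma> j)"
        by (subst sum.inter_filter[symmetric]) auto
      then show "(\<Sum>w\<in>UNIV. if d x w = i \<and> d w y = j then \<beta> i * \<gamma> j else 0) = real (p (d x y) i j) * (\<beta> i * \<gamma> j)"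
        using regular[of i j x y] ij by simp
    qed
    finally show ?thesis .
  qed
  then show ?thesis
    by (rule M_of_coeff[where \<beta> = "\<lambda>h. \<Sum>i\<le>D. \<Sum>j\<le>D. real (p h i j) * (\<beta> i * \<gamma> j)"])
qed

lemma M_sym: "B \<in> M \<Longrightarrow> B $ x $ y = B $ y $ x"
  by (metis M_coeff d_sym)

lemma M_commute:
  assumes "B \<in> M" "C' \<in> M"
  shows "B ** C' = C' ** B"
proof -
  have "(B ** C') $ x $ y = (C' ** B) $ x $ y" for x y
  proof -
    have "(B ** C') $ x $ y = (B ** C') $ y $ x" by (rule M_sym[OF M_mult[OF assms]])
    then show ?thesis using M_sym[OF assms(1)] M_sym[OF assms(2)] by (simp add: matrix_mult_entry mult.commute)
  qed
  then show ?thesis by (simp add: vec_eq_iff)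
qed

text \<open>Otherwise \<open>e\<close> would split into the orthogonal nonzero idempotents
  \<open>e ** f\<close> and \<open>e - e ** f\<close>; commutativity of the algebra makes both of
  them idempotent.\<close>

lemma primitive_absorb:
  assumes e: "primitive_idempotent M e" and f: "f \<in> M" "f ** f = f"
  shows "e ** f = 0 \<or> e ** f = e"
proof (rule ccontr)
  assume "\<not> ?thesis"
  then have nz: "e ** f \<noteq> 0" "e - e ** f \<noteq> 0" by auto
  have eM: "e \<in> M" and ee: "e ** e = e" using e by (auto simp: primitive_idempotent_def)
  have c: "f ** e = e ** f" using M_commute eM f by blast
  have 1: "e ** f \<in> M" "e - e ** f \<in> M" using M_mult eM f M_subspace by (auto intro: subspace_diff)
  have 2: "(e ** f) ** (e ** f) = e ** f" "(e ** f) ** e = e ** f" "e ** (e ** f) = e ** f"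
    by (metis c ee f(2) matrix_mul_assoc)+
  then have 3: "(e ** f) ** (e - e ** f) = 0" "(e - e ** f) ** (e ** f) = 0"
    "(e - e ** f) ** (e - e ** f) = e - e ** f"
    by (simp_all add: matrix_mult_diff_left matrix_mult_diff_right ee)
  have 4: "e = e ** f + (e - e ** f)" by simp
  show False using e nz 1 2(1) 3 4 unfolding primitive_idempotent_def by blast
qed

lemma E_prim: "i \<le> D \<Longrightarrow> primitive_idempotent M (E i)"
  using E_bij by (auto simp: bij_betw_def)

lemma E_in: "i \<le> D \<Longrightarrow> E i \<in> M" and E_nz: "i \<le> D \<Longrightarrow> E i \<noteq> 0"
  and E_idem: "i \<le> D \<Longrightarrow> E i ** E i = E i"
  using E_prim by (auto simp: primitive_idempotent_def)

lemma E_orth: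
  assumes "i \<le> D" "j \<le> D" "i \<noteq> j"
  shows "E i ** E j = 0"
proof (rule ccontr)
  assume nz: "E i ** E j \<noteq> 0"
  then have "E i ** E j = E i" using primitive_absorb E_prim E_in E_idem assms by blast
  moreover have "E j ** E i = E j"
    using primitive_absorb[of "E j" "E i"] E_prim E_in E_idem assms nz M_commute by metis
  ultimately have "E i = E j" using M_commute E_in assms by metis
  then show False using E_bij assms by (auto simp: bij_betw_def inj_on_def)
qed

lemma E_mult: "i \<le> D \<Longrightarrow> j \<le> D \<Longrightarrow> E i ** E j = (if i = j then E i else 0)"
  using E_orth E_idem by simp

lemma sum_E_mult:
  assumes "i \<le> D"
  shows "(\<Sum>j\<le>D. \<beta> j *\<^sub>R E j) ** E i = \<beta> i *\<^sub>R E i"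
  using assms by (simp add: matrix_mult_sum_left matrix_mult_scaleR_left E_mult if_distrib cong: if_cong)

text \<open>A dimension count: the \<open>D + 1\<close> idempotents supplied by \<open>E_bij\<close>
  are orthogonal and nonzero, hence independent, in a space spanned by \<open>D + 1\<close>
  matrices.\<close>

lemma span_E: "span (E ` {..D}) = M"
proof -
  have inj: "inj_on E {..D}" using E_bij by (auto simp: bij_betw_def)
  have ind: "independent (E ` {..D})"
  proof (rule independent_if_scalars_zero)
    fix f x assume s: "(\<Sum>x\<in>E ` {..D}. f x *\<^sub>R x) = 0" and x: "x \<in> E ` {..D}"
    then obtain i where i: "i \<le> D" "x = E i" by auto
    have "(\<Sum>j\<le>D. f (E j) *\<^sub>R E j) = 0" using s by (simp add: sum.reindex[OF inj])
    then have "f (E i) *\<^sub>R E i = 0" using sum_E_mult[OF i(1), of "\<lambda>j. f (E j)"] by simp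
    then show "f x = 0" using E_nz i by simp
  qed simp
  have "E ` {..D} \<subseteq> M" using E_in by auto
  moreover have "dim M \<le> card (E ` {..D})"
  proof -
    have "dim M \<le> card (A ` {..D})" unfolding M_span by (simp add: dim_le_card')
    also have "\<dots> \<le> card {..D}" by (rule card_image_le) simp
    also have "\<dots> = card (E ` {..D})" by (rule card_image[OF inj, symmetric])
    finally show ?thesis .
  qed
  ultimately have "M \<subseteq> span (E ` {..D})" using ind by (intro card_ge_dim_independent) auto
  moreover have "span (E ` {..D}) \<subseteq> M" using \<open>E ` {..D} \<subseteq> M\<close> M_subspace by (rule span_minimal)
  ultimately show ?thesis by blast
qed

lemma M_expand:
  assumes "B \<in> M"
  obtains \<beta> where "B = (\<Sum>i\<le>D. \<beta> i *\<^sub>R E i)"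
proof -
  have inj: "inj_on E {..D}" using E_bij by (auto simp: bij_betw_def)
  have "B \<in> span (E ` {..D})" using assms span_E by simp
  then obtain u where "B = (\<Sum>v\<in>E ` {..D}. u v *\<^sub>R v)" by (auto simp: span_finite)
  then show ?thesis using that[of "\<lambda>i. u (E i)"] by (simp add: sum.reindex[OF inj])
qed

lemma expand_unique:
  assumes "(\<Sum>i\<le>D. \<beta> i *\<^sub>R E i) = (\<Sum>i\<le>D. \<gamma> i *\<^sub>R E i)" "i \<le> D"
  shows "\<beta> i = \<gamma> i"
proof -
  have "\<beta> i *\<^sub>R E i = \<gamma> i *\<^sub>R E i" using sum_E_mult[OF assms(2)] assms(1) by metis
  then show ?thesis using E_nz[OF assms(2)] by simp
qed

lemma sum_E: "(\<Sum>i\<le>D. E i) = mat 1"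
proof -
  have "mat 1 = A 0" by (simp add: vec_eq_iff mat_def A_entry d_eq_0)
  then have "mat 1 \<in> M" using A_in[of 0] by simp
  then obtain \<beta> where b: "mat 1 = (\<Sum>i\<le>D. \<beta> i *\<^sub>R E i)" using M_expand by blast
  have "\<beta> i = 1" if "i \<le> D" for i
  proof -
    have "mat 1 ** E i = \<beta> i *\<^sub>R E i" unfolding b by (rule sum_E_mult[OF that])
    then have "1 *\<^sub>R E i = \<beta> i *\<^sub>R E i" by simp
    then show ?thesis using E_nz[OF that] by (metis scaleR_right_imp_eq)
  qed
  then show ?thesis using b by simp
qed

lemma E_entry_idem:
  assumes "i \<le> D"
  shows "(\<Sum>u\<in>UNIV. E i $ u $ w * E i $ u $ w') = E i $ w $ w'"
proof -
  have "(\<Sum>u\<in>UNIV. E i $ u $ w * E i $ u $ w') = (E i ** E i) $ w $ w'"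
    unfolding matrix_mult_entry using M_sym[OF E_in[OF assms]] by (intro sum.cong refl) simp
  then show ?thesis using E_idem[OF assms] by simp
qed

text \<open>Up to a positive factor this is the Krein parameter $q^l_{ij}$.\<close>
definition S :: "nat \<Rightarrow> nat \<Rightarrow> nat \<Rightarrow> real" where
  "S i j l = (\<Sum>x\<in>UNIV. \<Sum>y\<in>UNIV. E i $ x $ y * E j $ x $ y * E l $ x $ y)"

lemma entrywise_in: "B \<in> M \<Longrightarrow> C' \<in> M \<Longrightarrow> entrywise_product B C' \<in> M"
proof -
  assume "B \<in> M" "C' \<in> M"
  then obtain \<beta> \<gamma> where "\<And>x y. B $ x $ y = \<beta> (d x y)" "\<And>x y. C' $ x $ y = \<gamma> (d x y)"
    by (metis M_coeff)
  then show ?thesis by (intro M_of_coeff[where \<beta> = "\<lambda>h. \<beta> h * \<gamma> h"]) (simp add: entrywise_product_def)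
qed

text \<open>Makes the definite description in \<open>krein_parameter\<close> meaningful.\<close>

lemma krein_expand:
  assumes "i \<le> D" "j \<le> D"
  shows "\<exists>!q. (\<forall>l>D. q l = 0) \<and>
    entrywise_product (E i) (E j) = (1 / real CARD('v)) *\<^sub>R (\<Sum>l\<le>D. q l *\<^sub>R E l)"
proof -
  obtain \<beta> where b: "entrywise_product (E i) (E j) = (\<Sum>l\<le>D. \<beta> l *\<^sub>R E l)"
    using M_expand[OF entrywise_in[OF E_in E_in]] assms by metis
  have n: "real CARD('v) \<noteq> 0" by simp
  define q where "q l = (if l \<le> D then real CARD('v) * \<beta> l else 0)" for l
  show ?thesis
  proof (rule ex1I[of _ q])
    show "(\<forall>l>D. q l = 0) \<and> entrywise_product (E i) (E j) = (1 / real CARD('v)) *\<^sub>R (\<Sum>l\<le>D. q l *\<^sub>R E l)"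
      using n by (simp add: q_def b scaleR_sum_right)
  next
    fix q' assume q': "(\<forall>l>D. q' l = 0) \<and> entrywise_product (E i) (E j) = (1 / real CARD('v)) *\<^sub>R (\<Sum>l\<le>D. q' l *\<^sub>R E l)"
    then have e: "(\<Sum>l\<le>D. (q' l / real CARD('v)) *\<^sub>R E l) = (\<Sum>l\<le>D. \<beta> l *\<^sub>R E l)"
      using b by (simp add: scaleR_sum_right)
    have "q' l / real CARD('v) = \<beta> l" if "l \<le> D" for l
      by (rule expand_unique[OF e that])
    then show "q' = q" using q' n by (auto simp: fun_eq_iff q_def field_simps)
  qed
qed

lemma sum_entrywise_E:
  assumes "l \<le> D" "B = (\<Sum>i\<le>D. \<beta> i *\<^sub>R E i)"
  shows "(\<Sum>x\<in>UNIV. \<Sum>y\<in>UNIV. B $ x $ y * E l $ x $ y) = \<beta> l * (\<Sum>x\<in>UNIV. E l $ x $ x)"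
proof -
  have "(\<Sum>x\<in>UNIV. \<Sum>y\<in>UNIV. B $ x $ y * E l $ x $ y) = (\<Sum>x\<in>UNIV. (B ** E l) $ x $ x)"
    unfolding matrix_mult_entry using M_sym[OF E_in[OF assms(1)]] by (intro sum.cong refl) simp
  also have "\<dots> = (\<Sum>x\<in>UNIV. \<beta> l * E l $ x $ x)"
    unfolding assms(2) sum_E_mult[OF assms(1)] by simp
  finally show ?thesis by (simp add: sum_distrib_left)
qed

lemma E_trace_pos:
  assumes "l \<le> D"
  shows "0 < (\<Sum>x\<in>UNIV. E l $ x $ x)"
proof -
  have "(\<Sum>x\<in>UNIV. E l $ x $ x) = (\<Sum>x\<in>UNIV. \<Sum>u\<in>UNIV. (E l $ u $ x)\<^sup>2)"
    using E_entry_idem[OF assms] by (simp add: power2_eq_square)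
  moreover have "\<exists>u x. E l $ u $ x \<noteq> 0" using E_nz[OF assms] by (simp add: vec_eq_iff)
  then obtain u x where ux: "E l $ u $ x \<noteq> 0" by blast
  have "0 < (\<Sum>u\<in>UNIV. (E l $ u $ x)\<^sup>2)" by (rule sum_pos2[of _ u]) (use ux in auto)
  then have "0 < (\<Sum>x\<in>UNIV. \<Sum>u\<in>UNIV. (E l $ u $ x)\<^sup>2)"
    by (rule sum_pos2[OF finite UNIV_I]) (rule sum_nonneg, simp)
  ultimately show ?thesis by simp
qed

text \<open>Pairing with \<open>E l\<close> under the trace isolates one coefficient. As
  \<open>S\<close> is invariant under rotating its indices and the traces are positive, the
  vanishing of Krein parameters is so too.\<close>

lemma expand_entrywise_coeff:
  assumes "i \<le> D" "j \<le> D" "l \<le> D" "entrywise_product (E i) (E j) = (\<Sum>l\<le>D. \<beta> l *\<^sub>R E l)"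
  shows "\<beta> l * (\<Sum>x\<in>UNIV. E l $ x $ x) = S i j l"
  using sum_entrywise_E[OF assms(3) assms(4)] by (simp add: S_def entrywise_product_def)

lemma S_rotate: "S i j l = S l i j"
  unfolding S_def by (simp add: mult.commute mult.left_commute)

text \<open>The squared norm of $E_i A^*_x E_j$, summed over $x$, is \<open>S i 1 j\<close>.\<close>
lemma triple_vanish:
  assumes "i \<le> D" "j \<le> D" "1 \<le> D" "S 1 i j = 0"
  shows "(\<Sum>w\<in>UNIV. E i $ u $ w * E 1 $ x $ w * E j $ w $ v) = 0"
proof -
  \<comment> \<open>The triple \<open>z\<close> collects the base point of the dual adjacency matrix
    and the row and column of an entry. In the expanded square, the sum over \<open>z\<close> splits
    into three sums, each of which collapses by idempotence to an entry at \<open>w\<close> and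
    \<open>w'\<close>.\<close>
  let ?F = "\<lambda>z w w'. (E i $ fst (snd z) $ w * E i $ fst (snd z) $ w') * (E 1 $ fst z $ w * E 1 $ fst z $ w') *
    (E j $ snd (snd z) $ w * E j $ snd (snd z) $ w')"
  define Y where "Y x u v = (\<Sum>w\<in>UNIV. E i $ u $ w * E 1 $ x $ w * E j $ w $ v)" for x u v
  have sw: "(\<Sum>x\<in>UNIV. \<Sum>u\<in>UNIV. \<Sum>v\<in>UNIV. f x u v) = (\<Sum>z\<in>(UNIV::('v\<times>'v\<times>'v) set). f (fst z) (fst (snd z)) (snd (snd z)))"
    for f :: "'v \<Rightarrow> 'v \<Rightarrow> 'v \<Rightarrow> real"
    by (simp add: sum.cartesian_product split_def UNIV_Times_UNIV)
  have "(\<Sum>x\<in>UNIV. \<Sum>u\<in>UNIV. \<Sum>v\<in>UNIV. (Y x u v)\<^sup>2) =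
    (\<Sum>z\<in>(UNIV::('v\<times>'v\<times>'v) set). \<Sum>w\<in>UNIV. \<Sum>w'\<in>UNIV. ?F z w w')"
    unfolding sw[of "\<lambda>x u v. (Y x u v)\<^sup>2"]
    unfolding Y_def power2_eq_square sum_product
    using M_sym[OF E_in[OF assms(2)]] by (intro sum.cong refl) (simp add: mult_ac)
  also have "\<dots> = (\<Sum>w\<in>UNIV. \<Sum>w'\<in>UNIV. \<Sum>z\<in>(UNIV::('v\<times>'v\<times>'v) set). ?F z w w')"
    by (subst sum.swap, rule sum.cong[OF refl], rule sum.swap)
  also have "\<dots> = (\<Sum>w\<in>UNIV. \<Sum>w'\<in>UNIV. E i $ w $ w' * E 1 $ w $ w' * E j $ w $ w')"
  proof (intro sum.cong refl)
    fix w w'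
    have "(\<Sum>z\<in>(UNIV::('v\<times>'v\<times>'v) set). ?F z w w') =
      (\<Sum>x\<in>UNIV. \<Sum>u\<in>UNIV. \<Sum>v\<in>UNIV. (E i $ u $ w * E i $ u $ w') * (E 1 $ x $ w * E 1 $ x $ w') *
      (E j $ v $ w * E j $ v $ w'))" by (rule sw[symmetric])
    also have "\<dots> = (\<Sum>u\<in>UNIV. E i $ u $ w * E i $ u $ w') * (\<Sum>x\<in>UNIV. E 1 $ x $ w * E 1 $ x $ w') *
        (\<Sum>v\<in>UNIV. E j $ v $ w * E j $ v $ w')"
      by (simp add: sum_distrib_left sum_distrib_right mult_ac)
    finally show "(\<Sum>z\<in>(UNIV::('v\<times>'v\<times>'v) set). ?F z w w') = E i $ w $ w' * E 1 $ w $ w' * E j $ w $ w'"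
      using E_entry_idem assms by simp
  qed
  also have "\<dots> = 0" using assms(4) by (simp add: S_def mult_ac)
  finally have "(\<Sum>z\<in>(UNIV::('v\<times>'v\<times>'v) set). (Y (fst z) (fst (snd z)) (snd (snd z)))\<^sup>2) = 0"
    unfolding sw[of "\<lambda>x u v. (Y x u v)\<^sup>2"] .
  then have "\<forall>z. (Y (fst z) (fst (snd z)) (snd (snd z)))\<^sup>2 = 0"
    by (subst (asm) sum_nonneg_eq_0_iff) auto
  then have "Y x u v = 0" by (metis fst_conv snd_conv zero_eq_power2)
  then show ?thesis by (simp add: Y_def)
qed

end

section \<open>Consequences of the Q-polynomial property\<close>

locale q_poly_bm = bm_algebra +
  assumes D_pos: "1 \<le> D"
    and E_0: "E 0 = (\<chi> x y. 1 / real CARD('a))"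
    and Q_poly: "i \<le> D \<Longrightarrow> j \<le> D \<Longrightarrow> i \<noteq> j \<Longrightarrow> S i j 1 \<noteq> 0 \<longleftrightarrow> \<bar>int i - int j\<bar> = 1"
begin

text \<open>The entrywise product of \<open>E 1\<close> and \<open>E n\<close> involves only
  \<open>E (n - 1)\<close>, \<open>E n\<close> and \<open>E (n + 1)\<close>, the last with a nonzero
  coefficient. Inductively every \<open>E n\<close> is entrywise a function of \<open>E 1\<close>,
  and so is all of \<open>M\<close>. Injectivity of \<open>t\<close> follows.\<close>

lemma E_1_separates:
  assumes "E 1 $ x $ y = E 1 $ x' $ y'" "B \<in> M"
  shows "B $ x $ y = B $ x' $ y'"
proof -
  have *: "E n $ x $ y = E n $ x' $ y'" if "n \<le> D" for n
    using that
  proof (induction n rule: less_induct)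
    case (less m)
    consider "m = 0" | "m = 1" | n where "m = Suc n" "1 \<le> n" by (cases m; cases "m - 1") auto
    then show ?case
    proof cases
      case 1 then show ?thesis by (simp add: E_0)
    next
      case 2 then show ?thesis using assms by simp
    next
      case 3
      have nD: "n \<le> D" using 3 less.prems by simp
      obtain \<beta> where b: "entrywise_product (E 1) (E n) = (\<Sum>l\<le>D. \<beta> l *\<^sub>R E l)"
        using M_expand[OF entrywise_in[OF E_in[OF D_pos] E_in[OF nD]]] by blast
      have coeff: "\<beta> l = 0 \<longleftrightarrow> S n l 1 = 0" if "l \<le> D" for l
        using expand_entrywise_coeff[OF D_pos nD that b] E_trace_pos[OF that] S_rotate[of n l 1] by auto
      have zero: "\<beta> l * (E l $ x $ y - E l $ x' $ y') = 0" if "l \<le> D" "l \<noteq> m" for l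
      proof (cases "l < m")
        case True
        then show ?thesis using less.IH that by simp
      next
        case False
        then show ?thesis using coeff[OF that(1)] Q_poly[OF nD that(1)] that 3 by simp
      qed
      have "0 = E 1 $ x $ y * E n $ x $ y - E 1 $ x' $ y' * E n $ x' $ y'"
        using assms(1) less.IH[of n] 3 nD by simp
      also have "\<dots> = (\<Sum>l\<le>D. \<beta> l * (E l $ x $ y - E l $ x' $ y'))"
        using arg_cong[OF b, of "\<lambda>B. B $ x $ y - B $ x' $ y'"]
        by (simp add: entrywise_product_def sum_component sum_subtractf right_diff_distrib)
      also have "\<dots> = (\<Sum>l\<in>{m}. \<beta> l * (E l $ x $ y - E l $ x' $ y'))"
        by (rule sum.mono_neutral_right) (use zero less.prems in auto)
      finally have "\<beta> m * (E m $ x $ y - E m $ x' $ y') = 0" by simp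
      moreover have "\<beta> m \<noteq> 0" using coeff[OF less.prems] Q_poly[OF nD less.prems] 3 by simp
      ultimately show ?thesis by simp
    qed
  qed
  obtain \<beta> where "B = (\<Sum>l\<le>D. \<beta> l *\<^sub>R E l)" using M_expand[OF assms(2)] by blast
  then show ?thesis using * by (simp add: sum_component)
qed

lemma bilinear_expand:
  assumes "P = (\<Sum>i\<le>D. \<beta> i *\<^sub>R E i)" "Q = (\<Sum>i\<le>D. \<gamma> i *\<^sub>R E i)"
  shows "(\<Sum>w\<in>UNIV. P $ y $ w * E 1 $ x $ w * Q $ w $ z) =
    (\<Sum>i\<le>D. \<Sum>j\<le>D. \<beta> i * \<gamma> j * (\<Sum>w\<in>UNIV. E i $ y $ w * E 1 $ x $ w * E j $ w $ z))"
proof -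
  have "(\<Sum>w\<in>UNIV. P $ y $ w * E 1 $ x $ w * Q $ w $ z) =
    (\<Sum>w\<in>UNIV. \<Sum>i\<le>D. \<Sum>j\<le>D. \<beta> i * \<gamma> j * (E i $ y $ w * E 1 $ x $ w * E j $ w $ z))"
    unfolding assms by (simp add: sum_component sum_distrib_left sum_distrib_right mult_ac)
  also have "\<dots> = (\<Sum>i\<le>D. \<Sum>w\<in>UNIV. \<Sum>j\<le>D. \<beta> i * \<gamma> j * (E i $ y $ w * E 1 $ x $ w * E j $ w $ z))"
    by (rule sum.swap)
  also have "\<dots> = (\<Sum>i\<le>D. \<Sum>j\<le>D. \<Sum>w\<in>UNIV. \<beta> i * \<gamma> j * (E i $ y $ w * E 1 $ x $ w * E j $ w $ z))"
    by (rule sum.cong[OF refl], rule sum.swap)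
  finally show ?thesis by (simp add: sum_distrib_left)
qed

text \<open>In matrix form, with $A^*$ the diagonal matrix whose entries are the row of \<open>E 1\<close> at \<open>x\<close>:
  $P A^* Q - Q A^* P = A^* B - B A^*$. As $E_i A^* E_j$ vanishes for $|i - j| > 1$, only the
  differences of consecutive coefficients of \<open>B\<close> matter.\<close>
lemma commutator:
  assumes "P \<in> M" "Q \<in> M"
  obtains B where "\<And>x y z. (\<Sum>w\<in>UNIV. P $ y $ w * E 1 $ x $ w * Q $ w $ z) -
      (\<Sum>w\<in>UNIV. Q $ y $ w * E 1 $ x $ w * P $ w $ z) = B $ y $ z * (E 1 $ x $ y - E 1 $ x $ z)"
proof -
  obtain \<beta> where P: "P = (\<Sum>i\<le>D. \<beta> i *\<^sub>R E i)" using M_expand[OF assms(1)] by blast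
  obtain \<gamma> where Q: "Q = (\<Sum>i\<le>D. \<gamma> i *\<^sub>R E i)" using M_expand[OF assms(2)] by blast
  \<comment> \<open>The increments are chosen so that the terms with \<open>j = Suc i\<close> or
    \<open>i = Suc j\<close> match on both sides. Diagonal terms cancel and the remaining ones
    vanish, so the initial value 0 is arbitrary.\<close>
  define b where "b = rec_nat (0::real) (\<lambda>i s. s + (\<beta> i * \<gamma> (Suc i) - \<gamma> i * \<beta> (Suc i)))"
  have b: "b (Suc i) = b i + (\<beta> i * \<gamma> (Suc i) - \<gamma> i * \<beta> (Suc i))" for i by (simp add: b_def)
  define B where "B = (\<Sum>i\<le>D. b i *\<^sub>R E i)"
  have I: "mat 1 = (\<Sum>i\<le>D. 1 *\<^sub>R E i)" using sum_E by simp
  have "(\<Sum>w\<in>UNIV. P $ y $ w * E 1 $ x $ w * Q $ w $ z) -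
      (\<Sum>w\<in>UNIV. Q $ y $ w * E 1 $ x $ w * P $ w $ z) = B $ y $ z * (E 1 $ x $ y - E 1 $ x $ z)" for x y z
  proof -
    define X where "X i j = (\<Sum>w\<in>UNIV. E i $ y $ w * E 1 $ x $ w * E j $ w $ z)" for i j
    have X0: "X i j = 0" if "i \<le> D" "j \<le> D" "i \<noteq> j" "j \<noteq> Suc i" "i \<noteq> Suc j" for i j
    proof -
      have "\<bar>int i - int j\<bar> \<noteq> 1" using that by linarith
      then have "S i j 1 = 0" using Q_poly[OF that(1-3)] by simp
      then have "S 1 i j = 0" using S_rotate[of i j 1] by simp
      then show ?thesis unfolding X_def by (rule triple_vanish[OF that(1,2) D_pos])
    qed
    have tm: "\<beta> i * \<gamma> j * X i j - \<gamma> i * \<beta> j * X i j = 1 * b j * X i j - b i * 1 * X i j"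
      if "i \<le> D" "j \<le> D" for i j
    proof -
      consider "i = j" | "j = Suc i" | "i = Suc j" | "i \<noteq> j" "j \<noteq> Suc i" "i \<noteq> Suc j" by blast
      then show ?thesis by cases (use X0[OF that] in \<open>auto simp: b algebra_simps\<close>)
    qed
    have "(\<Sum>w\<in>UNIV. P $ y $ w * E 1 $ x $ w * Q $ w $ z) - (\<Sum>w\<in>UNIV. Q $ y $ w * E 1 $ x $ w * P $ w $ z) =
      (\<Sum>i\<le>D. \<Sum>j\<le>D. \<beta> i * \<gamma> j * X i j - \<gamma> i * \<beta> j * X i j)"
      unfolding bilinear_expand[OF P Q] bilinear_expand[OF Q P] X_def by (simp add: sum_subtractf)
    also have "\<dots> = (\<Sum>i\<le>D. \<Sum>j\<le>D. 1 * b j * X i j - b i * 1 * X i j)"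
      by (intro sum.cong refl) (use tm in auto)
    also have "\<dots> = (\<Sum>w\<in>UNIV. mat 1 $ y $ w * E 1 $ x $ w * B $ w $ z) - (\<Sum>w\<in>UNIV. B $ y $ w * E 1 $ x $ w * mat 1 $ w $ z)"
      unfolding bilinear_expand[OF I B_def] bilinear_expand[OF B_def I] X_def by (simp add: sum_subtractf)
    also have "\<dots> = B $ y $ z * (E 1 $ x $ y - E 1 $ x $ z)"
    proof -
      have "(\<Sum>w\<in>UNIV. mat 1 $ y $ w * E 1 $ x $ w * B $ w $ z) = (\<Sum>w\<in>UNIV. if y = w then E 1 $ x $ w * B $ w $ z else 0)"
        by (intro sum.cong refl) (simp add: mat_def)
      moreover have "(\<Sum>w\<in>UNIV. B $ y $ w * E 1 $ x $ w * mat 1 $ w $ z) = (\<Sum>w\<in>UNIV. if w = z then B $ y $ w * E 1 $ x $ w else 0)"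
        by (intro sum.cong refl) (simp add: mat_def)
      ultimately show ?thesis by (simp add: algebra_simps)
    qed
    finally show ?thesis .
  qed
  then show ?thesis by (rule that)
qed

theorem q_poly_metric_exists: "\<exists>t \<theta>. q_poly_metric d D p t \<theta>"
proof -
  obtain t where t: "\<And>x y. E 1 $ x $ y = t (d x y)" using M_coeff[OF E_in[OF D_pos]] by blast
  obtain \<alpha> where \<alpha>: "A 1 = (\<Sum>i\<le>D. \<alpha> i *\<^sub>R E i)" using M_expand[OF A_in[OF D_pos]] by blast
  have "q_poly_metric d D p t (\<alpha> 1)"
  proof
    show "inj_on t {..D}"
    proof (rule inj_onI)
      fix i j assume ij: "i \<in> {..D}" "j \<in> {..D}" "t i = t j"
      then obtain x z x' where x: "d x z = i" "d x' z = j" using ex_dist by (metis atMost_iff)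
      have "A i $ x $ z = A i $ x' $ z"
        using E_1_separates[of x z x' z "A i"] A_in[of i] ij x t by simp
      then show "i = j" using x by (simp add: A_entry split: if_splits)
    qed
  next
    fix y z
    show "(\<Sum>x\<in>UNIV. t (d x y) * t (d x z)) = t (d y z)"
      using E_entry_idem[OF D_pos, of y z] by (simp only: t)
  next
    fix x y
    have "E 1 ** A 1 = \<alpha> 1 *\<^sub>R E 1"
      using sum_E_mult[OF D_pos, of \<alpha>] M_commute[OF A_in[OF D_pos] E_in[OF D_pos]] \<alpha> by metis
    then have "(E 1 ** A 1) $ x $ y = \<alpha> 1 * t (d x y)" by (simp only: vector_scaleR_component t) simp
    moreover have "(E 1 ** A 1) $ x $ y = (\<Sum>w\<in>UNIV. if d y w = 1 then t (d x w) else 0)"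
      unfolding matrix_mult_entry by (intro sum.cong refl) (simp only: t A_entry d_sym[of y], simp)
    ultimately show "(\<Sum>w | d y w = 1. t (d x w)) = \<alpha> 1 * t (d x y)" by (simp add: sum.If_cases)
  next
    fix y z
    show "\<exists>r. \<forall>x. (\<Sum>w\<in>C y z. t (d x w)) - (\<Sum>w\<in>C z y. t (d x w)) = r * (t (d x y) - t (d x z))"
    proof (cases "y = z")
      case True
      then show ?thesis by (intro exI[of _ 0]) simp
    next
      case False
      then have h: "0 < d y z" "d y z - 1 \<le> D" using d_eq_0 d_le[of y z] by (auto intro: le_trans diff_le_self)
      \<comment> \<open>The choice of \<open>A 1\<close> and \<open>A (d y z - 1)\<close> makes the
        two sums at the entry \<open>y\<close>, \<open>z\<close> run over \<open>C y z\<close> and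
        \<open>C z y\<close>.\<close>
      obtain B where B: "\<And>x y' z'. (\<Sum>w\<in>UNIV. A 1 $ y' $ w * E 1 $ x $ w * A (d y z - 1) $ w $ z') -
        (\<Sum>w\<in>UNIV. A (d y z - 1) $ y' $ w * E 1 $ x $ w * A 1 $ w $ z') = B $ y' $ z' * (E 1 $ x $ y' - E 1 $ x $ z')"
        using commutator[OF A_in[OF D_pos] A_in[OF h(2)]] by blast
      have 1: "(\<Sum>w\<in>C y z. t (d x w)) = (\<Sum>w\<in>UNIV. A 1 $ y $ w * E 1 $ x $ w * A (d y z - 1) $ w $ z)" for x
      proof -
        have "(\<Sum>w\<in>UNIV. A 1 $ y $ w * E 1 $ x $ w * A (d y z - 1) $ w $ z) = (\<Sum>w\<in>UNIV. if w \<in> C y z then t (d x w) else 0)"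
          using h by (intro sum.cong refl) (auto simp del: One_nat_def simp: A_entry t in_C)
        then show ?thesis by (simp add: sum.If_cases)
      qed
      have 2: "(\<Sum>w\<in>C z y. t (d x w)) = (\<Sum>w\<in>UNIV. A (d y z - 1) $ y $ w * E 1 $ x $ w * A 1 $ w $ z)" for x
      proof -
        have "(\<Sum>w\<in>UNIV. A (d y z - 1) $ y $ w * E 1 $ x $ w * A 1 $ w $ z) = (\<Sum>w\<in>UNIV. if w \<in> C z y then t (d x w) else 0)"
        proof (rule sum.cong[OF refl])
          fix w
          have "d y w = d w y" "d z w = d w z" "d z y = d y z" by (rule d_sym)+
          then show "A (d y z - 1) $ y $ w * E 1 $ x $ w * A 1 $ w $ z = (if w \<in> C z y then t (d x w) else 0)"
            using h by (auto simp del: One_nat_def simp: A_entry t in_C)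
        qed
        then show ?thesis by (simp add: sum.If_cases)
      qed
      have "(\<Sum>w\<in>C y z. t (d x w)) - (\<Sum>w\<in>C z y. t (d x w)) = B $ y $ z * (E 1 $ x $ y - E 1 $ x $ z)" for x
        unfolding 1 2 by (rule B)
      then show ?thesis unfolding t by blast
    qed
  qed
  then show ?thesis by blast
qed

end

subsection \<open>Cycles, isomorphisms and the two families\<close>

lemma awalk_with_proj:
  "pre_digraph.awalk (with_proj G) u p v \<longleftrightarrow> u \<in> pverts G \<and> set p \<subseteq> parcs G \<and> pcas u p v"
  by (simp add: pre_digraph.awalk_def cas_with_proj_eq)

lemma ex_pcas_relpow: "(\<exists>p. set p \<subseteq> R \<and> pcas x p y \<and> length p = n) \<longleftrightarrow> (x, y) \<in> R ^^ n"
proof (induction n arbitrary: x)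
  case (Suc n)
  have "(\<exists>p. set p \<subseteq> R \<and> pcas x p y \<and> length p = Suc n) \<longleftrightarrow>
    (\<exists>w. (x, w) \<in> R \<and> (\<exists>p. set p \<subseteq> R \<and> pcas w p y \<and> length p = n))" (is "?L \<longleftrightarrow> ?R")
  proof
    assume ?L
    then obtain e p where "set (e # p) \<subseteq> R" "pcas x (e # p) y" "length p = n" by (metis length_Suc_conv)
    then have "(x, snd e) \<in> R" "set p \<subseteq> R" "pcas (snd e) p y" by auto
    then show ?R using \<open>length p = n\<close> by blast
  next
    assume ?R
    then obtain w p where "(x, w) \<in> R" "set p \<subseteq> R" "pcas w p y" "length p = n" by blast
    then show ?L by (intro exI[of _ "(x, w) # p"]) simp
  qed
  also have "\<dots> \<longleftrightarrow> (x, y) \<in> R ^^ Suc n" unfolding Suc.IH by (blast intro: relpow_Suc_I2 dest: relpow_Suc_D2)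
  finally show ?case .
qed auto

lemma gdist_relpow:
  assumes "pverts G = UNIV"
  shows "gdist G x y = (LEAST n. (x, y) \<in> parcs G ^^ n)"
  unfolding gdist_def awalk_with_proj using assms ex_pcas_relpow[of "parcs G" x y] by simp

section \<open>The graph distance as an instance of the abstract setting\<close>

locale full_graph =
  fixes G :: "('v::finite) pair_pre_digraph"
  assumes full: "pverts G = UNIV" and dr: "distance_regular G"
begin

abbreviation R where "R \<equiv> parcs G"
abbreviation D where "D \<equiv> graph_diameter G"

lemma pair_graph: "pair_graph G"
  using dr by (simp add: distance_regular_def)

lemma R_sym: "(x, y) \<in> R \<Longrightarrow> (y, x) \<in> R"
proof -
  interpret pair_graph G by (rule pair_graph)
  show "(x, y) \<in> R \<Longrightarrow> (y, x) \<in> R" using sym_arcs by (auto simp: symmetric_def elim: symE)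
qed

lemma R_irrefl: "(x, x) \<notin> R"
proof -
  interpret pair_graph G by (rule pair_graph)
  show ?thesis using pair_no_loops by fastforce
qed

text \<open>Connectedness of a digraph refers to its symmetric closure, which here is the graph
  itself.\<close>

lemma R_connected: "(x, y) \<in> R\<^sup>*"
proof -
  have "strongly_connected (with_proj (mk_symmetric (with_proj G)))"
    using dr by (simp add: distance_regular_def Digraph_Component.connected_def)
  then have "x \<rightarrow>\<^sup>*\<^bsub>with_proj (mk_symmetric (with_proj G))\<^esub> y"
    using full by (auto simp: strongly_connected_def mk_symmetric_def)
  then have "(x, y) \<in> (parcs (mk_symmetric (with_proj G)))\<^sup>*"
    unfolding reachable_def by (auto dest: rtrancl_on_rtranclI)
  also have "parcs (mk_symmetric (with_proj G)) = R"
    unfolding parcs_mk_symmetric using R_sym by (auto simp: with_proj_simps)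
  finally show ?thesis .
qed

lemma gdist_eq: "gdist G x y = (LEAST n. (x, y) \<in> R ^^ n)"
  by (rule gdist_relpow[OF full])

lemma gdist_relpowI: "(x, y) \<in> R ^^ n \<Longrightarrow> gdist G x y \<le> n"
  unfolding gdist_eq by (rule Least_le)

lemma relpow_gdist: "(x, y) \<in> R ^^ gdist G x y"
proof -
  have "\<exists>n. (x, y) \<in> R ^^ n" using R_connected by (simp add: rtrancl_power)
  then show ?thesis unfolding gdist_eq by (rule LeastI_ex)
qed

lemma gdist_0: "gdist G x y = 0 \<longleftrightarrow> x = y"
proof
  assume "gdist G x y = 0" then show "x = y" using relpow_gdist[of x y] by simp
next
  assume "x = y" then show "gdist G x y = 0" using gdist_relpowI[of x y 0] by simp
qed

lemma gdist_1: "gdist G x y = 1 \<longleftrightarrow> (x, y) \<in> R"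
proof
  assume "gdist G x y = 1" then show "(x, y) \<in> R" using relpow_gdist[of x y] by simp
next
  assume xy: "(x, y) \<in> R"
  then have "x \<noteq> y" using R_irrefl by auto
  then have "gdist G x y \<noteq> 0" by (simp add: gdist_0)
  moreover have "gdist G x y \<le> 1" using gdist_relpowI[of x y 1] xy by simp
  ultimately show "gdist G x y = 1" by simp
qed

lemma gdist_sym: "gdist G x y = gdist G y x"
proof -
  have "(y, x) \<in> R ^^ n" if "(x, y) \<in> R ^^ n" for x y n
    using that
  proof (induction n arbitrary: y)
    case (Suc n)
    then obtain w where "(x, w) \<in> R ^^ n" "(w, y) \<in> R" by auto
    then show ?case using Suc.IH R_sym relpow_Suc_I2 by metis
  qed auto
  then have "(x, y) \<in> R ^^ n \<longleftrightarrow> (y, x) \<in> R ^^ n" for n by blast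
  then show ?thesis by (simp add: gdist_eq)
qed

lemma finite_dists: "finite {gdist G x y | x y. x \<in> pverts G \<and> y \<in> pverts G}"
proof -
  have "{gdist G x y | x y. x \<in> pverts G \<and> y \<in> pverts G} = (\<lambda>(x, y). gdist G x y) ` UNIV"
    using full by auto
  then show ?thesis by simp
qed

lemma gdist_le: "gdist G x y \<le> D"
  unfolding graph_diameter_def using finite_dists full by (intro Max_ge) auto

lemma ex_gdist: "\<exists>x y. gdist G x y = D"
proof -
  have "D \<in> {gdist G x y | x y. x \<in> pverts G \<and> y \<in> pverts G}"
    unfolding graph_diameter_def using finite_dists full by (intro Max_in) auto
  then obtain x y where "graph_diameter G = gdist G x y" by blast
  then show ?thesis by metis
qed

lemma sphere_inter: "sphere_at G i x \<inter> sphere_at G j y = {w. gdist G x w = i \<and> gdist G w y = j}"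
  using full gdist_sym by (auto simp: sphere_at_def)

lemma card_sphere:
  assumes "i \<le> D" "j \<le> D"
  shows "card {w. gdist G x w = i \<and> gdist G w y = j} = intersection_number G (gdist G x y) i j"
proof -
  let ?P = "\<lambda>q. \<forall>x'\<in>pverts G. \<forall>y'\<in>pverts G. gdist G x' y' = gdist G x y \<longrightarrow>
    card (sphere_at G i x' \<inter> sphere_at G j y') = q"
  obtain q where q: "?P q"
    using dr gdist_le[of x y] assms unfolding distance_regular_def by blast
  have "intersection_number G (gdist G x y) i j = q"
    unfolding intersection_number_def
  proof (rule the_equality)
    show "?P q" by (rule q)
    show "q' = q" if "?P q'" for q' using that q full by auto
  qed
  moreover have "card (sphere_at G i x \<inter> sphere_at G j y) = q" using q full by simp
  ultimately show ?thesis by (simp add: sphere_inter)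
qed

sublocale drg_metric "gdist G" D "intersection_number G"
proof
  show "gdist G x y = 0 \<longleftrightarrow> x = y" for x y by (rule gdist_0)
  show "gdist G x y = gdist G y x" for x y by (rule gdist_sym)
  show "gdist G x z \<le> gdist G x y + gdist G y z" for x y z
    using relpow_gdist[of x y] relpow_gdist[of y z] by (intro gdist_relpowI) (auto simp: relpow_add)
  show "\<exists>w. gdist G x w = 1 \<and> gdist G w y = n" if "gdist G x y = Suc n" for x y n
  proof -
    have "(x, y) \<in> R ^^ Suc n" using relpow_gdist[of x y] that by simp
    then obtain w where w: "(x, w) \<in> R" "(w, y) \<in> R ^^ n" by (metis relpow_Suc_D2)
    have "gdist G w y \<le> n" using gdist_relpowI w by blast
    moreover have "Suc n \<le> Suc (gdist G w y)"
      using gdist_relpowI[OF relpow_Suc_I2[OF w(1) relpow_gdist[of w y]]] that by simp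
    ultimately show ?thesis using w(1) gdist_1 by (intro exI[of _ w]) auto
  qed
  show "gdist G x y \<le> D" for x y by (rule gdist_le)
  show "\<exists>x y. gdist G x y = D" by (rule ex_gdist)
  show "card {w. gdist G x w = i \<and> gdist G w y = j} = intersection_number G (gdist G x y) i j"
    if "i \<le> D" "j \<le> D" for i j x y by (rule card_sphere[OF that])
qed

end

text \<open>Girth 6 in terms of the adjacency relation alone: in this form it passes along
  bijections and can be compared with distances.\<close>

definition hexagonal :: "'a rel \<Rightarrow> bool" where
  "hexagonal R \<longleftrightarrow>
    (\<forall>a b c. (a, b) \<in> R \<and> (b, c) \<in> R \<and> (c, a) \<in> R \<longrightarrow> \<not> distinct [a, b, c]) \<and>
    (\<forall>a b c d. (a, b) \<in> R \<and> (b, c) \<in> R \<and> (c, d) \<in> R \<and> (d, a) \<in> R \<longrightarrow> \<not> distinct [a, b, c, d]) \<and>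
    (\<forall>a b c d e. (a, b) \<in> R \<and> (b, c) \<in> R \<and> (c, d) \<in> R \<and> (d, e) \<in> R \<and> (e, a) \<in> R \<longrightarrow> \<not> distinct [a, b, c, d, e]) \<and>
    (\<exists>a b c d e f. (a, b) \<in> R \<and> (b, c) \<in> R \<and> (c, d) \<in> R \<and> (d, e) \<in> R \<and> (e, f) \<in> R \<and> (f, a) \<in> R \<and> distinct [a, b, c, d, e, f])"

lemma cycle_with_proj:
  "pre_digraph.cycle (with_proj G) p \<longleftrightarrow>
    (\<exists>u. u \<in> pverts G \<and> set p \<subseteq> parcs G \<and> pcas u p u \<and> distinct (tl (pawalk_verts u p)) \<and> p \<noteq> [])"
  by (simp add: pre_digraph.cycle_def awalk_with_proj awalk_verts_with_proj_eq)

lemma cycle_3: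
  assumes "pair_wf_digraph G"
  shows "(\<exists>p. pre_digraph.cycle (with_proj G) p \<and> length p = 3) \<longleftrightarrow>
    (\<exists>a b c. (a, b) \<in> parcs G \<and> (b, c) \<in> parcs G \<and> (c, a) \<in> parcs G \<and> distinct [a, b, c])" (is "?L \<longleftrightarrow> ?R")
proof
  assume ?L
  then obtain e1 e2 e3 u where "pcas u [e1, e2, e3] u" "distinct (tl (pawalk_verts u [e1, e2, e3]))"
    "set [e1, e2, e3] \<subseteq> parcs G"
    by (auto simp: cycle_with_proj numeral_eq_Suc length_Suc_conv)
  then show ?R by (cases e1; cases e2; cases e3; force)
next
  assume ?R
  then obtain a b c where *: "(a, b) \<in> parcs G" "(b, c) \<in> parcs G" "(c, a) \<in> parcs G" "distinct [a, b, c]" by blast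
  then show ?L using pair_wf_digraph.in_arcsD1[OF assms *(1)]
    by (intro exI[of _ "[(a, b), (b, c), (c, a)]"]) (auto simp: cycle_with_proj)
qed

lemma cycle_4:
  assumes "pair_wf_digraph G"
  shows "(\<exists>p. pre_digraph.cycle (with_proj G) p \<and> length p = 4) \<longleftrightarrow>
    (\<exists>a b c d. (a, b) \<in> parcs G \<and> (b, c) \<in> parcs G \<and> (c, d) \<in> parcs G \<and> (d, a) \<in> parcs G \<and> distinct [a, b, c, d])" (is "?L \<longleftrightarrow> ?R")
proof
  assume ?L
  then obtain e1 e2 e3 e4 u where "pcas u [e1, e2, e3, e4] u" "distinct (tl (pawalk_verts u [e1, e2, e3, e4]))"
    "set [e1, e2, e3, e4] \<subseteq> parcs G"
    by (auto simp: cycle_with_proj numeral_eq_Suc length_Suc_conv)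
  then show ?R by (cases e1; cases e2; cases e3; cases e4; force)
next
  assume ?R
  then obtain a b c d where *: "(a, b) \<in> parcs G" "(b, c) \<in> parcs G" "(c, d) \<in> parcs G" "(d, a) \<in> parcs G" "distinct [a, b, c, d]" by blast
  then show ?L using pair_wf_digraph.in_arcsD1[OF assms *(1)]
    by (intro exI[of _ "[(a, b), (b, c), (c, d), (d, a)]"]) (auto simp: cycle_with_proj)
qed

lemma cycle_5:
  assumes "pair_wf_digraph G"
  shows "(\<exists>p. pre_digraph.cycle (with_proj G) p \<and> length p = 5) \<longleftrightarrow>
    (\<exists>a b c d e. (a, b) \<in> parcs G \<and> (b, c) \<in> parcs G \<and> (c, d) \<in> parcs G \<and> (d, e) \<in> parcs G \<and> (e, a) \<in> parcs G \<and>
      distinct [a, b, c, d, e])" (is "?L \<longleftrightarrow> ?R")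
proof
  assume ?L
  then obtain e1 e2 e3 e4 e5 u where "pcas u [e1, e2, e3, e4, e5] u" "distinct (tl (pawalk_verts u [e1, e2, e3, e4, e5]))"
    "set [e1, e2, e3, e4, e5] \<subseteq> parcs G"
    by (auto simp: cycle_with_proj numeral_eq_Suc length_Suc_conv)
  then show ?R by (cases e1; cases e2; cases e3; cases e4; cases e5; force)
next
  assume ?R
  then obtain a b c d e where *: "(a, b) \<in> parcs G" "(b, c) \<in> parcs G" "(c, d) \<in> parcs G" "(d, e) \<in> parcs G" "(e, a) \<in> parcs G"
    "distinct [a, b, c, d, e]" by blast
  then show ?L using pair_wf_digraph.in_arcsD1[OF assms *(1)]
    by (intro exI[of _ "[(a, b), (b, c), (c, d), (d, e), (e, a)]"]) (auto simp: cycle_with_proj)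
qed

lemma cycle_6:
  assumes "pair_wf_digraph G"
  shows "(\<exists>p. pre_digraph.cycle (with_proj G) p \<and> length p = 6) \<longleftrightarrow>
    (\<exists>a b c d e f. (a, b) \<in> parcs G \<and> (b, c) \<in> parcs G \<and> (c, d) \<in> parcs G \<and> (d, e) \<in> parcs G \<and> (e, f) \<in> parcs G \<and>
      (f, a) \<in> parcs G \<and> distinct [a, b, c, d, e, f])" (is "?L \<longleftrightarrow> ?R")
proof
  assume ?L
  then obtain e1 e2 e3 e4 e5 e6 u where "pcas u [e1, e2, e3, e4, e5, e6] u"
    "distinct (tl (pawalk_verts u [e1, e2, e3, e4, e5, e6]))" "set [e1, e2, e3, e4, e5, e6] \<subseteq> parcs G"
    by (auto simp: cycle_with_proj numeral_eq_Suc length_Suc_conv)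
  then show ?R by (cases e1; cases e2; cases e3; cases e4; cases e5; cases e6; force)
next
  assume ?R
  then obtain a b c d e f where *: "(a, b) \<in> parcs G" "(b, c) \<in> parcs G" "(c, d) \<in> parcs G" "(d, e) \<in> parcs G"
    "(e, f) \<in> parcs G" "(f, a) \<in> parcs G" "distinct [a, b, c, d, e, f]" by blast
  then show ?L using pair_wf_digraph.in_arcsD1[OF assms *(1)]
    by (intro exI[of _ "[(a, b), (b, c), (c, d), (d, e), (e, f), (f, a)]"]) (auto simp: cycle_with_proj)
qed

lemma girth_6_iff:
  assumes "pair_wf_digraph G"
  shows "girth G = 6 \<longleftrightarrow> hexagonal (parcs G)"
proof -
  let ?c = "\<lambda>n. \<exists>p. pre_digraph.cycle (with_proj G) p \<and> length p = n"
  let ?P = "{p. pre_digraph.cycle (with_proj G) p \<and> 3 \<le> length p}"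
  have "girth G = 6 \<longleftrightarrow> \<not> ?c 3 \<and> \<not> ?c 4 \<and> \<not> ?c 5 \<and> ?c 6"
  proof
    assume g: "girth G = 6"
    have ge: "6 \<le> length p" if "p \<in> ?P" for p
    proof -
      have "girth G \<le> enat (length p)" unfolding girth_def by (rule INF_lower[OF that])
      then show ?thesis using g by (simp add: numeral_eq_enat)
    qed
    have "\<exists>p\<in>?P. length p = 6"
    proof (rule ccontr)
      assume "\<not> ?thesis"
      then have "7 \<le> length p" if "p \<in> ?P" for p
      proof -
        have "6 \<le> length p" "length p \<noteq> 6" using ge[OF that] \<open>\<not> (\<exists>p\<in>?P. length p = 6)\<close> that by blast+
        then show ?thesis by linarith
      qed
      then have "enat 7 \<le> girth G" unfolding girth_def by (intro INF_greatest) simp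
      then show False using g by (simp add: numeral_eq_enat)
    qed
    then show "\<not> ?c 3 \<and> \<not> ?c 4 \<and> \<not> ?c 5 \<and> ?c 6" using ge by fastforce
  next
    assume c: "\<not> ?c 3 \<and> \<not> ?c 4 \<and> \<not> ?c 5 \<and> ?c 6"
    show "girth G = 6"
    proof (rule antisym)
      obtain p where "p \<in> ?P" "length p = 6" using c by auto
      have "girth G \<le> enat (length p)" unfolding girth_def by (rule INF_lower) fact
      then show "girth G \<le> 6" using \<open>length p = 6\<close> by (simp add: numeral_eq_enat)
      have "6 \<le> length p" if "p \<in> ?P" for p
      proof -
        have "length p \<noteq> 3" "length p \<noteq> 4" "length p \<noteq> 5" using c that by auto
        then show ?thesis using that by auto
      qed
      then show "6 \<le> girth G" unfolding girth_def by (intro INF_greatest) (simp add: numeral_eq_enat)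
    qed
  qed
  then show ?thesis
    unfolding cycle_3[OF assms] cycle_4[OF assms] cycle_5[OF assms] cycle_6[OF assms] hexagonal_def by blast
qed

lemma hexagonal_transfer:
  assumes f: "bij_betw f V W" and e: "\<And>x y. x \<in> V \<Longrightarrow> y \<in> V \<Longrightarrow> (x, y) \<in> R \<longleftrightarrow> (f x, f y) \<in> S"
    and R: "R \<subseteq> V \<times> V" and S: "S \<subseteq> W \<times> W" and hex: "hexagonal S"
  shows "hexagonal R"
proof -
  have fR: "(f x, f y) \<in> S" "x \<in> V" "y \<in> V" if "(x, y) \<in> R" for x y using that R e by auto
  have fn: "f x = f y \<longleftrightarrow> x = y" if "x \<in> V" "y \<in> V" for x y
    using f that by (auto simp: bij_betw_def inj_on_def)
  note H = hex[unfolded hexagonal_def]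
  show ?thesis unfolding hexagonal_def
  proof (intro conjI allI impI)
    fix a b c assume "(a, b) \<in> R \<and> (b, c) \<in> R \<and> (c, a) \<in> R"
    then have *: "(f a, f b) \<in> S" "(f b, f c) \<in> S" "(f c, f a) \<in> S"
      and V: "a \<in> V" "b \<in> V" "c \<in> V" using fR by blast+
    have "\<not> distinct [f a, f b, f c]" using H[THEN conjunct1] * by blast
    then show "\<not> distinct [a, b, c]" using fn V by simp
  next
    fix a b c d assume "(a, b) \<in> R \<and> (b, c) \<in> R \<and> (c, d) \<in> R \<and> (d, a) \<in> R"
    then have *: "(f a, f b) \<in> S" "(f b, f c) \<in> S" "(f c, f d) \<in> S" "(f d, f a) \<in> S"
      and V: "a \<in> V" "b \<in> V" "c \<in> V" "d \<in> V" using fR by blast+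
    have "\<not> distinct [f a, f b, f c, f d]" using H[THEN conjunct2, THEN conjunct1] * by blast
    then show "\<not> distinct [a, b, c, d]" using fn V by simp
  next
    fix a b c d e assume "(a, b) \<in> R \<and> (b, c) \<in> R \<and> (c, d) \<in> R \<and> (d, e) \<in> R \<and> (e, a) \<in> R"
    then have *: "(f a, f b) \<in> S" "(f b, f c) \<in> S" "(f c, f d) \<in> S" "(f d, f e) \<in> S" "(f e, f a) \<in> S"
      and V: "a \<in> V" "b \<in> V" "c \<in> V" "d \<in> V" "e \<in> V" using fR by blast+
    have "\<not> distinct [f a, f b, f c, f d, f e]" using H[THEN conjunct2, THEN conjunct2, THEN conjunct1] * by blast
    then show "\<not> distinct [a, b, c, d, e]" using fn V by simp
  next
    define g where "g = the_inv_into V f"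
    have g: "g x \<in> V" "f (g x) = x" if "x \<in> W" for x
      using f that the_inv_into_into[of f V x V] f_the_inv_into_f[of f V x] by (auto simp: bij_betw_def g_def)
    have gS: "(g x, g y) \<in> R" "x \<in> W" "y \<in> W" if "(x, y) \<in> S" for x y using that S g e[of "g x" "g y"] by auto
    have gn: "g x \<noteq> g y" if "x \<in> W" "y \<in> W" "x \<noteq> y" for x y using g that by metis
    obtain a b c d e f where s: "(a, b) \<in> S" "(b, c) \<in> S" "(c, d) \<in> S" "(d, e) \<in> S" "(e, f) \<in> S" "(f, a) \<in> S"
      "distinct [a, b, c, d, e, f]" using H by blast
    have "distinct [g a, g b, g c, g d, g e, g f]" using s gS(2) gn by auto
    then show "\<exists>a b c d e f. (a, b) \<in> R \<and> (b, c) \<in> R \<and> (c, d) \<in> R \<and> (d, e) \<in> R \<and> (e, f) \<in> R \<and> (f, a) \<in> R \<and> distinct [a, b, c, d, e, f]"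
      using s gS(1) by blast
  qed
qed

text \<open>A digraph isomorphism carries separate maps for vertices, arcs, heads and tails. Between
  pair graphs the heads and tails have to be the projections, which forces the arc map to be induced
  by the vertex map.\<close>

lemma digraph_iso_pair_iff:
  fixes G :: "'a pair_pre_digraph" and H :: "'b pair_pre_digraph"
  assumes wf: "pair_wf_digraph G" and H: "parcs H \<subseteq> pverts H \<times> pverts H"
  shows "digraph_iso (with_proj G) (with_proj H) \<longleftrightarrow>
    (\<exists>f. bij_betw f (pverts G) (pverts H) \<and>
      (\<forall>x\<in>pverts G. \<forall>y\<in>pverts G. (x, y) \<in> parcs G \<longleftrightarrow> (f x, f y) \<in> parcs H))" (is "?L \<longleftrightarrow> ?R")
proof
  assume ?L
  then obtain h where h: "pre_digraph.digraph_isomorphism (with_proj G) h" "with_proj H = app_iso h (with_proj G)"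
    by (auto simp: digraph_iso_def)
  define f where "f = iso_verts h"
  have inj: "inj_on f (pverts G)" using h(1) by (simp add: pre_digraph.digraph_isomorphism_def f_def)
  have hd: "iso_head h = snd" "iso_tail h = fst"
    using arg_cong[OF h(2), of head] arg_cong[OF h(2), of tail] by simp_all
  have V: "pverts H = f ` pverts G" and A: "parcs H = iso_arcs h ` parcs G"
    using arg_cong[OF h(2), of verts] arg_cong[OF h(2), of arcs] by (simp_all add: f_def)
  have arc: "iso_arcs h (x, y) = (f x, f y)" if "(x, y) \<in> parcs G" for x y
    using h(1) that by (auto simp: pre_digraph.digraph_isomorphism_def f_def hd prod_eq_iff)
  have "(x, y) \<in> parcs G \<longleftrightarrow> (f x, f y) \<in> parcs H" if xy: "x \<in> pverts G" "y \<in> pverts G" for x y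
  proof
    assume "(x, y) \<in> parcs G" then show "(f x, f y) \<in> parcs H" using arc A by force
  next
    assume "(f x, f y) \<in> parcs H"
    then obtain x' y' where e: "(x', y') \<in> parcs G" "(f x, f y) = (f x', f y')" using A arc by force
    then have "x' \<in> pverts G" "y' \<in> pverts G"
      using pair_wf_digraph.in_arcsD1[OF wf] pair_wf_digraph.in_arcsD2[OF wf] by blast+
    then show "(x, y) \<in> parcs G" using e inj xy by (auto simp: inj_on_def)
  qed
  then show ?R using inj V by (auto simp: bij_betw_def)
next
  assume ?R
  then obtain f where f: "bij_betw f (pverts G) (pverts H)"
    and e: "\<And>x y. x \<in> pverts G \<Longrightarrow> y \<in> pverts G \<Longrightarrow> (x, y) \<in> parcs G \<longleftrightarrow> (f x, f y) \<in> parcs H" by blast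
  have inV: "x \<in> pverts G" "y \<in> pverts G" if "(x, y) \<in> parcs G" for x y
    using that pair_wf_digraph.in_arcsD1[OF wf] pair_wf_digraph.in_arcsD2[OF wf] by blast+
  interpret pair_wf_digraph G by (rule wf)
  define h where "h = \<lparr>iso_verts = f, iso_arcs = map_prod f f, iso_head = snd, iso_tail = fst\<rparr>"
  have inj: "inj_on f (pverts G)" using f by (simp add: bij_betw_def)
  have "inj_on (map_prod f f) (parcs G)"
    by (rule inj_onI) (use inj inV in \<open>auto simp: inj_on_def\<close>)
  then have "pre_digraph.digraph_isomorphism (with_proj G) h"
    unfolding pre_digraph.digraph_isomorphism_def using inj wf_digraph_axioms by (simp add: h_def)
  moreover have "map_prod f f ` parcs G = parcs H"
  proof
    show "map_prod f f ` parcs G \<subseteq> parcs H"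
    proof
      fix q assume "q \<in> map_prod f f ` parcs G"
      then obtain x y where "(x, y) \<in> parcs G" "q = (f x, f y)" by auto
      then show "q \<in> parcs H" using e[OF inV(1) inV(2)] by blast
    qed
    show "parcs H \<subseteq> map_prod f f ` parcs G"
    proof
      fix q assume q: "q \<in> parcs H"
      then obtain a b where ab: "q = (a, b)" "a \<in> pverts H" "b \<in> pverts H" using H by auto
      then have "a \<in> f ` pverts G" "b \<in> f ` pverts G" using f by (simp_all add: bij_betw_def)
      then obtain x y where xy: "x \<in> pverts G" "y \<in> pverts G" "a = f x" "b = f y" by blast
      then have "(x, y) \<in> parcs G" using e q ab by simp
      then show "q \<in> map_prod f f ` parcs G" using ab xy by (intro image_eqI[of _ _ "(x, y)"]) simp_all
    qed
  qed
  then have "with_proj H = app_iso h (with_proj G)"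
    using f by (simp add: app_iso_def h_def with_proj_def bij_betw_def)
  ultimately show ?L unfolding digraph_iso_def by blast
qed

section \<open>Short cycles in the Odd graph\<close>

lemma odd_graph_hexagonal:
  assumes "3 \<le> n"
  shows "hexagonal (parcs (odd_graph n))"
proof -
  let ?U = "{..<2 * n + 1}"
  have R: "(S, T) \<in> parcs (odd_graph n) \<longleftrightarrow> S \<subseteq> ?U \<and> card S = n \<and> T \<subseteq> ?U \<and> card T = n \<and> S \<inter> T = {}" for S T
    by (simp add: odd_graph_def)
  have fin: "finite S" if "S \<subseteq> ?U" for S using that finite_subset by blast
  \<comment> \<open>A common neighbour leaves only \<open>n + 1\<close> points for the union of
    \<open>S\<close> and \<open>T\<close>.\<close>
  have common: "n \<le> card (S \<inter> T) + 1"
    if "(S, W) \<in> parcs (odd_graph n)" "(W, T) \<in> parcs (odd_graph n)" for S T W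
  proof -
    have *: "S \<subseteq> ?U" "T \<subseteq> ?U" "W \<subseteq> ?U" "card S = n" "card T = n" "card W = n" "W \<inter> (S \<union> T) = {}"
      using that by (auto simp: R)
    have "card (W \<union> (S \<union> T)) = card W + card (S \<union> T)" using * fin by (intro card_Un_disjoint) auto
    moreover have "card (W \<union> (S \<union> T)) \<le> card ?U" using * by (intro card_mono) auto
    moreover have "card S + card T = card (S \<union> T) + card (S \<inter> T)" using * fin by (intro card_Un_Int) auto
    ultimately show ?thesis using * by simp
  qed
  show ?thesis unfolding hexagonal_def
  proof (intro conjI allI impI)
    fix a b c assume *: "(a, b) \<in> parcs (odd_graph n) \<and> (b, c) \<in> parcs (odd_graph n) \<and> (c, a) \<in> parcs (odd_graph n)"
    then have "n \<le> card (a \<inter> c) + 1" "a \<inter> c = {}" using common[of a b c] by (auto simp: R)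
    then show "\<not> distinct [a, b, c]" using assms by simp
  next
    fix a b c d assume *: "(a, b) \<in> parcs (odd_graph n) \<and> (b, c) \<in> parcs (odd_graph n) \<and> (c, d) \<in> parcs (odd_graph n) \<and> (d, a) \<in> parcs (odd_graph n)"
    show "\<not> distinct [a, b, c, d]"
    proof
      assume dist: "distinct [a, b, c, d]"
      have s: "a \<subseteq> ?U" "b \<subseteq> ?U" "c \<subseteq> ?U" "d \<subseteq> ?U" "card a = n" "card b = n" "card c = n" "card d = n"
        "(a \<union> c) \<inter> (b \<union> d) = {}" using * by (auto simp: R)
      have lt: "n < card (S \<union> T)" if "S \<subseteq> ?U" "T \<subseteq> ?U" "card S = n" "card T = n" "S \<noteq> T" for S T
      proof -
        have "\<not> T \<subseteq> S" using that card_subset_eq[OF fin[OF that(1)], of T] by auto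
        then have "S \<subset> S \<union> T" by blast
        then have "card S < card (S \<union> T)" using fin that by (intro psubset_card_mono) auto
        then show ?thesis using that by simp
      qed
      \<comment> \<open>In a square, \<open>a \<union> c\<close> and \<open>b \<union> d\<close>
        would be disjoint sets of at least \<open>n + 1\<close> points each, one point too
        many.\<close>
      have "n < card (a \<union> c)" "n < card (b \<union> d)" using lt s dist by auto
      moreover have "card ((a \<union> c) \<union> (b \<union> d)) = card (a \<union> c) + card (b \<union> d)"
        using s fin by (intro card_Un_disjoint) auto
      moreover have "card ((a \<union> c) \<union> (b \<union> d)) \<le> card ?U" using s by (intro card_mono) auto
      ultimately show False by simp
    qed
  next
    fix a b c d e assume *: "(a, b) \<in> parcs (odd_graph n) \<and> (b, c) \<in> parcs (odd_graph n) \<and> (c, d) \<in> parcs (odd_graph n) \<and> (d, e) \<in> parcs (odd_graph n) \<and> (e, a) \<in> parcs (odd_graph n)"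
    have 1: "n \<le> card (a \<inter> c) + 1" using common[of a b c] * by blast
    have 2: "n \<le> card (d \<inter> a) + 1" using common[of d e a] * by blast
    have s: "finite a" "card a = n" "c \<inter> d = {}" using * fin by (auto simp: R)
    have "card ((a \<inter> c) \<union> (d \<inter> a)) = card (a \<inter> c) + card (d \<inter> a)"
      using s by (intro card_Un_disjoint) auto
    moreover have "card ((a \<inter> c) \<union> (d \<inter> a)) \<le> card a" using s by (intro card_mono) auto
    ultimately show "\<not> distinct [a, b, c, d, e]" using 1 2 s assms by simp
  next
    \<comment> \<open>The ground set splits into the points 0, 1, 2 and two sets of
      \<open>n - 1\<close> points. Adding one of the three points to \<open>X\<close> or to
      \<open>Y\<close> gives six vertices, and different added points make the vertices on opposite
      sides adjacent: a complete bipartite graph minus a matching, which is a hexagon.\<close>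
    define X Y where "X = {3..<n + 2}" and "Y = {n + 2..<2 * n + 1}"
    have X: "insert q X \<subseteq> ?U" "card (insert q X) = n" if "q < 3" for q using that assms by (auto simp: X_def)
    have Y: "insert q Y \<subseteq> ?U" "card (insert q Y) = n" if "q < 3" for q using that assms by (auto simp: Y_def)
    have e: "(insert q X, insert q' Y) \<in> parcs (odd_graph n)" "(insert q' Y, insert q X) \<in> parcs (odd_graph n)"
      if "q < 3" "q' < 3" "q \<noteq> q'" for q q'
    proof -
      have "insert q X \<inter> insert q' Y = {}" using that assms by (auto simp: X_def Y_def)
      then show "(insert q X, insert q' Y) \<in> parcs (odd_graph n)" "(insert q' Y, insert q X) \<in> parcs (odd_graph n)"
        using X[OF that(1)] Y[OF that(2)] unfolding R by blast+
    qed
    have neq: "insert q X \<noteq> insert q' X" "insert q Y \<noteq> insert q' Y" if "q < 3" "q' < 3" "q \<noteq> q'" for q q'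
      using that assms by (auto simp: X_def Y_def)
    have neq': "insert q X \<noteq> insert q' Y" if "q < 3" "q' < 3" for q q'
    proof -
      have "3 \<in> insert q X" "3 \<notin> insert q' Y" using that assms by (auto simp: X_def Y_def)
      then show ?thesis by blast
    qed
    show "\<exists>a b c d e f. (a, b) \<in> parcs (odd_graph n) \<and> (b, c) \<in> parcs (odd_graph n) \<and> (c, d) \<in> parcs (odd_graph n) \<and> (d, e) \<in> parcs (odd_graph n) \<and> (e, f) \<in> parcs (odd_graph n) \<and> (f, a) \<in> parcs (odd_graph n) \<and> distinct [a, b, c, d, e, f]"
      by (rule exI[of _ "insert 0 X"], rule exI[of _ "insert 1 Y"], rule exI[of _ "insert 2 X"], rule exI[of _ "insert 0 Y"],
          rule exI[of _ "insert 1 X"], rule exI[of _ "insert 2 Y"])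
        (use e neq neq' neq'[THEN not_sym] in simp)
  qed
qed

section \<open>Girth 6 inside a distance-regular graph\<close>

context full_graph
begin

lemma ex_q_poly_metric:
  assumes Q: "Q_polynomial G" and D: "1 \<le> D"
  shows "\<exists>t \<theta>. q_poly_metric (gdist G) D (intersection_number G) t \<theta>"
proof -
  obtain E where E: "idempotent_ordering G E" and QE: "Q_polynomial_wrt G E"
    using Q by (auto simp: Q_polynomial_def)
  interpret bm: bm_algebra "gdist G" D "intersection_number G" "distance_matrix G" "bose_mesner G" E
    by unfold_locales (use E in \<open>auto simp: distance_matrix_def bose_mesner_def idempotent_ordering_def\<close>)
  interpret q: q_poly_bm "gdist G" D "intersection_number G" "distance_matrix G" "bose_mesner G" E
  proof
    show "1 \<le> D" by (rule D)
    show "E 0 = (\<chi> x y. 1 / real CARD('v))" using E by (simp add: idempotent_ordering_def)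
    fix i j assume ij: "i \<le> D" "j \<le> D" "i \<noteq> j"
    define q where "q = (THE q. (\<forall>l>D. q l = 0) \<and>
      entrywise_product (E i) (E j) = (1 / real CARD('v)) *\<^sub>R (\<Sum>l\<le>D. q l *\<^sub>R E l))"
    have "entrywise_product (E i) (E j) = (1 / real CARD('v)) *\<^sub>R (\<Sum>l\<le>D. q l *\<^sub>R E l)"
      unfolding q_def using theI'[OF bm.krein_expand[OF ij(1,2)]] by blast
    then have "entrywise_product (E i) (E j) = (\<Sum>l\<le>D. (q l / real CARD('v)) *\<^sub>R E l)"
      by (simp add: scaleR_sum_right)
    note c = bm.expand_entrywise_coeff[OF ij(1,2) D this]
    have "bm.S i j 1 \<noteq> 0 \<longleftrightarrow> q 1 \<noteq> 0"
      using c bm.E_trace_pos[OF D] by auto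
    also have "\<dots> \<longleftrightarrow> \<bar>int i - int j\<bar> = 1"
      using QE ij by (simp add: Q_polynomial_wrt_def krein_parameter_def q_def)
    finally show "bm.S i j 1 \<noteq> 0 \<longleftrightarrow> \<bar>int i - int j\<bar> = 1" .
  qed
  show ?thesis by (rule q.q_poly_metric_exists)
qed

lemma valency_eq:
  assumes "has_valency G k'" "1 \<le> D"
  shows "k = k'"
proof -
  fix x
  have "card {y. (x, y) \<in> R} = k'" using assms full by (simp add: has_valency_def)
  then show ?thesis using card_nbrs[OF assms(2), of x] by (simp only: gdist_1)
qed

lemma hexagonal_no_triangle:
  assumes "hexagonal R" "gdist G x y = 1" "gdist G x z = 1"
  shows "gdist G y z \<noteq> 1"
proof
  assume "gdist G y z = 1"
  then have e: "(x, y) \<in> R" "(y, z) \<in> R" "(z, x) \<in> R" using assms gdist_1 R_sym by auto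
  then have "distinct [x, y, z]" using R_irrefl by auto
  then show False using e assms(1) unfolding hexagonal_def by blast
qed

lemma hexagonal_no_square:
  assumes hex: "hexagonal R" and xy: "gdist G x y = 2" and w: "gdist G x w = 1" "gdist G w y = 1" "gdist G x w' = 1" "gdist G w' y = 1"
  shows "w = w'"
proof (rule ccontr)
  assume "w \<noteq> w'"
  have e: "(x, w) \<in> R" "(w, y) \<in> R" "(y, w') \<in> R" "(w', x) \<in> R" using w gdist_1 R_sym by auto
  moreover have "x \<noteq> y" using xy by auto
  ultimately have "distinct [x, w, y, w']" using R_irrefl \<open>w \<noteq> w'\<close> by auto
  then show False using e hex unfolding hexagonal_def by blast
qed

lemma hexagonal_no_pentagon:
  assumes hex: "hexagonal R" and d: "gdist G x y = 2" "gdist G x z = 2"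
  shows "gdist G y z \<noteq> 1"
proof
  assume yz: "gdist G y z = 1"
  obtain u where u: "gdist G x u = 1" "gdist G u y = 1" using d_step[of x y 1] d by auto
  obtain v where v: "gdist G x v = 1" "gdist G v z = 1" using d_step[of x z 1] d by auto
  have e: "(x, u) \<in> R" "(u, y) \<in> R" "(y, z) \<in> R" "(z, v) \<in> R" "(v, x) \<in> R" using u v yz gdist_1 R_sym by auto
  have "u \<noteq> v" using hexagonal_no_triangle[OF hex, of u y z] u v yz gdist_sym by auto
  moreover have "x \<noteq> y" "x \<noteq> z" using d by auto
  moreover have "u \<noteq> z" "v \<noteq> y" using u v d by auto
  ultimately have "distinct [x, u, y, z, v]" using e R_irrefl by auto
  then show False using e hex unfolding hexagonal_def by blast
qed

text \<open>In the absence of shorter cycles, opposite vertices of a hexagon are at distance 3, and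
  both ways round contribute to \<open>C x3 x0\<close>. This is how the existence of a hexagon
  enters \<open>q_poly_girth_6\<close>.\<close>

lemma hexagonal_c_3:
  assumes hex: "hexagonal R"
  shows "2 \<le> c 3"
proof -
  obtain x0 x1 x2 x3 x4 x5 where e: "(x0, x1) \<in> R" "(x1, x2) \<in> R" "(x2, x3) \<in> R" "(x3, x4) \<in> R" "(x4, x5) \<in> R" "(x5, x0) \<in> R"
    and dist: "distinct [x0, x1, x2, x3, x4, x5]" using hex unfolding hexagonal_def by blast
  have d2: "gdist G a c = 2" if "(a, b) \<in> R" "(b, c) \<in> R" "a \<noteq> c" for a b c
  proof -
    have "gdist G a c \<le> 2" using gdist_relpowI[of a c 2] that by (auto simp: numeral_2_eq_2)
    moreover have "gdist G a c \<noteq> 1" using hexagonal_no_triangle[OF hex, of b a c] that gdist_1 gdist_sym by metis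
    moreover have "gdist G a c \<noteq> 0" using that gdist_0 by auto
    ultimately show ?thesis by linarith
  qed
  have "gdist G x0 x2 = 2" using d2 e dist by auto
  have x04: "gdist G x4 x0 = 2" using d2[of x4 x5 x0] e dist by auto
  have "gdist G x0 x3 \<le> 3"
    using gdist_relpowI[of x0 x3 3] e by (auto simp: numeral_3_eq_3)
  moreover have "gdist G x0 x3 \<noteq> 2"
    using hexagonal_no_pentagon[OF hex \<open>gdist G x0 x2 = 2\<close>, of x3] e gdist_1 by auto
  moreover have "gdist G x0 x3 \<noteq> 1"
    using hexagonal_no_square[OF hex \<open>gdist G x0 x2 = 2\<close>, of x1 x3] e dist gdist_1 R_sym by auto
  moreover have "gdist G x0 x3 \<noteq> 0" using dist gdist_0 by auto
  ultimately have x03: "gdist G x0 x3 = 3" by linarith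
  then have "x3 \<noteq> x0" by auto
  have "x2 \<in> C x3 x0" "x4 \<in> C x3 x0"
    using \<open>gdist G x0 x2 = 2\<close> x04 x03 e gdist_1 R_sym gdist_sym[of x2 x0] gdist_sym[of x3 x0] by (auto simp: in_C simp del: One_nat_def)
  then have "card {x2, x4} \<le> card (C x3 x0)" by (intro card_mono) auto
  then show ?thesis using card_C[OF \<open>x3 \<noteq> x0\<close>] x03 dist gdist_sym[of x3 x0] by simp
qed

lemma ex_q_poly_girth_6:
  assumes "Q_polynomial G" "hexagonal R" "3 \<le> D" "3 \<le> k"
  shows "\<exists>t \<theta>. q_poly_girth_6 (gdist G) D (intersection_number G) t \<theta>"
proof -
  obtain t \<theta> where q: "q_poly_metric (gdist G) D (intersection_number G) t \<theta>"
    using ex_q_poly_metric assms by fastforce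
  interpret q: q_poly_metric "gdist G" D "intersection_number G" t \<theta> by (rule q)
  have "q_poly_girth_6 (gdist G) D (intersection_number G) t \<theta>"
    by unfold_locales
      (use assms hexagonal_no_triangle hexagonal_no_square hexagonal_no_pentagon hexagonal_c_3 in blast)+
  then show ?thesis by blast
qed

text \<open>Bipartiteness excludes odd cycles and \<open>c 2 = 1\<close> excludes squares. Two
  vertices at distance 3 have \<open>c 3 = k'\<close> neighbours of one nearer to the other;
  geodesics through two of these close a hexagon.\<close>

lemma generalized_hexagon_hexagonal:
  assumes gh: "generalized_hexagon k' G" and k': "3 \<le> k'"
  shows "hexagonal R"
proof -
  have D3: "D = 3" using gh by (simp add: generalized_hexagon_def)
  have ia: "has_intersection_array G [k', k' - 1, k' - 1] [1, 1, k']" using gh by (simp add: generalized_hexagon_def)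
  then have "\<forall>i<3. [1, 1, k'] ! i = intersection_number G (Suc i) 1 i" using D3 by (simp add: has_intersection_array_def)
  from this[rule_format, of 1] this[rule_format, of 2] have "c 2 = 1" "c 3 = k'"
    by (simp_all add: c_def numeral_2_eq_2 numeral_3_eq_3)
  have "bipartite G" using gh by (simp add: generalized_hexagon_def)
  then obtain P Q where PQ0: "P \<inter> Q = {}" "\<forall>(x, y)\<in>R. x \<in> P \<and> y \<in> Q \<or> x \<in> Q \<and> y \<in> P"
    unfolding bipartite_def by (elim exE conjE) (rule that, assumption+)
  have PQ: "x \<in> P \<longleftrightarrow> y \<notin> P" if "(x, y) \<in> R" for x y
    using bspec[OF PQ0(2) that] PQ0(1) by auto
  have tri: "gdist G a b = 2" if "(a, w) \<in> R" "(w, b) \<in> R" "a \<noteq> b" for a b w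
  proof -
    have "gdist G a b \<le> 2" using gdist_relpowI[of a b 2] that by (auto simp: numeral_2_eq_2)
    moreover have "(a, b) \<notin> R" using that PQ by blast
    then have "gdist G a b \<noteq> 1" using gdist_1 by simp
    moreover have "gdist G a b \<noteq> 0" using that gdist_0 by auto
    ultimately show ?thesis by linarith
  qed
  have square: "w = w'" if "(a, w) \<in> R" "(w, b) \<in> R" "(a, w') \<in> R" "(w', b) \<in> R" "a \<noteq> b" for a b w w'
  proof -
    have ab: "gdist G a b = 2" using tri that by blast
    have "w \<in> C a b" "w' \<in> C a b" using that ab gdist_1 by (auto simp: in_C simp del: One_nat_def)
    moreover have "card (C a b) = 1" using card_C[OF \<open>a \<noteq> b\<close>] ab \<open>c 2 = 1\<close> by simp
    ultimately show ?thesis by (metis card_1_singletonE singletonD)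
  qed
  obtain y z where yz: "gdist G y z = 3" using ex_gdist D3 by auto
  then have "y \<noteq> z" by auto
  have "2 \<le> card (C y z)" using card_C[OF \<open>y \<noteq> z\<close>] yz \<open>c 3 = k'\<close> k' by simp
  then obtain u u' where u: "u \<in> C y z" "u' \<in> C y z" "u \<noteq> u'" using card_ge_2_imp_ex_neq by blast
  have uz: "gdist G u z = Suc 1" "gdist G u' z = Suc 1" using u yz by (auto simp: in_C)
  obtain v where v: "gdist G u v = 1" "gdist G v z = 1" using d_step[OF uz(1)] by blast
  obtain v' where v': "gdist G u' v' = 1" "gdist G v' z = 1" using d_step[OF uz(2)] by blast
  have e: "(y, u) \<in> R" "(u, v) \<in> R" "(v, z) \<in> R" "(z, v') \<in> R" "(v', u') \<in> R" "(u', y) \<in> R"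
    using u v v' gdist_1 R_sym by (auto simp: in_C simp del: One_nat_def)
  have "y \<noteq> v" "y \<noteq> v'" using v v' yz by auto
  have "v \<noteq> v'" using square[of y u v u'] u e R_sym \<open>y \<noteq> v\<close> by auto
  moreover have "u \<noteq> z" "u' \<noteq> z" using uz by auto
  moreover have "u \<noteq> v'" "u' \<noteq> v" using uz v v' by auto
  ultimately have "distinct [y, u, v, z, v', u']"
    using e R_irrefl \<open>y \<noteq> z\<close> \<open>y \<noteq> v\<close> \<open>y \<noteq> v'\<close> u by auto
  then have ex: "\<exists>a b c d e f. (a, b) \<in> R \<and> (b, c) \<in> R \<and> (c, d) \<in> R \<and> (d, e) \<in> R \<and> (e, f) \<in> R \<and> (f, a) \<in> R \<and> distinct [a, b, c, d, e, f]"
    using e by blast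
  show ?thesis unfolding hexagonal_def
  proof (intro conjI allI impI ex)
    fix a b c assume "(a, b) \<in> R \<and> (b, c) \<in> R \<and> (c, a) \<in> R"
    then show "\<not> distinct [a, b, c]" using PQ by blast
  next
    fix a b c d assume *: "(a, b) \<in> R \<and> (b, c) \<in> R \<and> (c, d) \<in> R \<and> (d, a) \<in> R"
    then show "\<not> distinct [a, b, c, d]" using square[of a b c d] R_sym by auto
  next
    fix a b c d e assume "(a, b) \<in> R \<and> (b, c) \<in> R \<and> (c, d) \<in> R \<and> (d, e) \<in> R \<and> (e, a) \<in> R"
    then show "\<not> distinct [a, b, c, d, e]" using PQ by blast
  qed
qed

end

section \<open>The case \<open>c 3 = k\<close>: the generalized hexagon\<close>

context q_poly_girth_6
begin

lemma odd_like_if_not_full: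
  assumes "c 3 < k"
  shows odd_like
  using odd_like_of_large_diameter odd_like_of_diameter_3 assms D_ge_3 by (cases "D = 3") auto

lemma full_diameter_3:
  assumes "\<not> c 3 < k"
  shows "D = 3" "c 3 = k"
proof -
  show "D = 3" using c_lt[of 3] assms D_ge_3 by force
  then show "c 3 = k" using c_le_k[of 3] assms by simp
qed

text \<open>Below the diameter this is \<open>no_equal\<close>; at distance 3 all \<open>k\<close>
  neighbours are nearer. It yields the bipartition.\<close>

lemma full_no_equal:
  assumes full: "\<not> c 3 < k" and xy: "d x y = 1"
  shows "d x z \<noteq> d y z"
proof
  assume eq: "d x z = d y z"
  have D3: "D = 3" "c 3 = k" by (rule full_diameter_3[OF full])+
  have "\<not> d y z < D" using no_equal[of "d y z" y z x] eq xy by auto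
  then have yz: "d y z = 3" using D3 d_le[of y z] by simp
  then have ne: "y \<noteq> z" by auto
  have "C y z = {w. d y w = 1}"
    using card_C[OF ne] yz D3 card_nbrs[of y] by (intro card_subset_eq) (auto simp: in_C)
  then have "x \<in> C y z" using xy d_sym[of x y] by simp
  then show False using eq by (simp add: in_C)
qed

lemma full_intersection_numbers:
  assumes full: "\<not> c 3 < k"
  shows "p 0 1 1 = k" "p 1 1 2 = k - 1" "p 2 1 3 = k - 1" "p 1 1 0 = 1" "p 2 1 1 = 1" "p 3 1 2 = k"
proof -
  have D3: "D = 3" "c 3 = k" by (rule full_diameter_3[OF full])+
  have b: "p h 1 (Suc h) = k - c h" if h: "1 \<le> h" "h < D" for h
  proof -
    obtain y z where yz: "d y z = h" using ex_dist[of h] h by fastforce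
    then have "y \<noteq> z" using h by auto
    then show ?thesis using card_far[of y z] regular[of 1 "Suc h" y z] yz h by simp
  qed
  show "p 0 1 1 = k" by (simp add: k_def)
  show "p 1 1 2 = k - 1" using b[of 1] c_1 D3 by (simp add: numeral_2_eq_2)
  show "p 2 1 3 = k - 1" using b[of 2] c_2 D3 by simp
  show "p 1 1 0 = 1" "p 2 1 1 = 1" "p 3 1 2 = k" using c_1 c_2 D3 by (simp_all add: c_def)
qed

end

theorem theorem6p7:
  fixes G :: "('v::finite) pair_pre_digraph" and D k :: nat
  assumes "pverts G = UNIV"
    and "distance_regular G"
    and "Q_polynomial G"
    and "D = graph_diameter G" and "D \<ge> 3"
    and "has_valency G k" and "k \<ge> 3"
  shows "girth G = 6 \<longleftrightarrow>
    digraph_iso (with_proj G) (with_proj (odd_graph D)) \<or>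
    (\<exists>H :: 'v pair_pre_digraph. generalized_hexagon k H \<and>
       digraph_iso (with_proj G) (with_proj H))"
proof -
  interpret full_graph G using assms by unfold_locales
  have D: "D = graph_diameter G" "3 \<le> graph_diameter G" "1 \<le> graph_diameter G" using assms by simp_all
  have val: "drg_metric.k (intersection_number G) = k" using valency_eq assms(6) D(3) by blast
  have wf: "pair_wf_digraph H" if "pair_graph H" for H :: "'v pair_pre_digraph"
  proof -
    interpret H: pair_graph H by (rule that)
    show ?thesis by (rule H.pair_wf_digraph_axioms)
  qed
  have wfG: "pair_wf_digraph G" using wf pair_graph by blast
  have odd_sub: "parcs (odd_graph n) \<subseteq> pverts (odd_graph n) \<times> pverts (odd_graph n)" for n
    by (auto simp: odd_graph_def)
  show ?thesis unfolding girth_6_iff[OF wfG]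
  proof
    assume hex: "hexagonal (parcs G)"
    obtain t \<theta> where q: "q_poly_girth_6 (gdist G) (graph_diameter G) (intersection_number G) t \<theta>"
      using ex_q_poly_girth_6[OF assms(3) hex D(2)] val assms(7) by auto
    interpret q: q_poly_girth_6 "gdist G" "graph_diameter G" "intersection_number G" t \<theta> by (rule q)
    show "digraph_iso (with_proj G) (with_proj (odd_graph D)) \<or>
      (\<exists>H :: 'v pair_pre_digraph. generalized_hexagon k H \<and> digraph_iso (with_proj G) (with_proj H))"
    proof (cases "c 3 < drg_metric.k (intersection_number G)")
      case True
      then have ol: "q_poly_girth_6.odd_like (intersection_number G) t" by (rule q.odd_like_if_not_full)
      interpret o: q_poly_odd_like "gdist G" "graph_diameter G" "intersection_number G" t \<theta>
        by unfold_locales (rule ol)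
      obtain f :: "'v \<Rightarrow> nat set" where f: "bij_betw f UNIV {S. S \<subseteq> {..<2 * D + 1} \<and> card S = D}"
        and fe: "\<And>x y. gdist G x y = 1 \<longleftrightarrow> f x \<inter> f y = {}"
        using o.ex_odd_graph_isomorphism D(1) by auto
      have im: "f x \<subseteq> {..<2 * D + 1}" "card (f x) = D" for x using f by (auto simp: bij_betw_def)
      have "\<forall>x\<in>pverts G. \<forall>y\<in>pverts G. (x, y) \<in> parcs G \<longleftrightarrow> (f x, f y) \<in> parcs (odd_graph D)"
        using fe im gdist_1 by (simp add: odd_graph_def)
      moreover have "bij_betw f (pverts G) (pverts (odd_graph D))" using f assms(1) by (simp add: odd_graph_def)
      ultimately have "digraph_iso (with_proj G) (with_proj (odd_graph D))"
        unfolding digraph_iso_pair_iff[OF wfG odd_sub] by blast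
      then show ?thesis by blast
    next
      case False
      have D3: "graph_diameter G = 3" by (rule q.full_diameter_3(1)[OF False])
      have bip: "bipartite G"
      proof -
        fix z
        \<comment> \<open>Adjacent vertices are never equidistant from \<open>z\<close>, so the
          parity of the distance to any fixed vertex is a proper 2-colouring.\<close>
        let ?P = "{x. even (gdist G x z)}" and ?Q = "{x. odd (gdist G x z)}"
        have "x \<in> ?P \<and> y \<in> ?Q \<or> x \<in> ?Q \<and> y \<in> ?P" if "(x, y) \<in> parcs G" for x y
        proof -
          have xy: "gdist G x y = 1" using that gdist_1 by simp
          have "gdist G x z = Suc (gdist G y z) \<or> Suc (gdist G x z) = gdist G y z"
            using q.adj_dist_cases[OF xy, of z] q.full_no_equal[OF False xy, of z] by blast
          then have "even (gdist G x z) \<longleftrightarrow> odd (gdist G y z)" by (metis even_Suc)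
          then show ?thesis by auto
        qed
        then show ?thesis unfolding bipartite_def assms(1)
          by (intro exI[of _ ?P] exI[of _ ?Q]) auto
      qed
      have "has_intersection_array G [k, k - 1, k - 1] [1, 1, k]"
        unfolding has_intersection_array_def D3
        using q.full_intersection_numbers[OF False] val
        by (auto simp: less_Suc_eq numeral_3_eq_3 numeral_2_eq_2 nth_Cons')
      then have "generalized_hexagon k G" using bip D3 assms(2) by (simp add: generalized_hexagon_def)
      moreover have "digraph_iso (with_proj G) (with_proj G)"
      proof -
        have sub: "parcs G \<subseteq> pverts G \<times> pverts G" using assms(1) by auto
        show ?thesis unfolding digraph_iso_pair_iff[OF wfG sub] by (intro exI[of _ id]) simp
      qed
      ultimately show ?thesis by blast
    qed
  next
    assume "digraph_iso (with_proj G) (with_proj (odd_graph D)) \<or>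
      (\<exists>H :: 'v pair_pre_digraph. generalized_hexagon k H \<and> digraph_iso (with_proj G) (with_proj H))"
    then show "hexagonal (parcs G)"
    proof
      assume "digraph_iso (with_proj G) (with_proj (odd_graph D))"
      then obtain f where f: "bij_betw f (pverts G) (pverts (odd_graph D))"
        "\<And>x y. x \<in> pverts G \<Longrightarrow> y \<in> pverts G \<Longrightarrow> (x, y) \<in> parcs G \<longleftrightarrow> (f x, f y) \<in> parcs (odd_graph D)"
        unfolding digraph_iso_pair_iff[OF wfG odd_sub] by blast
      show ?thesis
        by (rule hexagonal_transfer[OF f _ odd_sub odd_graph_hexagonal]) (use assms in auto)
    next
      assume "\<exists>H :: 'v pair_pre_digraph. generalized_hexagon k H \<and> digraph_iso (with_proj G) (with_proj H)"
      then obtain H :: "'v pair_pre_digraph" where gh: "generalized_hexagon k H"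
        and iso: "digraph_iso (with_proj G) (with_proj H)" by blast
      have drH: "distance_regular H" using gh by (simp add: generalized_hexagon_def)
      then have "pair_graph H" by (simp add: distance_regular_def)
      then have sub: "parcs H \<subseteq> pverts H \<times> pverts H"
        using pair_wf_digraph.in_arcsD1[OF wf] pair_wf_digraph.in_arcsD2[OF wf] by auto
      obtain f where f: "bij_betw f (pverts G) (pverts H)"
        "\<And>x y. x \<in> pverts G \<Longrightarrow> y \<in> pverts G \<Longrightarrow> (x, y) \<in> parcs G \<longleftrightarrow> (f x, f y) \<in> parcs H"
        using iso unfolding digraph_iso_pair_iff[OF wfG sub] by blast
      \<comment> \<open>\<open>H\<close> lives on the same finite type as \<open>G\<close>, so equal
        cardinality makes its vertex set the whole type, as \<open>full_graph\<close>
        requires.\<close>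
      have "card (pverts H) = card (UNIV :: 'v set)" using bij_betw_same_card[OF f(1)] assms(1) by simp
      then have "pverts H = UNIV" by (intro card_subset_eq) auto
      then interpret H: full_graph H using drH by unfold_locales
      have "hexagonal (parcs H)" by (rule H.generalized_hexagon_hexagonal[OF gh assms(7)])
      note tr = hexagonal_transfer[OF f _ sub this]
      show ?thesis by (rule tr) (use assms in auto)
    qed
  qed
qed

end
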